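(* Let $\gamma\in(0,1]$ and let $f_0\in\mathcal P_2(\mathbb R^3)$. Then there exists a weak solution $(f_t)_{t\ge0}$ to the Landau equation with parameter $\gamma$ starting at $f_0$.
   Context: For $q>0$ and a probability measure $f$ on $\mathbb R^3$, $m_q(f)=\int_{\mathbb R^3}|v|^q f(\mathrm dv)$, and $\mathcal P_q(\mathbb R^3)$ is the set of probability measures $f$ on $\mathbb R^3$ with $m_q(f)<\infty$. Landau equation: for $\gamma\in(0,1]$ and $x\in\mathbb R^3$ let $a(x)=|x|^{2+\gamma}\big(\mathbf I_3-\frac{xx^*}{|x|^2}\big)$ (with $a(0)=0$) and $b(x)=-2|x|^\gamma x$. For $\varphi\in C^2_b(\mathbb R^3)$ (bounded $C^2$ with bounded derivatives up to order 2) put $$\mathcal L\varphi(v,v_* )=\tfrac12\sum_{k,\ell=1}^3 a_{k\ell}(v-v_* )\partial^2_{k\ell}\varphi(v)+\sum_{k=1}^3 b_k(v-v_* )\partial_k\varphi(v).$$ A weak solution to the Landau equation is a family $(f_t)_{t\ge0}$ of probability measures on $\mathbb R^3$ such that $\sup_{t\in[0,T]}m_2(f_t)+\int_0^T m_{2+\gamma}(f_t)\,\mathrm dt<\infty$ for all $T>0$, $m_2(f_t)\le m_2(f_0)$ for all $t\ge0$, and for all $\varphi\in C^2_b(\mathbb R^3)$ and $t\ge0$, $$\int_{\mathbb R^3}\varphi(v)f_t(\mathrm dv)=\int_{\mathbb R^3}\varphi(v)f_0(\mathrm dv)+\int_0^t\int_{\mathbb R^3}\int_{\mathbb R^3}\mathcal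 L\varphi(v,v_* )f_s(\mathrm dv_* )f_s(\mathrm dv)\,\mathrm ds.$$ *)

theory Defs
  imports "HOL-Probability.Probability"
begin

definition moment :: "real \<Rightarrow> (real^3) measure \<Rightarrow> ennreal" where
  "moment q f = (\<integral>\<^sup>+v. ennreal (norm v powr q) \<partial>f)"

definition prob_measures :: "(real^3) measure set" where
  "prob_measures = {f. prob_space f \<and> sets f = sets borel}"

definition prob_measures_moment :: "real \<Rightarrow> (real^3) measure set" where
  "prob_measures_moment q = {f \<in> prob_measures. moment q f < \<infinity>}"

definition landau_a :: "real \<Rightarrow> real^3 \<Rightarrow> real^3^3" where
  "landau_a \<gamma> x =
     (if x = 0 then 0
      else (norm x powr (2 + \<gamma>)) *\<^sub>R (mat 1 - (1 / (norm x)\<^sup>2) *\<^sub>R (\<chi> k l. x $ k * x $ l)))"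

definition landau_b :: "real \<Rightarrow> real^3 \<Rightarrow> real^3" where
  "landau_b \<gamma> x = (- 2 * norm x powr \<gamma>) *\<^sub>R x"

definition partial_deriv :: "3 \<Rightarrow> (real^3 \<Rightarrow> real) \<Rightarrow> real^3 \<Rightarrow> real" where
  "partial_deriv k \<phi> v = frechet_derivative \<phi> (at v) (axis k 1)"

text \<open>Bounded functions of class \<open>C\<^sup>2\<close> whose derivatives of order one and two are bounded.
  Continuity of the first derivatives follows from their differentiability.\<close>

definition C2b :: "(real^3 \<Rightarrow> real) set" where
  "C2b = {\<phi>.
     bounded (range \<phi>) \<and> \<phi> differentiable_on UNIV \<and>
     (\<forall>k. bounded (range (partial_deriv k \<phi>)) \<and> partial_deriv k \<phi> differentiable_on UNIV) \<and>
     (\<forall>k l. bounded (range (partial_deriv k (partial_deriv l \<phi>))) \<and>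
            continuous_on UNIV (partial_deriv k (partial_deriv l \<phi>)))}"

definition landau_L :: "real \<Rightarrow> (real^3 \<Rightarrow> real) \<Rightarrow> real^3 \<Rightarrow> real^3 \<Rightarrow> real" where
  "landau_L \<gamma> \<phi> v w =
     1 / 2 * (\<Sum>k\<in>UNIV. \<Sum>l\<in>UNIV. landau_a \<gamma> (v - w) $ k $ l * partial_deriv k (partial_deriv l \<phi>) v)
     + (\<Sum>k\<in>UNIV. landau_b \<gamma> (v - w) $ k * partial_deriv k \<phi> v)"

definition landau_action :: "real \<Rightarrow> (real^3 \<Rightarrow> real) \<Rightarrow> (real^3) measure \<Rightarrow> real" where
  "landau_action \<gamma> \<phi> f = (\<integral>v. (\<integral>w. landau_L \<gamma> \<phi> v w \<partial>f) \<partial>f)"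

text \<open>Only the values \<open>f t\<close> with \<open>t \<ge> 0\<close> matter.  The measurability and integrability clauses say
  that the time integrals are meaningful: the library integrals are total, so a non-measurable
  integrand would otherwise give a lower integral (for \<open>moment\<close>) or the value 0 (for
  \<open>landau_action\<close>).  The integrals over velocities need no such clause:
  \<open>\<bar>landau_L \<gamma> \<phi> v w\<bar> \<le> C * (1 + norm v powr (2 + \<gamma>) + norm w powr (2 + \<gamma>))\<close> for \<open>\<phi> \<in> C2b\<close>,
  and \<open>moment (2 + \<gamma>) (f s)\<close> is finite for almost every \<open>s \<ge> 0\<close>.\<close>

definition landau_weak_solution :: "real \<Rightarrow> (real \<Rightarrow> (real^3) measure) \<Rightarrow> bool" where
  "landau_weak_solution \<gamma> f \<longleftrightarrow>
     (\<forall>t\<ge>0. f t \<in> prob_measures) \<and>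
     (\<lambda>t. moment (2 + \<gamma>) (f t)) \<in> borel_measurable (restrict_space borel {0..}) \<and>
     (\<forall>T>0. (SUP t\<in>{0..T}. moment 2 (f t))
              + (\<integral>\<^sup>+t\<in>{0..T}. moment (2 + \<gamma>) (f t) \<partial>lborel) < \<infinity>) \<and>
     (\<forall>t\<ge>0. moment 2 (f t) \<le> moment 2 (f 0)) \<and>
     (\<forall>\<phi>\<in>C2b. \<forall>t\<ge>0.
        set_integrable lborel {0..t} (\<lambda>s. landau_action \<gamma> \<phi> (f s)) \<and>
        (\<integral>v. \<phi> v \<partial>f t) = (\<integral>v. \<phi> v \<partial>f 0) + (LINT s:{0..t}|lborel. landau_action \<gamma> \<phi> (f s)))"

end

theory Submission
  imports Defs
begin

text \<open>The solution is a limit of time-discrete collision processes.  In one step of length \<open>h\<close>, two independent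
  velocities \<open>v\<close> and \<open>w\<close> collide: \<open>v - w\<close> is rotated about a random coordinate axis, by an angle of order
  \<open>sqrt (h * norm (v - w) powr \<gamma>)\<close>, and \<open>v + w\<close> is kept.  Energy is conserved exactly, and a test function
  \<open>\<phi>\<close> changes on average by \<open>h * landau_L \<gamma> \<phi> v w\<close> up to lower order.

  The functional with density \<open>r\<^sup>2 / (R + r)\<close>, \<open>r = (norm v)\<^sup>2\<close>, is convex in \<open>r\<close> and bounded by the energy; collisions
  dissipate it at a rate controlling the part of the moment of order \<open>2 + \<gamma>\<close> above level \<open>R\<close>.  Letting
  \<open>R\<close> tend to infinity, \<open>norm v powr (2 + \<gamma>)\<close> is uniformly integrable in time and velocity as soon as the initial
  energy is finite.  The errors of the discretization involve sixth moments; these are finite for truncated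
  initial data and disappear because the time step is chosen after the truncation.

  Uniform integrability gives equicontinuity in time, hence a subsequence converging weakly at all times, and it
  allows the quadratic, unbounded collision term to pass to the limit.\<close>

section \<open>Vectors coded by reals: a space-filling curve\<close>

text \<open>The collision term grows like \<open>norm v powr (2 + \<gamma>)\<close>, while the datum
  has no moment above the second. A bound on the time integral of that moment alone would not
  exclude a loss in the limit of the action, so uniform integrability is the real target. It closes
  because the gain in the dissipation inequality carries a factor 1 / R: at one fixed level the gain
  is absorbed, which bounds the time integral of the full moment; at a large level this bound leaves
  only the initial tail energy, a term of order 1 / R, and the error of the discretization.

  The rational density is convenient because its sum over a colliding pair depends, besides the
  conserved sum of the energies, only on the product of the two denominators, and the reciprocal of
  that product can be expanded with an exact remainder.

  Compactness rests on an almost sure representation of weakly convergent laws. Two independent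
  copies of it represent the product measures, so the quadratic term is handled by dominated
  convergence.\<close>

definition schoenberg_hat :: "real \<Rightarrow> real" where
  "schoenberg_hat t = max 0 (min 1 (1 / 2 - cos (pi * t)))"

text \<open>Coordinates of a Schoenberg space-filling curve, for i = 0, 1, 2. The clipped cosine
  \<open>schoenberg_hat\<close> has period 2, vanishes on [0, 1/3] and equals 1 on [2/3, 1], so it
  decodes a ternary digit 0 or 2; the exponents 3 n + i let the three coordinates read disjoint sets
  of digits.\<close>

definition schoenberg :: "nat \<Rightarrow> real \<Rightarrow> real" where
  "schoenberg i t = (\<Sum>n. schoenberg_hat (3 ^ (3 * n + i) * t) / 2 ^ Suc n)"

lemma schoenberg_hat_bounds: "0 \<le> schoenberg_hat t" "schoenberg_hat t \<le> 1"
  by (auto simp: schoenberg_hat_def)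

lemma summable_half_Suc: "summable (\<lambda>n. 1 / 2 ^ Suc n :: real)"
  using power_half_series sums_summable by (auto simp: power_one_over)

lemma continuous_on_schoenberg: "continuous_on UNIV (schoenberg i)"
proof -
  have "uniform_limit UNIV (\<lambda>n x. \<Sum>k<n. schoenberg_hat (3 ^ (3 * k + i) * x) / 2 ^ Suc k)
     (\<lambda>x. \<Sum>k. schoenberg_hat (3 ^ (3 * k + i) * x) / 2 ^ Suc k) sequentially"
    by (rule Weierstrass_m_test[OF _ summable_half_Suc])
      (use schoenberg_hat_bounds in \<open>auto simp: divide_right_mono\<close>)
  then show ?thesis
    unfolding schoenberg_def[abs_def]
    by (rule uniform_limit_theorem[rotated])
      (auto simp: schoenberg_hat_def intro!: always_eventually continuous_intros)
qed

text \<open>Iteration of the doubling map: each digit is the integer part of twice the current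
  fractional part, and after N digits the partial sum misses y by exactly
  \<open>frac (2 ^ N * y) / 2 ^ N\<close>.\<close>

lemma binary_expansion_exists:
  fixes y :: real
  assumes "0 \<le> y" "y < 1"
  shows "\<exists>a :: nat \<Rightarrow> real. (\<forall>n. a n = 0 \<or> a n = 1) \<and> (\<lambda>n. a n / 2 ^ Suc n) sums y"
proof -
  define a :: "nat \<Rightarrow> real" where "a n = of_int \<lfloor>2 * frac (2 ^ n * y)\<rfloor>" for n
  have a01: "a n = 0 \<or> a n = 1" for n
  proof -
    have "0 \<le> 2 * frac (2 ^ n * y)" "2 * frac (2 ^ n * y) < 2"
      using frac_lt_1[of "2 ^ n * y"] by auto
    then have "\<lfloor>2 * frac (2 ^ n * y)\<rfloor> = 0 \<or> \<lfloor>2 * frac (2 ^ n * y)\<rfloor> = 1" by linarith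
    then show ?thesis unfolding a_def by auto
  qed
  have fr: "frac (2 ^ Suc n * y) = 2 * frac (2 ^ n * y) - a n" for n
  proof -
    have "2 ^ Suc n * y = of_int (2 * \<lfloor>2 ^ n * y\<rfloor>) + 2 * frac (2 ^ n * y)"
      by (simp add: frac_def algebra_simps)
    then have "frac (2 ^ Suc n * y) = frac (2 * frac (2 ^ n * y))"
      by (simp only: frac_add_of_int_left)
    then show ?thesis by (simp add: a_def frac_def)
  qed
  have part: "(\<Sum>n<N. a n / 2 ^ Suc n) = y - frac (2 ^ N * y) / 2 ^ N" for N
  proof (induction N)
    case 0
    then show ?case using assms by (simp add: frac_eq)
  next
    case (Suc N)
    have "(\<Sum>n<Suc N. a n / 2 ^ Suc n) = y - frac (2 ^ N * y) / 2 ^ N + a N / 2 ^ Suc N"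
      using Suc by simp
    also have "\<dots> = y - frac (2 ^ Suc N * y) / 2 ^ Suc N"
      unfolding fr by (simp add: field_simps)
    finally show ?case .
  qed
  have "(\<lambda>N. frac (2 ^ N * y) / 2 ^ N) \<longlonglongrightarrow> 0"
  proof (rule tendsto_sandwich[OF _ _ tendsto_const])
    show "\<forall>\<^sub>F n in sequentially. frac (2 ^ n * y) / 2 ^ n \<le> (1 / 2) ^ n"
      by (auto simp: power_one_over divide_right_mono less_imp_le[OF frac_lt_1])
    show "(\<lambda>n. (1 / 2) ^ n :: real) \<longlonglongrightarrow> 0" by (rule LIMSEQ_realpow_zero) auto
  qed auto
  then have "(\<lambda>N. \<Sum>n<N. a n / 2 ^ Suc n) \<longlonglongrightarrow> y - 0"
    unfolding part by (intro tendsto_intros)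
  then show ?thesis using a01 unfolding sums_def by auto
qed

text \<open>The binary digits of the three targets are interleaved and written, doubled, as the
  ternary digits of a single parameter.\<close>

lemma schoenberg_surj:
  assumes y: "\<And>i. i < 3 \<Longrightarrow> 0 \<le> y i \<and> y i < (1::real)"
  shows "\<exists>t\<in>{0..1}. \<forall>i<3. schoenberg i t = y i"
proof -
  have "\<forall>i. \<exists>a :: nat \<Rightarrow> real. i < 3 \<longrightarrow> (\<forall>n. a n = 0 \<or> a n = 1) \<and> (\<lambda>n. a n / 2 ^ Suc n) sums y i"
    using binary_expansion_exists y by blast
  then obtain a :: "nat \<Rightarrow> nat \<Rightarrow> real" where
    a: "\<And>i n. i < 3 \<Longrightarrow> a i n = 0 \<or> a i n = 1" "\<And>i. i < 3 \<Longrightarrow> (\<lambda>n. a i n / 2 ^ Suc n) sums y i"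
    by metis
  define b where "b k = a (k mod 3) (k div 3)" for k
  have b01: "b k = 0 \<or> b k = 1" for k unfolding b_def by (intro a) auto
  \<comment> \<open>\<open>t k\<close> has the digit sequence shifted by k as its ternary expansion;
    the parameter sought is \<open>t 0\<close>.\<close>
  define t where "t k = (\<Sum>j. 2 * b (j + k) / 3 ^ Suc j)" for k
  have geo: "(\<lambda>j. 2 / 3 ^ Suc j :: real) sums 1"
    using sums_mult[OF geometric_sums[of "1/3 :: real"], of "2/3"] by (simp add: power_one_over)
  have le: "0 \<le> 2 * b (j + k) / 3 ^ Suc j \<and> 2 * b (j + k) / 3 ^ Suc j \<le> 2 / 3 ^ Suc j" for j k
    using b01[of "j + k"] by (auto simp: field_simps)
  have summ: "summable (\<lambda>j. 2 * b (j + k) / 3 ^ Suc j)" for k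
  proof (rule summable_comparison_test'[OF sums_summable[OF geo], of 0])
    fix j
    show "norm (2 * b (j + k) / 3 ^ Suc j) \<le> 2 / 3 ^ Suc j"
      using le[of j k] by (simp only: real_norm_def abs_of_nonneg)
  qed
  have t01: "0 \<le> t k" "t k \<le> 1" for k
  proof -
    show "0 \<le> t k" unfolding t_def by (rule suminf_nonneg[OF summ]) (use le in blast)
    have "t k \<le> (\<Sum>j. 2 / 3 ^ Suc j)" unfolding t_def
      by (rule suminf_le[OF _ summ sums_summable[OF geo]]) (use le in blast)
    then show "t k \<le> 1" using sums_unique[OF geo] by simp
  qed
  have step: "3 * t k = 2 * b k + t (Suc k)" for k
  proof -
    have "t k = 2 * b k / 3 + (\<Sum>j. 2 * b (Suc j + k) / 3 ^ Suc (Suc j))"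
      unfolding t_def using suminf_split_head[OF summ[of k]] by simp
    also have "(\<Sum>j. 2 * b (Suc j + k) / 3 ^ Suc (Suc j)) = (\<Sum>j. (2 * b (j + Suc k) / 3 ^ Suc j) / 3)"
      by (intro suminf_cong) (simp add: field_simps)
    also have "\<dots> = t (Suc k) / 3" unfolding t_def by (rule suminf_divide[OF summ])
    finally show ?thesis by simp
  qed
  \<comment> \<open>All ternary digits are even, so multiplication by \<open>3 ^ k\<close> turns
    \<open>t 0\<close> into \<open>t k\<close> up to an even integer, that is, up to a period of the
    hat.\<close>
  have even_part: "\<exists>m::int. 3 ^ k * t 0 = 2 * of_int m + t k" for k
  proof (induction k)
    case 0
    then show ?case by (intro exI[of _ 0]) simp
  next
    case (Suc k)
    then obtain m :: int where m: "3 ^ k * t 0 = 2 * of_int m + t k" by blast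
    have "3 ^ Suc k * t 0 = 3 * (2 * of_int m + t k)" using m by simp
    also have "\<dots> = 2 * of_int (3 * m) + (2 * b k + t (Suc k))" using step[of k] by simp
    also have "\<dots> = 2 * of_int (if b k = 0 then 3 * m else 3 * m + 1) + t (Suc k)"
      using b01[of k] by auto
    finally show ?case by blast
  qed
  have hat: "schoenberg_hat (3 ^ k * t 0) = b k" for k
  proof -
    obtain m :: int where m: "3 ^ k * t 0 = 2 * of_int m + t k" using even_part by blast
    have "cos (pi * (3 ^ k * t 0)) = cos (pi * t k + of_int m * (2 * pi))"
      unfolding m by (simp add: algebra_simps)
    also have "\<dots> = cos (pi * t k)"
      using cos_int_2pin[of m] sin_int_2pin[of m] by (simp add: cos_add mult_ac)
    finally have c: "cos (pi * (3 ^ k * t 0)) = cos (pi * t k)" .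
    consider "b k = 0" | "b k = 1" using b01 by blast
    then show ?thesis
    proof cases
      case 1
      then have "t k \<le> 1/3" using step[of k] t01[of "Suc k"] by simp
      then have "pi * t k \<le> pi * (1/3)" by (intro mult_left_mono) auto
      then have "cos (pi / 3) \<le> cos (pi * t k)"
        using t01[of k] by (intro cos_monotone_0_pi_le) auto
      then show ?thesis using c 1 by (simp add: schoenberg_hat_def cos_60)
    next
      case 2
      then have "2/3 \<le> t k" using step[of k] t01[of "Suc k"] by simp
      then have "pi * (2/3) \<le> pi * t k" by (intro mult_left_mono) auto
      then have "cos (pi * t k) \<le> cos (pi * (2/3))"
        using t01[of k] by (intro cos_monotone_0_pi_le) auto
      also have "cos (pi * (2/3)) = - cos (pi / 3)"
        using cos_pi_minus[of "pi/3"] by (simp add: field_simps)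
      finally show ?thesis using c 2 by (simp add: schoenberg_hat_def cos_60)
    qed
  qed
  have "schoenberg i (t 0) = y i" if i: "i < 3" for i
  proof -
    have "schoenberg i (t 0) = (\<Sum>n. a i n / 2 ^ Suc n)"
      unfolding schoenberg_def hat using i by (simp add: b_def)
    then show ?thesis using sums_unique[OF a(2)[OF i]] by simp
  qed
  then show ?thesis using t01[of 0] by (intro bexI[of _ "t 0"]) auto
qed

lemma space_filling_curve_ball:
  "\<exists>Q :: real \<Rightarrow> real^3. continuous_on UNIV Q \<and> (\<forall>y. norm y < 1 \<longrightarrow> (\<exists>t\<in>{0..1}. Q t = y))"
proof -
  define idx :: "3 \<Rightarrow> nat" where "idx i = (if i = 1 then 0 else if i = 2 then 1 else 2)" for i
  define Q :: "real \<Rightarrow> real^3" where "Q t = (\<chi> i. 2 * schoenberg (idx i) t - 1)" for t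
  have "continuous_on UNIV Q"
    unfolding Q_def using continuous_on_schoenberg by (intro continuous_intros)
  moreover have "\<exists>t\<in>{0..1}. Q t = y" if y: "norm y < 1" for y
  proof -
    define z where "z n = (1 + y $ (if n = 0 then 1 else if n = Suc 0 then 2 else 3)) / 2" for n :: nat
    have b: "\<bar>y $ i\<bar> < 1" for i using component_le_norm_cart[of y i] y by simp
    have "0 \<le> z n \<and> z n < 1" for n
      using b[of 1] b[of 2] b[of 3] unfolding z_def by auto
    then obtain t where t: "t \<in> {0..1}" "\<forall>i<3. schoenberg i t = z i"
      using schoenberg_surj[of z] by blast
    have "schoenberg 0 t = z 0" "schoenberg 1 t = z 1" "schoenberg 2 t = z 2" using t(2) by auto
    then have "Q t $ i = y $ i" for i
      using exhaust_3[of i] by (auto simp: Q_def z_def idx_def)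
    then have "Q t = y" by (simp add: vec_eq_iff)
    with t show ?thesis by blast
  qed
  ultimately show ?thesis by blast
qed

text \<open>The code \<open>e v\<close> is the least parameter that the curve sends to the image of \<open>v\<close> in the unit ball; it
  is measurable because its sublevel sets are preimages of compact pieces of the curve.\<close>

lemma borel_coding_by_reals:
  obtains Q :: "real \<Rightarrow> real^3" and e :: "real^3 \<Rightarrow> real" where
    "continuous_on UNIV Q" "e \<in> borel_measurable borel"
    "\<And>v. e v \<in> {0..1}" "\<And>v. Q (e v) = v /\<^sub>R (1 + norm v)"
proof -
  obtain Q :: "real \<Rightarrow> real^3" where Q: "continuous_on UNIV Q"
    and sur: "\<And>y. norm y < 1 \<Longrightarrow> \<exists>t\<in>{0..1}. Q t = y"
    using space_filling_curve_ball by blast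
  define H :: "real^3 \<Rightarrow> real^3" where "H v = v /\<^sub>R (1 + norm v)" for v
  have nz: "1 + norm v \<noteq> 0" for v :: "real^3" by (metis add_nonneg_eq_0_iff norm_ge_zero zero_le_one zero_neq_one)
  have H: "continuous_on UNIV H" unfolding H_def by (intro continuous_intros) (use nz in auto)
  have normH: "norm (H v) < 1" for v
  proof -
    have "norm (H v) = norm v / (1 + norm v)" by (simp add: H_def divide_inverse mult.commute)
    also have "\<dots> < 1" by (simp add: divide_less_eq add_pos_nonneg)
    finally show ?thesis .
  qed
  define S where "S v = {t\<in>{0..1}. Q t = H v}" for v
  define e where "e v = Inf (S v)" for v
  have ne: "S v \<noteq> {}" for v using sur[OF normH[of v]] by (auto simp: S_def)
  have bdd: "bdd_below (S v)" for v by (auto simp: S_def intro!: bdd_belowI[of _ 0])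
  have cl: "closed (S v)" for v
  proof -
    have "S v = {0..1} \<inter> Q -` {H v}" by (auto simp: S_def)
    moreover have "closed (Q -` {H v})"
      using Q continuous_closed_vimage[of "{H v}" Q]
      by (auto simp: continuous_on_eq_continuous_at)
    ultimately show ?thesis by auto
  qed
  have eS: "e v \<in> S v" for v unfolding e_def by (intro closed_contains_Inf ne bdd cl)
  have meas: "e \<in> borel_measurable borel"
  proof (subst borel_measurable_iff_le, intro allI)
    fix a
    have "e v \<le> a \<longleftrightarrow> H v \<in> Q ` {0..min 1 a}" for v
    proof
      assume "e v \<le> a"
      then show "H v \<in> Q ` {0..min 1 a}" using eS[of v] by (auto simp: S_def intro!: image_eqI[of _ _ "e v"])
    next
      assume "H v \<in> Q ` {0..min 1 a}"
      then obtain t where t: "0 \<le> t" "t \<le> 1" "t \<le> a" "Q t = H v" by auto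
      then have "t \<in> S v" by (auto simp: S_def)
      then have "e v \<le> t" unfolding e_def by (intro cInf_lower bdd)
      then show "e v \<le> a" using t by simp
    qed
    then have "{w \<in> space borel. e w \<le> a} = H -` (Q ` {0..min 1 a})" by auto
    moreover have "closed (H -` (Q ` {0..min 1 a}))"
    proof (rule continuous_closed_vimage)
      show "closed (Q ` {0..min 1 a})"
        using Q by (intro compact_imp_closed compact_continuous_image) (auto intro: continuous_on_subset)
      show "isCont H x" for x using H by (auto simp: continuous_on_eq_continuous_at)
    qed
    ultimately show "{w \<in> space borel. e w \<le> a} \<in> sets borel" by auto
  qed
  show ?thesis
    by (rule that[OF Q meas]) (use eS in \<open>auto simp: S_def H_def\<close>)
qed

text \<open>Coding vectors by reals reduces the statement to Helly's and Skorohod's theorems on the line.  The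
  second moment prevents the limit from charging the unit sphere, that is, infinity.\<close>

lemma prokhorov_skorokhod:
  fixes \<mu> :: "nat \<Rightarrow> (real^3) measure"
  assumes \<mu>: "\<And>n. \<mu> n \<in> prob_measures" and K: "\<And>n. moment 2 (\<mu> n) \<le> K" "K < \<infinity>"
  obtains r \<Omega> X Y where "strict_mono r" "prob_space (\<Omega> :: real measure)"
    "\<And>n. X n \<in> \<Omega> \<rightarrow>\<^sub>M borel" "Y \<in> \<Omega> \<rightarrow>\<^sub>M borel" "\<And>n. distr \<Omega> borel (X n) = \<mu> (r n)"
    "AE \<omega> in \<Omega>. (\<lambda>n. X n \<omega>) \<longlonglongrightarrow> Y \<omega>"
proof -
  obtain Q :: "real \<Rightarrow> real^3" and e :: "real^3 \<Rightarrow> real" where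
    Q: "continuous_on UNIV Q" and e[measurable]: "e \<in> borel_measurable borel"
    and e01: "\<And>v. e v \<in> {0..1}" and Qe: "\<And>v. Q (e v) = v /\<^sub>R (1 + norm v)"
    using borel_coding_by_reals by blast
  have Qm[measurable]: "Q \<in> borel_measurable borel" using Q by (rule borel_measurable_continuous_onI)
  have sets\<mu>[measurable_cong, simp]: "sets (\<mu> n) = sets borel" for n
    using \<mu> by (auto simp: prob_measures_def)
  have sp[simp]: "space (\<mu> n) = UNIV" for n using sets_eq_imp_space_eq[OF sets\<mu>] by simp
  interpret p: prob_space "\<mu> n" for n using \<mu> by (auto simp: prob_measures_def)
  \<comment> \<open>D inverts the map \<open>v /\<^sub>R (1 + norm v)\<close> on the open unit ball.
    Its values elsewhere do not matter: the coded points almost surely lie in the ball, and so does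
    their limit, as shown below.\<close>
  define D :: "real^3 \<Rightarrow> real^3" where "D y = y /\<^sub>R (1 - norm y)" for y
  have [measurable]: "D \<in> borel_measurable borel" unfolding D_def by measurable
  have nH: "norm (v /\<^sub>R (1 + norm v)) < 1" "D (v /\<^sub>R (1 + norm v)) = v" for v :: "real^3"
  proof -
    have pos: "1 + norm v > 0" by (simp add: add_pos_nonneg)
    have n: "norm (v /\<^sub>R (1 + norm v)) = norm v / (1 + norm v)"
      using pos by (simp add: divide_inverse mult.commute)
    also have "\<dots> < 1" using pos by (simp add: divide_less_eq)
    finally show "norm (v /\<^sub>R (1 + norm v)) < 1" .
    have "1 - norm (v /\<^sub>R (1 + norm v)) = inverse (1 + norm v)"
      unfolding n using pos by (simp add: field_simps)
    then show "D (v /\<^sub>R (1 + norm v)) = v" unfolding D_def using pos by simp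
  qed
  define \<nu> where "\<nu> n = distr (\<mu> n) borel e" for n
  have rd: "real_distribution (\<nu> n)" for n
    unfolding \<nu>_def by (intro real_distribution.intro p.prob_space_distr real_distribution_axioms.intro) auto
  \<comment> \<open>Codes lie in [0, 1], so tightness is automatic; the danger moves to limits on
    the unit sphere, that is, to mass escaping to infinity.\<close>
  have "tight \<nu>"
    unfolding tight_def
  proof (intro conjI allI impI rd)
    fix \<epsilon> :: real assume "\<epsilon> > 0"
    have "measure (\<nu> n) {-1<..1} = 1" for n
    proof -
      have "measure (\<nu> n) {-1<..1} = measure (\<mu> n) (e -` {-1<..1} \<inter> space (\<mu> n))"
        unfolding \<nu>_def by (intro measure_distr) auto
      also have "e -` {-1<..1} \<inter> space (\<mu> n) = space (\<mu> n)" using e01 by force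
      finally show ?thesis using p.prob_space by simp
    qed
    then show "\<exists>a b. a < b \<and> (\<forall>n. 1 - \<epsilon> < measure (\<nu> n) {a<..b})"
      using \<open>\<epsilon> > 0\<close> by (intro exI[of _ "-1"] exI[of _ 1]) auto
  qed
  from tight_imp_convergent_subsubsequence[OF this, of id] obtain r M where
    r: "strict_mono r" and M: "real_distribution M" and conv: "weak_conv_m (\<nu> \<circ> r) M"
    by (auto simp: strict_mono_id)
  have "\<And>n. real_distribution ((\<nu> \<circ> r) n)" using rd by simp
  from Skorohod[OF this M conv] obtain \<Omega> Yn Y where
    ps: "prob_space (\<Omega> :: real measure)" and Yn[measurable]: "\<And>n. Yn n \<in> borel_measurable \<Omega>"
    and dYn: "\<And>n. distr \<Omega> borel (Yn n) = \<nu> (r n)"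
    and Y: "Y \<in> measurable \<Omega> lborel" and YY: "\<And>x. x \<in> space \<Omega> \<Longrightarrow> (\<lambda>n. Yn n x) \<longlonglongrightarrow> Y x"
    by (simp add: o_def) blast
  have Y'[measurable]: "Y \<in> borel_measurable \<Omega>" using Y by simp
  define X where "X n = (\<lambda>\<omega>. D (Q (Yn n \<omega>)))" for n
  define Z where "Z = (\<lambda>\<omega>. D (Q (Y \<omega>)))"
  have X[measurable]: "X n \<in> \<Omega> \<rightarrow>\<^sub>M borel" for n unfolding X_def by measurable
  have Z: "Z \<in> \<Omega> \<rightarrow>\<^sub>M borel" unfolding Z_def by measurable
  have dX: "distr \<Omega> borel (X n) = \<mu> (r n)" for n
  proof -
    have "distr \<Omega> borel (X n) = distr (distr \<Omega> borel (Yn n)) borel (\<lambda>t. D (Q t))"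
      unfolding X_def by (subst distr_distr) (auto simp: o_def)
    also have "\<dots> = distr (\<mu> (r n)) borel (\<lambda>v. v)"
      unfolding dYn \<nu>_def by (subst distr_distr) (auto simp: o_def Qe nH)
    finally show ?thesis by (simp add: distr_id2)
  qed
  have "AE \<omega> in \<Omega>. norm (Q (Yn n \<omega>)) < 1" for n
  proof -
    have "AE v in \<mu> (r n). norm (Q (e v)) < 1" using nH(1) by (simp only: Qe) simp
    then have "AE t in \<nu> (r n). norm (Q t) < 1" unfolding \<nu>_def by (subst AE_distr_iff) auto
    then show ?thesis unfolding dYn[symmetric] by (subst (asm) AE_distr_iff) auto
  qed
  then have ae1: "AE \<omega> in \<Omega>. \<forall>n. norm (Q (Yn n \<omega>)) < 1" by (simp add: AE_all_countable)
  \<comment> \<open>Fatou's lemma: the lower limit of the squared norms is almost surely finite. A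
    limit on the sphere would force the norms of \<open>X n\<close> to infinity, so almost every
    limit lies inside the ball.\<close>
  have "(\<integral>\<^sup>+\<omega>. liminf (\<lambda>n. ennreal ((norm (X n \<omega>))\<^sup>2)) \<partial>\<Omega>) \<le> liminf (\<lambda>n. \<integral>\<^sup>+\<omega>. ennreal ((norm (X n \<omega>))\<^sup>2) \<partial>\<Omega>)"
    by (rule nn_integral_liminf) measurable
  also have "\<dots> = liminf (\<lambda>n. moment 2 (\<mu> (r n)))"
  proof -
    have "(\<integral>\<^sup>+\<omega>. ennreal ((norm (X n \<omega>))\<^sup>2) \<partial>\<Omega>) = moment 2 (\<mu> (r n))" for n
      unfolding moment_def dX[symmetric] by (subst nn_integral_distr) (auto simp: powr_numeral)
    then show ?thesis by simp
  qed
  also have "\<dots> \<le> liminf (\<lambda>n. K)" by (rule Liminf_mono) (use K in auto)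
  also have "\<dots> = K" by (simp add: Liminf_const)
  finally have "(\<integral>\<^sup>+\<omega>. liminf (\<lambda>n. ennreal ((norm (X n \<omega>))\<^sup>2)) \<partial>\<Omega>) \<noteq> \<infinity>" using K by auto
  then have ae2: "AE \<omega> in \<Omega>. liminf (\<lambda>n. ennreal ((norm (X n \<omega>))\<^sup>2)) \<noteq> \<infinity>"
    by (intro nn_integral_PInf_AE) measurable
  have "AE \<omega> in \<Omega>. (\<lambda>n. X n \<omega>) \<longlonglongrightarrow> Z \<omega>"
    using ae1 ae2 AE_space
  proof eventually_elim
    case (elim \<omega>)
    define y where "y n = Q (Yn n \<omega>)" for n
    have lim: "y \<longlonglongrightarrow> Q (Y \<omega>)"
      unfolding y_def using Q YY[OF elim(3)]
      by (intro isCont_tendsto_compose[where g=Q]) (auto simp: continuous_on_eq_continuous_at)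
    have lt: "norm (y n) < 1" for n using elim(1) by (simp add: y_def)
    have Xy: "X n \<omega> = D (y n)" for n by (simp add: X_def y_def)
    have "norm (Q (Y \<omega>)) \<le> 1"
      by (rule LIMSEQ_le_const2[OF tendsto_norm[OF lim]]) (use lt less_imp_le in blast)
    moreover have "norm (Q (Y \<omega>)) \<noteq> 1"
    proof
      assume eq1: "norm (Q (Y \<omega>)) = 1"
      then have l1: "(\<lambda>n. norm (y n)) \<longlonglongrightarrow> 1" using tendsto_norm[OF lim] by simp
      have "(\<lambda>n. 1 - norm (y n)) \<longlonglongrightarrow> 1 - 1" by (intro tendsto_intros l1)
      then have "filterlim (\<lambda>n. 1 - norm (y n)) (at_right 0) sequentially"
        using lt by (auto simp: filterlim_at intro!: always_eventually less_imp_neq)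
      then have "filterlim (\<lambda>n. inverse (1 - norm (y n))) at_top sequentially"
        by (rule filterlim_compose[OF filterlim_inverse_at_top_right])
      then have "filterlim (\<lambda>n. norm (y n) / (1 - norm (y n))) at_top sequentially"
        unfolding divide_inverse by (rule filterlim_tendsto_pos_mult_at_top[OF l1, rotated]) simp
      moreover have "norm (X n \<omega>) = norm (y n) / (1 - norm (y n))" for n
        using lt[of n] by (simp add: Xy D_def divide_inverse mult.commute)
      ultimately have top: "filterlim (\<lambda>n. norm (X n \<omega>)) at_top sequentially" by simp
      have "ennreal B \<le> liminf (\<lambda>n. ennreal ((norm (X n \<omega>))\<^sup>2))" for B
      proof (rule Liminf_bounded)
        have "eventually (\<lambda>n. norm (X n \<omega>) \<ge> max 1 B) sequentially"
          using top unfolding filterlim_at_top by blast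
        then show "\<forall>\<^sub>F n in sequentially. ennreal B \<le> ennreal ((norm (X n \<omega>))\<^sup>2)"
        proof eventually_elim
          case (elim n)
          have "B \<le> norm (X n \<omega>) * 1" using elim by simp
          also have "\<dots> \<le> norm (X n \<omega>) * norm (X n \<omega>)" using elim by (intro mult_left_mono) auto
          finally show ?case by (intro ennreal_leI) (simp add: power2_eq_square)
        qed
      qed
      note ge = this
      obtain c where "c \<ge> 0" "liminf (\<lambda>n. ennreal ((norm (X n \<omega>))\<^sup>2)) = ennreal c"
        using elim(2) by (cases "liminf (\<lambda>n. ennreal ((norm (X n \<omega>))\<^sup>2))") auto
      then show False using ge[of "c + 1"] by simp
    qed
    ultimately have "norm (Q (Y \<omega>)) < 1" by simp
    then show "(\<lambda>n. X n \<omega>) \<longlonglongrightarrow> Z \<omega>"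
      unfolding Xy Z_def D_def by (intro tendsto_intros lim) auto
  qed
  then show ?thesis using that[OF r ps X Z dX] by blast
qed

text \<open>The cut-offs decrease to the indicator of A because points off a closed set have
  positive distance to it; \<open>infdist\<close> to the empty set is 0 by convention, so that set
  would give the wrong limit. The lemma converts facts about continuous functions into facts about
  closed sets, both for uniqueness of measures and for measurability in time.\<close>

lemma integral_infdist_tendsto_measure_closed:
  fixes A :: "(real^3) set"
  assumes A: "closed A" "A \<noteq> {}" and M: "prob_space M" "sets M = sets borel"
  shows "(\<lambda>k. \<integral>v. max 0 (1 - real k * infdist v A) \<partial>M) \<longlonglongrightarrow> measure M A"
proof -
  interpret M: prob_space M by fact
  note M(2)[measurable_cong]
  have Am[measurable]: "A \<in> sets borel" using A by auto
  have "(\<lambda>k. \<integral>v. max 0 (1 - real k * infdist v A) \<partial>M) \<longlonglongrightarrow> (\<integral>v. indicator A v \<partial>M)"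
  proof (rule integral_dominated_convergence[where w="\<lambda>_. 1"])
    show "AE v in M. (\<lambda>k. max 0 (1 - real k * infdist v A)) \<longlonglongrightarrow> indicator A v"
    proof (intro AE_I2)
      fix v
      show "(\<lambda>k. max 0 (1 - real k * infdist v A)) \<longlonglongrightarrow> indicator A v"
      proof (cases "v \<in> A")
        case True
        then show ?thesis by simp
      next
        case False
        then have pos: "infdist v A > 0" using A in_closed_iff_infdist_zero[of A v] infdist_nonneg[of v A] by auto
        obtain N :: nat where N: "1 < real N * infdist v A" using reals_Archimedean3[OF pos] by blast
        have "\<forall>\<^sub>F k in sequentially. max 0 (1 - real k * infdist v A) = 0"
          using eventually_ge_at_top[of N]
        proof eventually_elim
          case (elim k)
          then have "real N * infdist v A \<le> real k * infdist v A" using pos by (intro mult_right_mono) auto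
          then show ?case using N by simp
        qed
        then show ?thesis using False by (simp add: tendsto_eventually)
      qed
    qed
    show "AE v in M. norm (max 0 (1 - real k * infdist v A)) \<le> 1" for k
      by (auto simp: infdist_nonneg)
    have "(\<lambda>v. max 0 (1 - real k * infdist v A)) \<in> borel_measurable borel" for k
      by (intro borel_measurable_continuous_onI continuous_intros)
    then show "(\<lambda>v. max 0 (1 - real k * infdist v A)) \<in> borel_measurable M" for k
      using measurable_cong_sets[OF M(2) refl] by blast
  qed auto
  moreover have "(\<integral>v. indicator A v \<partial>M) = measure M A" using M by simp
  ultimately show ?thesis by simp
qed

lemma infdist_cutoff_bounded: "bounded (range (\<lambda>v. max 0 (1 - real k * infdist v A)))"
proof -
  have "range (\<lambda>v. max 0 (1 - real k * infdist v A)) \<subseteq> {0..1}" by (auto simp: infdist_nonneg)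
  then show ?thesis using bounded_subset bounded_closed_interval by blast
qed

lemma prob_measures_eqI:
  assumes \<mu>: "\<mu> \<in> prob_measures" and \<nu>: "\<nu> \<in> prob_measures"
    and eq: "\<And>g :: real^3 \<Rightarrow> real. continuous_on UNIV g \<Longrightarrow> bounded (range g) \<Longrightarrow> (\<integral>v. g v \<partial>\<mu>) = (\<integral>v. g v \<partial>\<nu>)"
  shows "\<mu> = \<nu>"
proof -
  have s[measurable_cong, simp]: "sets \<mu> = sets borel" "sets \<nu> = sets borel"
    using \<mu> \<nu> by (auto simp: prob_measures_def)
  interpret m: prob_space \<mu> using \<mu> by (auto simp: prob_measures_def)
  interpret n: prob_space \<nu> using \<nu> by (auto simp: prob_measures_def)
  have sp: "space \<mu> = UNIV" "space \<nu> = UNIV" using sets_eq_imp_space_eq[OF s(1)] sets_eq_imp_space_eq[OF s(2)] by auto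
  have closed_eq: "emeasure \<mu> A = emeasure \<nu> A" if A: "closed A" for A
  proof (cases "A = {}")
    case False
    have "(\<lambda>k. \<integral>v. max 0 (1 - real k * infdist v A) \<partial>\<mu>) = (\<lambda>k. \<integral>v. max 0 (1 - real k * infdist v A) \<partial>\<nu>)"
    proof
      fix k
      show "(\<integral>v. max 0 (1 - real k * infdist v A) \<partial>\<mu>) = (\<integral>v. max 0 (1 - real k * infdist v A) \<partial>\<nu>)"
        by (intro eq continuous_intros infdist_cutoff_bounded)
    qed
    then have "measure \<mu> A = measure \<nu> A"
      using integral_infdist_tendsto_measure_closed[OF A False m.prob_space_axioms s(1)] integral_infdist_tendsto_measure_closed[OF A False n.prob_space_axioms s(2)]
      by (metis LIMSEQ_unique)
    then show ?thesis by (simp add: m.emeasure_eq_measure n.emeasure_eq_measure)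
  qed simp
  show ?thesis
  proof (rule measure_eqI_generator_eq[where E="Collect closed" and \<Omega>=UNIV and A="\<lambda>_. UNIV"])
    show "Int_stable (Collect closed)" by (auto simp: Int_stable_def)
    show "sets \<mu> = sigma_sets UNIV (Collect closed)" "sets \<nu> = sigma_sets UNIV (Collect closed)"
      by (simp_all add: borel_eq_closed)
  qed (use closed_eq m.emeasure_space_1 n.emeasure_space_1 sp in auto)
qed

section \<open>Weak convergence\<close>

definition weakly_converges :: "(nat \<Rightarrow> (real^3) measure) \<Rightarrow> (real^3) measure \<Rightarrow> bool" where
  "weakly_converges \<mu> \<nu> \<longleftrightarrow> (\<forall>g :: real^3 \<Rightarrow> real. continuous_on UNIV g \<longrightarrow> bounded (range g) \<longrightarrow>
     (\<lambda>n. \<integral>v. g v \<partial>\<mu> n) \<longlonglongrightarrow> (\<integral>v. g v \<partial>\<nu>))"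

lemma weakly_convergesD:
  fixes g :: "real^3 \<Rightarrow> real"
  shows "weakly_converges \<mu> \<nu> \<Longrightarrow> continuous_on UNIV g \<Longrightarrow> bounded (range g) \<Longrightarrow>
    (\<lambda>n. \<integral>v. g v \<partial>\<mu> n) \<longlonglongrightarrow> (\<integral>v. g v \<partial>\<nu>)"
  by (simp add: weakly_converges_def)

lemma weakly_converges_subseq:
  "weakly_converges \<mu> \<nu> \<Longrightarrow> strict_mono r \<Longrightarrow> weakly_converges (\<lambda>n. \<mu> (r n)) \<nu>"
  unfolding weakly_converges_def
proof (intro allI impI)
  fix g :: "real^3 \<Rightarrow> real"
  assume "\<forall>g :: real^3 \<Rightarrow> real. continuous_on UNIV g \<longrightarrow> bounded (range g) \<longrightarrow> (\<lambda>n. integral\<^sup>L (\<mu> n) g) \<longlonglongrightarrow> integral\<^sup>L \<nu> g"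
    and r: "strict_mono r" and g: "continuous_on UNIV g" "bounded (range g)"
  then have "(\<lambda>n. integral\<^sup>L (\<mu> n) g) \<longlonglongrightarrow> integral\<^sup>L \<nu> g" by simp
  from LIMSEQ_subseq_LIMSEQ[OF this r]
  show "(\<lambda>n. integral\<^sup>L (\<mu> (r n)) g) \<longlonglongrightarrow> integral\<^sup>L \<nu> g" by (simp add: o_def)
qed

lemma prob_measuresD:
  assumes "\<mu> \<in> prob_measures"
  shows "prob_space \<mu>" "sets \<mu> = sets borel" "space \<mu> = UNIV" "finite_measure \<mu>"
  using assms sets_eq_imp_space_eq[of \<mu> borel] prob_space.finite_measure by (auto simp: prob_measures_def)

lemma prob_measures_distr:
  "prob_space \<Omega> \<Longrightarrow> X \<in> \<Omega> \<rightarrow>\<^sub>M (borel :: (real^3) measure) \<Longrightarrow> distr \<Omega> borel X \<in> prob_measures"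
  by (auto simp: prob_measures_def intro: prob_space.prob_space_distr)

section \<open>Almost sure representation of weak convergence\<close>

lemma AE_tendsto_integral_distr:
  fixes g :: "real^3 \<Rightarrow> real"
  assumes "prob_space \<Omega>" and X: "\<And>n. X n \<in> \<Omega> \<rightarrow>\<^sub>M borel" and Y: "Y \<in> \<Omega> \<rightarrow>\<^sub>M borel"
    and ae: "AE \<omega> in \<Omega>. (\<lambda>n. X n \<omega>) \<longlonglongrightarrow> Y \<omega>"
    and g: "continuous_on UNIV g" "bounded (range g)"
  shows "(\<lambda>n. \<integral>v. g v \<partial>distr \<Omega> borel (X n)) \<longlonglongrightarrow> (\<integral>v. g v \<partial>distr \<Omega> borel Y)"
proof -
  interpret prob_space \<Omega> by fact
  obtain B where B: "\<And>v. \<bar>g v\<bar> \<le> B" using g(2) by (auto simp: bounded_iff)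
  have [measurable]: "g \<in> borel_measurable borel" by (intro borel_measurable_continuous_onI g)
  note X[measurable] Y[measurable]
  have "(\<lambda>n. \<integral>\<omega>. g (X n \<omega>) \<partial>\<Omega>) \<longlonglongrightarrow> (\<integral>\<omega>. g (Y \<omega>) \<partial>\<Omega>)"
  proof (rule integral_dominated_convergence[where w="\<lambda>_. B"])
    show "AE \<omega> in \<Omega>. (\<lambda>n. g (X n \<omega>)) \<longlonglongrightarrow> g (Y \<omega>)"
      using ae by eventually_elim
        (rule isCont_tendsto_compose[where g=g], use g in \<open>auto simp: continuous_on_eq_continuous_at\<close>)
  qed (use B in auto)
  then show ?thesis by (simp add: integral_distr)
qed

text \<open>The almost sure representation is obtained along subsequences only; this recovers
  convergence of the whole sequence.\<close>

lemma tendsto_subseq_criterion: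
  fixes x :: "nat \<Rightarrow> 'a::metric_space"
  assumes "\<And>s :: nat \<Rightarrow> nat. strict_mono s \<Longrightarrow> \<exists>r :: nat \<Rightarrow> nat. strict_mono r \<and> (\<lambda>n. x (s (r n))) \<longlonglongrightarrow> l"
  shows "x \<longlonglongrightarrow> l"
proof (rule ccontr)
  assume "\<not> x \<longlonglongrightarrow> l"
  then obtain \<epsilon> where \<epsilon>: "\<epsilon> > 0" "\<not> (\<forall>\<^sub>F n in sequentially. dist (x n) l < \<epsilon>)"
    unfolding tendsto_iff by blast
  have "infinite {n. \<epsilon> \<le> dist (x n) l}"
  proof
    assume "finite {n. \<epsilon> \<le> dist (x n) l}"
    then have "\<forall>\<^sub>F n in cofinite. dist (x n) l < \<epsilon>" by (simp add: eventually_cofinite not_less)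
    then show False using \<epsilon>(2) by (simp add: cofinite_eq_sequentially)
  qed
  then obtain s :: "nat \<Rightarrow> nat" where s: "strict_mono s" "\<And>n. s n \<in> {n. \<epsilon> \<le> dist (x n) l}"
    using infinite_enumerate by blast
  obtain r where r: "strict_mono r" "(\<lambda>n. x (s (r n))) \<longlonglongrightarrow> l" using assms[OF s(1)] by blast
  have "\<forall>\<^sub>F n in sequentially. dist (x (s (r n))) l < \<epsilon>" using r(2) \<epsilon>(1) by (rule tendstoD)
  then show False using s(2) by (auto simp: not_less[symmetric] eventually_sequentially)
qed

text \<open>Along the chosen subsequence the laws converge both to \<nu> and to the law of Y, and
  bounded continuous functions determine a measure.\<close>

lemma weakly_converges_representation:
  assumes w: "weakly_converges \<mu> \<nu>" and \<mu>: "\<And>n. \<mu> n \<in> prob_measures" and \<nu>: "\<nu> \<in> prob_measures"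
    and K: "\<And>n. moment 2 (\<mu> n) \<le> K" "K < \<infinity>"
  obtains r \<Omega> X Y where "strict_mono r" "prob_space (\<Omega> :: real measure)"
    "\<And>n. X n \<in> \<Omega> \<rightarrow>\<^sub>M borel" "Y \<in> \<Omega> \<rightarrow>\<^sub>M borel" "\<And>n. distr \<Omega> borel (X n) = \<mu> (r n)"
    "distr \<Omega> borel Y = \<nu>" "AE \<omega> in \<Omega>. (\<lambda>n. X n \<omega>) \<longlonglongrightarrow> Y \<omega>"
proof -
  obtain r X Y and \<Omega> :: "real measure" where *: "strict_mono r" "prob_space \<Omega>"
    "\<And>n. X n \<in> \<Omega> \<rightarrow>\<^sub>M borel" "Y \<in> \<Omega> \<rightarrow>\<^sub>M borel" "\<And>n. distr \<Omega> borel (X n) = \<mu> (r n)"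
    "AE \<omega> in \<Omega>. (\<lambda>n. X n \<omega>) \<longlonglongrightarrow> Y \<omega>"
    by (rule prokhorov_skorokhod[OF \<mu> K(1) K(2)]) (rule that)
  have "distr \<Omega> borel Y = \<nu>"
  proof (rule prob_measures_eqI[OF prob_measures_distr[OF *(2,4)] \<nu>])
    fix g :: "real^3 \<Rightarrow> real" assume g: "continuous_on UNIV g" "bounded (range g)"
    show "(\<integral>v. g v \<partial>distr \<Omega> borel Y) = (\<integral>v. g v \<partial>\<nu>)"
      using AE_tendsto_integral_distr[OF *(2,3,4,6) g] weakly_convergesD[OF weakly_converges_subseq[OF w *(1)] g]
      unfolding *(5) by (rule LIMSEQ_unique)
  qed
  with * that show ?thesis by blast
qed

text \<open>The double integral is not linear in the measure. The representation rewrites it over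
  two independent copies of \<Omega>, where dominated convergence is applied twice. The hypothesis
  \<open>conv\<close> is continuous convergence along subsequences: the kernels vary with n, as the
  discrete operators do, and the representation passes to a subsequence.\<close>

lemma weakly_converges_double_integral:
  fixes G :: "nat \<Rightarrow> real^3 \<Rightarrow> real^3 \<Rightarrow> real"
  assumes w: "weakly_converges \<mu> \<nu>" and \<mu>: "\<And>n. \<mu> n \<in> prob_measures" and \<nu>: "\<nu> \<in> prob_measures"
    and K: "\<And>n. moment 2 (\<mu> n) \<le> K" "K < \<infinity>"
    and G: "\<And>n. (\<lambda>(v, w). G n v w) \<in> borel_measurable (borel \<Otimes>\<^sub>M borel)"
    and G': "(\<lambda>(v, w). G' v w) \<in> borel_measurable (borel \<Otimes>\<^sub>M borel)"
    and bound: "\<And>n v w. \<bar>G n v w\<bar> \<le> C"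
    and conv: "\<And>f x y v w. strict_mono f \<Longrightarrow> x \<longlonglongrightarrow> v \<Longrightarrow> y \<longlonglongrightarrow> w \<Longrightarrow> (\<lambda>n. G (f n) (x n) (y n)) \<longlonglongrightarrow> G' v w"
  shows "(\<lambda>n. \<integral>v. (\<integral>w. G n v w \<partial>\<mu> n) \<partial>\<mu> n) \<longlonglongrightarrow> (\<integral>v. (\<integral>w. G' v w \<partial>\<nu>) \<partial>\<nu>)"
proof (rule tendsto_subseq_criterion)
  fix s :: "nat \<Rightarrow> nat" assume s: "strict_mono s"
  obtain r X Y and \<Omega> :: "real measure" where *: "strict_mono r" "prob_space \<Omega>"
    and X[measurable]: "\<And>n. X n \<in> \<Omega> \<rightarrow>\<^sub>M borel" and Y[measurable]: "Y \<in> \<Omega> \<rightarrow>\<^sub>M borel"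
    and dX: "\<And>n. distr \<Omega> borel (X n) = \<mu> (s (r n))"
    and dY: "distr \<Omega> borel Y = \<nu>" and ae: "AE \<omega> in \<Omega>. (\<lambda>n. X n \<omega>) \<longlonglongrightarrow> Y \<omega>"
    by (rule weakly_converges_representation[OF weakly_converges_subseq[OF w s] \<mu> \<nu> K(1) K(2)]) (rule that)
  interpret prob_space \<Omega> by fact
  have f: "strict_mono (\<lambda>n. s (r n))" using strict_mono_o[OF s *(1)] by (simp add: o_def)
  note G[measurable] G'[measurable]
  have C: "0 \<le> C" using bound[of 0 0 0] by simp
  have eq: "(\<integral>v. (\<integral>w. H v w \<partial>distr \<Omega> borel Z) \<partial>distr \<Omega> borel Z) = (\<integral>\<omega>. (\<integral>\<omega>'. H (Z \<omega>) (Z \<omega>') \<partial>\<Omega>) \<partial>\<Omega>)"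
    if [measurable]: "Z \<in> \<Omega> \<rightarrow>\<^sub>M borel" "(\<lambda>(v, w). H v w) \<in> borel_measurable (borel \<Otimes>\<^sub>M borel)"
    for Z and H :: "real^3 \<Rightarrow> real^3 \<Rightarrow> real"
  proof -
    interpret Z: prob_space "distr \<Omega> borel Z" by (intro prob_space_distr) measurable
    have "(\<integral>v. (\<integral>w. H v w \<partial>distr \<Omega> borel Z) \<partial>distr \<Omega> borel Z) = (\<integral>\<omega>. (\<integral>w. H (Z \<omega>) w \<partial>distr \<Omega> borel Z) \<partial>\<Omega>)"
      by (rule integral_distr) measurable
    also have "\<dots> = (\<integral>\<omega>. (\<integral>\<omega>'. H (Z \<omega>) (Z \<omega>') \<partial>\<Omega>) \<partial>\<Omega>)"
      by (intro Bochner_Integration.integral_cong refl integral_distr) measurable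
    finally show ?thesis .
  qed
  have "(\<lambda>n. \<integral>\<omega>. (\<integral>\<omega>'. G (s (r n)) (X n \<omega>) (X n \<omega>') \<partial>\<Omega>) \<partial>\<Omega>) \<longlonglongrightarrow> (\<integral>\<omega>. (\<integral>\<omega>'. G' (Y \<omega>) (Y \<omega>') \<partial>\<Omega>) \<partial>\<Omega>)"
  proof (rule integral_dominated_convergence[where w="\<lambda>_. C"])
    show "AE \<omega> in \<Omega>. (\<lambda>n. \<integral>\<omega>'. G (s (r n)) (X n \<omega>) (X n \<omega>') \<partial>\<Omega>) \<longlonglongrightarrow> (\<integral>\<omega>'. G' (Y \<omega>) (Y \<omega>') \<partial>\<Omega>)"
      using ae AE_space
    proof eventually_elim
      case (elim \<omega>)
      show ?case
      proof (rule integral_dominated_convergence[where w="\<lambda>_. C"])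
        show "AE \<omega>' in \<Omega>. (\<lambda>n. G (s (r n)) (X n \<omega>) (X n \<omega>')) \<longlonglongrightarrow> G' (Y \<omega>) (Y \<omega>')"
          using ae by eventually_elim (rule conv[OF f elim(1)])
      qed (use elim(2) bound in auto)
    qed
    show "AE \<omega> in \<Omega>. norm (\<integral>\<omega>'. G (s (r n)) (X n \<omega>) (X n \<omega>') \<partial>\<Omega>) \<le> C" for n
    proof (intro AE_I2)
      fix \<omega> assume "\<omega> \<in> space \<Omega>"
      have "norm (\<integral>\<omega>'. G (s (r n)) (X n \<omega>) (X n \<omega>') \<partial>\<Omega>) \<le> (\<integral>\<omega>'. C \<partial>\<Omega>)"
      proof (rule Bochner_Integration.integral_norm_bound_integral)
        show "integrable \<Omega> (\<lambda>\<omega>'. G (s (r n)) (X n \<omega>) (X n \<omega>'))"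
          by (rule integrable_const_bound[where B=C]) (use bound \<open>\<omega> \<in> space \<Omega>\<close> in auto)
      qed (use bound in auto)
      then show "norm (\<integral>\<omega>'. G (s (r n)) (X n \<omega>) (X n \<omega>') \<partial>\<Omega>) \<le> C" using prob_space by simp
    qed
  qed auto
  then have "(\<lambda>n. \<integral>v. (\<integral>w. G (s (r n)) v w \<partial>\<mu> (s (r n))) \<partial>\<mu> (s (r n))) \<longlonglongrightarrow> (\<integral>v. (\<integral>w. G' v w \<partial>\<nu>) \<partial>\<nu>)"
    unfolding dX[symmetric] dY[symmetric] by (simp add: eq)
  with *(1) show "\<exists>r. strict_mono r \<and> (\<lambda>n. \<integral>v. (\<integral>w. G (s (r n)) v w \<partial>\<mu> (s (r n))) \<partial>\<mu> (s (r n))) \<longlonglongrightarrow> (\<integral>v. (\<integral>w. G' v w \<partial>\<nu>) \<partial>\<nu>)"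
    by blast
qed

text \<open>Lower semicontinuity for unbounded g: the truncations \<open>min (g v) (real m)\<close>
  are bounded and continuous, and monotone convergence in m removes them.\<close>

lemma weakly_converges_nn_integral_le:
  fixes g :: "real^3 \<Rightarrow> real"
  assumes w: "weakly_converges \<mu> \<nu>" and \<mu>: "\<And>n. \<mu> n \<in> prob_measures" and \<nu>: "\<nu> \<in> prob_measures"
    and g: "continuous_on UNIV g" "\<And>v. 0 \<le> g v"
  shows "(\<integral>\<^sup>+v. ennreal (g v) \<partial>\<nu>) \<le> liminf (\<lambda>n. \<integral>\<^sup>+v. ennreal (g v) \<partial>\<mu> n)"
proof -
  have gm[measurable]: "g \<in> borel_measurable borel" by (intro borel_measurable_continuous_onI g)
  have trunc: "(\<integral>\<^sup>+v. ennreal (min (g v) (real m)) \<partial>\<nu>) \<le> liminf (\<lambda>n. \<integral>\<^sup>+v. ennreal (g v) \<partial>\<mu> n)" for m :: nat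
  proof -
    have r: "range (\<lambda>v. min (g v) (real m)) \<subseteq> {0..real m}" using g(2) by auto
    have int: "(\<integral>\<^sup>+v. ennreal (min (g v) (real m)) \<partial>M) = ennreal (\<integral>v. min (g v) (real m) \<partial>M)"
      if M: "M \<in> prob_measures" for M
    proof (rule nn_integral_eq_integral)
      interpret prob_space M using prob_measuresD[OF M] by simp
      show "integrable M (\<lambda>v. min (g v) (real m))"
        by (rule integrable_const_bound[where B="real m"])
          (use g(2) prob_measuresD(2)[OF M] in \<open>auto simp: measurable_cong_sets[OF prob_measuresD(2)[OF M] refl]\<close>)
    qed (use g(2) in auto)
    have "(\<lambda>n. \<integral>v. min (g v) (real m) \<partial>\<mu> n) \<longlonglongrightarrow> (\<integral>v. min (g v) (real m) \<partial>\<nu>)"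
      by (rule weakly_convergesD[OF w]) (use g r bounded_subset[OF bounded_closed_interval r] in \<open>auto intro!: continuous_intros\<close>)
    then have "(\<lambda>n. \<integral>\<^sup>+v. ennreal (min (g v) (real m)) \<partial>\<mu> n) \<longlonglongrightarrow> (\<integral>\<^sup>+v. ennreal (min (g v) (real m)) \<partial>\<nu>)"
      unfolding int[OF \<mu>] int[OF \<nu>] by (rule tendsto_ennrealI)
    then have "(\<integral>\<^sup>+v. ennreal (min (g v) (real m)) \<partial>\<nu>) = liminf (\<lambda>n. \<integral>\<^sup>+v. ennreal (min (g v) (real m)) \<partial>\<mu> n)"
      using lim_imp_Liminf[OF trivial_limit_sequentially] by metis
    also have "\<dots> \<le> liminf (\<lambda>n. \<integral>\<^sup>+v. ennreal (g v) \<partial>\<mu> n)"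
      by (intro Liminf_mono always_eventually allI nn_integral_mono ennreal_leI) auto
    finally show ?thesis .
  qed
  have "(\<integral>\<^sup>+v. ennreal (g v) \<partial>\<nu>) = (\<integral>\<^sup>+v. (SUP m. ennreal (min (g v) (real m))) \<partial>\<nu>)"
  proof (intro nn_integral_cong)
    fix v
    obtain k :: nat where k: "g v \<le> real k" using real_arch_simple by blast
    show "ennreal (g v) = (SUP m. ennreal (min (g v) (real m)))"
    proof (rule antisym)
      show "ennreal (g v) \<le> (SUP m. ennreal (min (g v) (real m)))"
        by (rule SUP_upper2[of k]) (use k in auto)
    qed (auto intro!: SUP_least ennreal_leI)
  qed
  also have "\<dots> = (SUP m. \<integral>\<^sup>+v. ennreal (min (g v) (real m)) \<partial>\<nu>)"
    by (rule nn_integral_monotone_convergence_SUP)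
      (use prob_measuresD(2)[OF \<nu>] in \<open>auto simp: incseq_def le_fun_def measurable_cong_sets[OF prob_measuresD(2)[OF \<nu>] refl] intro!: ennreal_leI\<close>)
  also have "\<dots> \<le> liminf (\<lambda>n. \<integral>\<^sup>+v. ennreal (g v) \<partial>\<mu> n)" by (intro SUP_least trunc)
  finally show ?thesis .
qed

section \<open>A determining algebra of test functions\<close>

text \<open>An algebra of test functions that is stable under differentiation and, by Stone--Weierstrass on a
  cube, uniformly dense among the continuous functions of compact support.\<close>

inductive_set tanh_polynomials :: "(real^3 \<Rightarrow> real) set" where
  const: "(\<lambda>_. c) \<in> tanh_polynomials"
| tanh: "(\<lambda>v. tanh (v $ i)) \<in> tanh_polynomials"
| add: "p \<in> tanh_polynomials \<Longrightarrow> q \<in> tanh_polynomials \<Longrightarrow> (\<lambda>v. p v + q v) \<in> tanh_polynomials"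
| mult: "p \<in> tanh_polynomials \<Longrightarrow> q \<in> tanh_polynomials \<Longrightarrow> (\<lambda>v. p v * q v) \<in> tanh_polynomials"

lemma tanh_polynomials_bounded:
  assumes "p \<in> tanh_polynomials" shows "bounded (range p)"
proof -
  have "\<exists>B. \<forall>v. \<bar>p v\<bar> \<le> B" using assms
  proof induction
    case (tanh i)
    have "\<bar>tanh (v $ i)\<bar> \<le> 1" for v :: "real^3"
      using tanh_real_lt_1[of "v $ i"] tanh_real_gt_neg1[of "v $ i"] by (simp add: abs_le_iff)
    then show ?case by blast
  next
    case (add p q)
    then obtain B C where "\<And>v. \<bar>p v\<bar> \<le> B" "\<And>v. \<bar>q v\<bar> \<le> C" by blast
    then have "\<bar>p v + q v\<bar> \<le> B + C" for v by (meson abs_triangle_ineq add_mono order_trans)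
    then show ?case by blast
  next
    case (mult p q)
    then obtain B C where B: "\<And>v. \<bar>p v\<bar> \<le> B" and C: "\<And>v. \<bar>q v\<bar> \<le> C" by blast
    have "\<bar>p v * q v\<bar> \<le> B * C" for v
      unfolding abs_mult using B[of v] C[of v] by (intro mult_mono) auto
    then show ?case by blast
  qed auto
  then show ?thesis by (auto simp: bounded_iff)
qed

text \<open>The derivative of tanh is 1 - tanh^2, so the gradient stays in the algebra; bounds on
  derivatives of any order then reduce to boundedness of the algebra.\<close>

lemma tanh_polynomials_derivative:
  assumes "p \<in> tanh_polynomials"
  shows "\<exists>p'. (\<forall>k. p' k \<in> tanh_polynomials) \<and>
    (\<forall>v. (p has_derivative (\<lambda>h. \<Sum>k\<in>UNIV. p' k v * h $ k)) (at v))"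
  using assms
proof induction
  case (const c)
  show ?case
    by (rule exI[of _ "\<lambda>_ _. 0"]) (auto intro: tanh_polynomials.const)
next
  case (tanh i)
  let ?p' = "\<lambda>k v. if k = i then 1 + (- 1) * (tanh (v $ i) * tanh (v $ i)) else (0 :: real)"
  have "?p' k \<in> tanh_polynomials" for k
  proof (cases "k = i")
    case True
    have "(\<lambda>v :: real^3. 1 + (- 1) * (tanh (v $ i) * tanh (v $ i))) \<in> tanh_polynomials"
      by (intro tanh_polynomials.add tanh_polynomials.mult tanh_polynomials.tanh tanh_polynomials.const)
    with True show ?thesis by simp
  next
    case False
    then show ?thesis using tanh_polynomials.const[of 0] by simp
  qed
  moreover have "((\<lambda>v. tanh (v $ i)) has_derivative (\<lambda>h. \<Sum>k\<in>UNIV. ?p' k v * h $ k)) (at v)" for v :: "real^3"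
  proof -
    have "((\<lambda>x. tanh x) has_field_derivative (1 - (tanh (v $ i))\<^sup>2) * 1) (at (v $ i))"
      by (rule has_field_derivative_tanh[OF _ DERIV_ident]) simp
    then have "(tanh has_derivative (\<lambda>h. (1 - (tanh (v $ i))\<^sup>2) * h)) (at (v $ i))"
      by (simp add: has_field_derivative_def)
    from has_derivative_compose[OF bounded_linear_imp_has_derivative[OF bounded_linear_vec_nth] this]
    show ?thesis
      by (simp add: if_distrib[of "\<lambda>x. x * _"] power2_eq_square cong: if_cong)
  qed
  ultimately show ?case by (intro exI[of _ ?p']) blast
next
  case (add p q)
  then obtain p' q' where
    "\<forall>k. p' k \<in> tanh_polynomials" "\<forall>v. (p has_derivative (\<lambda>h. \<Sum>k\<in>UNIV. p' k v * h $ k)) (at v)"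
    "\<forall>k. q' k \<in> tanh_polynomials" "\<forall>v. (q has_derivative (\<lambda>h. \<Sum>k\<in>UNIV. q' k v * h $ k)) (at v)"
    by blast
  then show ?case
    by (intro exI[of _ "\<lambda>k v. p' k v + q' k v"])
      (auto intro!: tanh_polynomials.add derivative_eq_intros simp: algebra_simps sum.distrib fun_eq_iff)
next
  case (mult p q)
  then obtain p' q' where
    *: "\<forall>k. p' k \<in> tanh_polynomials" "\<forall>v. (p has_derivative (\<lambda>h. \<Sum>k\<in>UNIV. p' k v * h $ k)) (at v)"
    "\<forall>k. q' k \<in> tanh_polynomials" "\<forall>v. (q has_derivative (\<lambda>h. \<Sum>k\<in>UNIV. q' k v * h $ k)) (at v)"
    by blast
  have "((\<lambda>v. p v * q v) has_derivative (\<lambda>h. \<Sum>k\<in>UNIV. (p v * q' k v + p' k v * q v) * h $ k)) (at v)" for v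
    using has_derivative_mult[OF *(2)[rule_format, of v] *(4)[rule_format, of v]]
    by (simp add: algebra_simps sum.distrib sum_distrib_left sum_distrib_right)
  then show ?case using * mult.hyps
    by (intro exI[of _ "\<lambda>k v. p v * q' k v + p' k v * q v"])
      (auto intro!: tanh_polynomials.add tanh_polynomials.mult)
qed

lemma tanh_polynomials_partial_deriv:
  assumes "p \<in> tanh_polynomials"
  shows "p differentiable_on UNIV" "partial_deriv k p \<in> tanh_polynomials"
proof -
  obtain p' where p': "\<And>k. p' k \<in> tanh_polynomials"
    "\<And>v. (p has_derivative (\<lambda>h. \<Sum>k\<in>UNIV. p' k v * h $ k)) (at v)"
    using tanh_polynomials_derivative[OF assms] by blast
  show "p differentiable_on UNIV"
    using p'(2) by (auto simp: differentiable_on_def differentiable_def)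
  have "partial_deriv k p v = p' k v" for v
    using frechet_derivative_at[OF p'(2)[of v], symmetric]
    by (simp add: partial_deriv_def axis_def if_distrib[of "\<lambda>x. _ * x"] cong: if_cong)
  then have "partial_deriv k p = p' k" by auto
  with p'(1) show "partial_deriv k p \<in> tanh_polynomials" by simp
qed

lemma tanh_polynomials_subset_C2b: "tanh_polynomials \<subseteq> C2b"
  unfolding C2b_def
  using tanh_polynomials_bounded tanh_polynomials_partial_deriv differentiable_imp_continuous_on
  by blast

lemma tanh_polynomials_continuous: "p \<in> tanh_polynomials \<Longrightarrow> continuous_on UNIV p"
  using tanh_polynomials_partial_deriv(1) differentiable_imp_continuous_on by blast

lemma tanh_artanh_real: "\<bar>y\<bar> < 1 \<Longrightarrow> tanh (artanh y) = (y :: real)"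
proof -
  assume y: "\<bar>y\<bar> < 1"
  then have pos: "(1 + y) / (1 - y) > 0" by auto
  have "exp (- 2 * artanh y) = inverse ((1 + y) / (1 - y))"
    unfolding artanh_def using pos by (simp add: exp_minus)
  moreover have "(1 - x) / (1 + x) = y" if "x = inverse ((1 + y) / (1 - y))" for x
    unfolding that using y by (simp add: divide_simps)
  ultimately show ?thesis unfolding tanh_real_altdef by blast
qed

text \<open>Coordinatewise tanh maps space homeomorphically onto the open cube. A function of
  compact support becomes a function that extends by 0 to the closed cube, where ordinary
  polynomials are dense.\<close>

lemma tanh_polynomials_dense:
  fixes g :: "real^3 \<Rightarrow> real"
  assumes g: "continuous_on UNIV g" and supp: "\<And>v. M < norm v \<Longrightarrow> g v = 0" and "\<epsilon> > 0"
  shows "\<exists>p\<in>tanh_polynomials. \<forall>v. \<bar>g v - p v\<bar> < \<epsilon>"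
proof -
  define T :: "real^3 \<Rightarrow> real^3" where "T v = (\<chi> i. tanh (v $ i))" for v
  define A :: "real^3 \<Rightarrow> real^3" where "A y = (\<chi> i. artanh (y $ i))" for y
  define U :: "(real^3) set" where "U = {y. \<forall>i. \<bar>y $ i\<bar> < 1}"
  define G where "G y = (if y \<in> U then g (A y) else 0)" for y
  have TU: "T v \<in> U" for v using tanh_real_lt_1 tanh_real_gt_neg1 by (auto simp: T_def U_def abs_less_iff minus_less_iff)
  have AT: "A (T v) = v" for v by (simp add: A_def T_def artanh_tanh_real vec_eq_iff)
  have TA: "T (A y) = y" if "y \<in> U" for y using that by (simp add: A_def T_def tanh_artanh_real vec_eq_iff U_def)
  have contT: "continuous_on UNIV T" unfolding T_def by (intro continuous_intros) auto
  have "U = (\<Inter>i. {y. \<bar>y $ i\<bar> < 1})" by (auto simp: U_def)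
  then have oU: "open U"
    by (auto intro!: open_INT open_Collect_less continuous_intros)
  have cK: "closed (T ` cball 0 M)"
    by (intro compact_imp_closed compact_continuous_image continuous_on_subset[OF contT]) auto
  have G1: "continuous_on U G"
  proof -
    have "continuous_on U (\<lambda>y. artanh (y $ i))" for i
      by (rule continuous_on_compose2[OF continuous_on_artanh[where A="{-1<..<1}"]])
        (auto simp: U_def abs_less_iff minus_less_iff intro!: continuous_intros)
    then have "continuous_on U A"
      unfolding A_def by (rule continuous_on_vec_lambda)
    then have "continuous_on U (\<lambda>y. g (A y))"
      using continuous_on_compose2[OF g] by blast
    then show ?thesis by (rule continuous_on_eq) (simp add: G_def)
  qed
  \<comment> \<open>The image of the ball is compact inside the open cube, so its complement is an
    open set containing the faces of the cube, and G vanishes there. Together with U it covers the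
    whole space.\<close>
  have G2: "continuous_on (- T ` cball 0 M) G"
  proof (rule continuous_on_eq[OF continuous_on_const[of _ 0]])
    fix y assume y: "y \<in> - T ` cball 0 M"
    show "0 = G y"
    proof (cases "y \<in> U")
      case True
      then have "A y \<notin> cball 0 M" using y TA[OF True] by force
      then show ?thesis using supp[of "A y"] by (simp add: G_def)
    qed (simp add: G_def)
  qed
  have "continuous_on (U \<union> - T ` cball 0 M) G"
    by (rule continuous_on_open_Un[OF oU _ G1 G2]) (use cK in auto)
  moreover have "U \<union> - T ` cball 0 M = UNIV" using TU by auto
  ultimately have contG: "continuous_on UNIV G" by simp
  \<comment> \<open>Functions on the cube whose pullback under T is a
    \<open>tanh_polynomials\<close> function; the coordinate functions separate points.\<close>
  define R where "R = {F. continuous_on (cbox (-1) 1) F \<and> (\<lambda>v. F (T v)) \<in> tanh_polynomials}"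
  interpret function_ring_on R "cbox (-1) (1 :: real^3)"
  proof
    fix x y :: "real^3" assume "x \<noteq> y"
    then obtain i where i: "x $ i \<noteq> y $ i" by (auto simp: vec_eq_iff)
    have "continuous_on (cbox (-1) 1) (\<lambda>y :: real^3. y $ i)" by (intro continuous_intros)
    then have "(\<lambda>y. y $ i) \<in> R"
      by (simp add: R_def T_def tanh_polynomials.tanh)
    with i show "\<exists>f\<in>R. f x \<noteq> f y" by (intro bexI[of _ "\<lambda>y. y $ i"])
  qed (auto simp: R_def intro: continuous_intros tanh_polynomials.intros)
  obtain F where F: "F \<in> R" "\<forall>x\<in>cbox (-1) 1. \<bar>G x - F x\<bar> < \<epsilon>"
    using Stone_Weierstrass_basic[OF continuous_on_subset[OF contG] \<open>\<epsilon> > 0\<close>] by blast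
  show ?thesis
  proof (rule bexI[of _ "\<lambda>v. F (T v)"], rule allI)
    fix v
    have "T v \<in> cbox (-1) 1" using TU[of v] by (auto simp: U_def mem_box_cart abs_less_iff minus_less_iff less_imp_le)
    then have "\<bar>G (T v) - F (T v)\<bar> < \<epsilon>" using F(2) by blast
    then show "\<bar>g v - F (T v)\<bar> < \<epsilon>" using TU by (simp add: G_def AT)
  qed (use F(1) in \<open>simp add: R_def\<close>)
qed

lemma moment_2_real:
  assumes "\<mu> \<in> prob_measures" "moment 2 \<mu> \<le> ennreal K" "0 \<le> K"
  shows "integrable \<mu> (\<lambda>v. (norm v)\<^sup>2)" "(\<integral>v. (norm v)\<^sup>2 \<partial>\<mu>) \<le> K"
proof -
  note prob_measuresD(2)[OF assms(1), measurable_cong]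
  have eq: "(\<integral>\<^sup>+v. ennreal ((norm v)\<^sup>2) \<partial>\<mu>) = moment 2 \<mu>"
    unfolding moment_def by (simp add: powr_numeral)
  show int: "integrable \<mu> (\<lambda>v. (norm v)\<^sup>2)"
  proof (rule integrableI_nonneg)
    show "(\<integral>\<^sup>+v. ennreal ((norm v)\<^sup>2) \<partial>\<mu>) < \<infinity>"
      unfolding eq using assms(2) ennreal_less_top[of K] by (metis infinity_ennreal_def le_less_trans)
  qed auto
  have "ennreal (\<integral>v. (norm v)\<^sup>2 \<partial>\<mu>) \<le> ennreal K"
    using nn_integral_eq_integral[OF int] eq assms(2) by simp
  then show "(\<integral>v. (norm v)\<^sup>2 \<partial>\<mu>) \<le> K" using assms(3) by (simp add: ennreal_le_iff)
qed

lemma integrable_continuous_bounded: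
  fixes g :: "real^3 \<Rightarrow> real"
  assumes "\<mu> \<in> prob_measures" "continuous_on UNIV g" "bounded (range g)"
  shows "integrable \<mu> g"
proof -
  interpret prob_space \<mu> using prob_measuresD[OF assms(1)] by simp
  obtain B where B: "\<And>v. \<bar>g v\<bar> \<le> B" using assms(3) by (auto simp: bounded_iff)
  have "g \<in> borel_measurable \<mu>"
    using borel_measurable_continuous_onI[OF assms(2)] measurable_cong_sets[OF prob_measuresD(2)[OF assms(1)] refl] by blast
  then show ?thesis by (intro integrable_const_bound[where B=B]) (use B in auto)
qed

text \<open>Test functions from the algebra suffice because the second moment bounds the cost of
  cutting g off at radius M by B K / M^2, uniformly in n; the compactly supported remainder is then
  approximated uniformly.\<close>

lemma Cauchy_imp_weakly_converges:
  assumes \<mu>: "\<And>n. \<mu> n \<in> prob_measures" and K: "\<And>n. moment 2 (\<mu> n) \<le> ennreal K" "0 \<le> K"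
    and Cau: "\<And>p. p \<in> tanh_polynomials \<Longrightarrow> Cauchy (\<lambda>n. \<integral>v. p v \<partial>\<mu> n)"
  shows "\<exists>\<nu>\<in>prob_measures. weakly_converges \<mu> \<nu>"
proof -
  have C: "Cauchy (\<lambda>n. \<integral>v. g v \<partial>\<mu> n)"
    if g: "continuous_on UNIV g" "bounded (range g)" for g :: "real^3 \<Rightarrow> real"
  proof (rule metric_CauchyI)
    fix e :: real assume e: "e > 0"
    obtain B where B: "\<And>v. \<bar>g v\<bar> \<le> B" using g(2) by (auto simp: bounded_iff)
    have B0: "0 \<le> B" using B[of 0] by simp
    \<comment> \<open>Chosen for B K / M^2 \<le> e / 4, the outer summand 1 making M positive. Two
      cut-off errors e / 4, two approximation errors e / 16 and the Cauchy error e / 16 add up to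
      less than e.\<close>
    define M where "M = sqrt (4 * (B * K + 1) / e) + 1"
    have M0: "M > 0" "4 * (B * K + 1) / e \<le> M\<^sup>2"
    proof -
      have nn: "0 \<le> 4 * (B * K + 1) / e" using B0 K e by auto
      then show "M > 0" unfolding M_def by (smt (verit) real_sqrt_ge_zero)
      have "(sqrt (4 * (B * K + 1) / e))\<^sup>2 \<le> M\<^sup>2"
        unfolding M_def using nn by (intro power_mono) auto
      then show "4 * (B * K + 1) / e \<le> M\<^sup>2" using nn by simp
    qed
    have BK: "B * K / M\<^sup>2 \<le> e / 4"
      using M0 e B0 K by (simp add: field_simps)
    define h where "h v = g v * max 0 (1 - (norm v)\<^sup>2 / M\<^sup>2)" for v
    have hc: "continuous_on UNIV h" unfolding h_def using M0 by (intro continuous_intros g) auto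
    have h0: "h v = 0" if "M < norm v" for v
    proof -
      have "M\<^sup>2 \<le> (norm v)\<^sup>2" using that M0 by (intro power_mono) auto
      then show ?thesis using M0 by (simp add: h_def)
    qed
    have chi: "0 \<le> max 0 (1 - (norm v)\<^sup>2 / M\<^sup>2)" "max 0 (1 - (norm v)\<^sup>2 / M\<^sup>2) \<le> 1" for v :: "real^3" by auto
    have hb: "bounded (range h)"
    proof -
      have "\<bar>h v\<bar> \<le> B * 1" for v
        unfolding h_def abs_mult using B[of v] B0 chi[of v] by (intro mult_mono) auto
      then show ?thesis by (auto simp: bounded_iff)
    qed
    have gh: "\<bar>(\<integral>v. g v \<partial>\<mu> n) - (\<integral>v. h v \<partial>\<mu> n)\<bar> \<le> e / 4" for n
    proof -
      note i1 = integrable_continuous_bounded[OF \<mu>[of n] g] and i2 = integrable_continuous_bounded[OF \<mu>[of n] hc hb]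
      have "\<bar>(\<integral>v. g v \<partial>\<mu> n) - (\<integral>v. h v \<partial>\<mu> n)\<bar> = norm (\<integral>v. g v - h v \<partial>\<mu> n)"
        using i1 i2 by simp
      also have "\<dots> \<le> (\<integral>v. norm (g v - h v) \<partial>\<mu> n)" by (rule integral_norm_bound)
      also have "\<dots> \<le> (\<integral>v. B / M\<^sup>2 * (norm v)\<^sup>2 \<partial>\<mu> n)"
      proof (intro integral_mono)
        show "integrable (\<mu> n) (\<lambda>v. norm (g v - h v))" using i1 i2 by auto
        show "integrable (\<mu> n) (\<lambda>v. B / M\<^sup>2 * (norm v)\<^sup>2)" using moment_2_real[OF \<mu> K] by auto
        fix v
        have "norm (g v - h v) = \<bar>g v\<bar> * (1 - max 0 (1 - (norm v)\<^sup>2 / M\<^sup>2))"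
          using chi(2)[of v] unfolding h_def real_norm_def by (metis abs_mult abs_of_nonneg diff_ge_0_iff_ge mult.right_neutral right_diff_distrib)
        also have "\<dots> \<le> B * ((norm v)\<^sup>2 / M\<^sup>2)" using B[of v] B0 chi by (intro mult_mono) auto
        finally show "norm (g v - h v) \<le> B / M\<^sup>2 * (norm v)\<^sup>2" by simp
      qed
      also have "\<dots> \<le> B / M\<^sup>2 * K" using moment_2_real(2)[OF \<mu> K, of n] B0 by (simp add: mult_left_mono del: times_divide_eq_left)
      also have "\<dots> \<le> e / 4" using BK by simp
      finally show ?thesis .
    qed
    obtain p where p: "p \<in> tanh_polynomials" "\<And>v. \<bar>h v - p v\<bar> < e / 16"
      using tanh_polynomials_dense[OF hc, of M "e / 16"] h0 e by auto
    have hp: "\<bar>(\<integral>v. h v \<partial>\<mu> n) - (\<integral>v. p v \<partial>\<mu> n)\<bar> \<le> e / 16" for n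
    proof -
      interpret prob_space "\<mu> n" using prob_measuresD[OF \<mu>] by simp
      note i1 = integrable_continuous_bounded[OF \<mu>[of n] tanh_polynomials_continuous[OF p(1)] tanh_polynomials_bounded[OF p(1)]]
        and i2 = integrable_continuous_bounded[OF \<mu>[of n] hc hb]
      have "\<bar>(\<integral>v. h v \<partial>\<mu> n) - (\<integral>v. p v \<partial>\<mu> n)\<bar> = norm (\<integral>v. h v - p v \<partial>\<mu> n)" using i1 i2 by simp
      also have "\<dots> \<le> (\<integral>v. norm (h v - p v) \<partial>\<mu> n)" by (rule integral_norm_bound)
      also have "\<dots> \<le> (\<integral>v. e / 16 \<partial>\<mu> n)" using i1 i2 p(2) less_imp_le by (intro integral_mono) auto
      finally show ?thesis using prob_space by simp
    qed
    obtain N where N: "\<And>m n. m \<ge> N \<Longrightarrow> n \<ge> N \<Longrightarrow> dist (\<integral>v. p v \<partial>\<mu> m) (\<integral>v. p v \<partial>\<mu> n) < e / 16"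
      using metric_CauchyD[OF Cau[OF p(1)], of "e / 16"] e by auto
    show "\<exists>N. \<forall>m\<ge>N. \<forall>n\<ge>N. dist (\<integral>v. g v \<partial>\<mu> m) (\<integral>v. g v \<partial>\<mu> n) < e"
    proof (intro exI[of _ N] allI impI)
      fix m n assume "N \<le> m" "N \<le> n"
      from N[OF this] gh[of m] gh[of n] hp[of m] hp[of n] e
      show "dist (\<integral>v. g v \<partial>\<mu> m) (\<integral>v. g v \<partial>\<mu> n) < e"
        unfolding dist_real_def by linarith
    qed
  qed
  \<comment> \<open>Compactness supplies a candidate along a subsequence; the Cauchy property
    carries the limit over to the whole sequence.\<close>
  obtain r X Y and \<Omega> :: "real measure" where *: "strict_mono r" "prob_space \<Omega>"
    "\<And>n. X n \<in> \<Omega> \<rightarrow>\<^sub>M borel" "Y \<in> \<Omega> \<rightarrow>\<^sub>M borel" "\<And>n. distr \<Omega> borel (X n) = \<mu> (r n)"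
    "AE \<omega> in \<Omega>. (\<lambda>n. X n \<omega>) \<longlonglongrightarrow> Y \<omega>"
    by (rule prokhorov_skorokhod[OF \<mu> K(1)]) (simp, rule that)
  have "weakly_converges \<mu> (distr \<Omega> borel Y)"
    unfolding weakly_converges_def
  proof (intro allI impI)
    fix g :: "real^3 \<Rightarrow> real" assume g: "continuous_on UNIV g" "bounded (range g)"
    obtain l where l: "(\<lambda>n. \<integral>v. g v \<partial>\<mu> n) \<longlonglongrightarrow> l"
      using Cauchy_convergent[OF C[OF g]] by (auto simp: convergent_def)
    from LIMSEQ_subseq_LIMSEQ[OF this *(1)] AE_tendsto_integral_distr[OF *(2,3,4,6) g]
    have "l = (\<integral>v. g v \<partial>distr \<Omega> borel Y)"
      unfolding *(5) o_def by (rule LIMSEQ_unique)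
    with l show "(\<lambda>n. \<integral>v. g v \<partial>\<mu> n) \<longlonglongrightarrow> (\<integral>v. g v \<partial>distr \<Omega> borel Y)" by simp
  qed
  then show ?thesis using prob_measures_distr[OF *(2,4)] by blast
qed

section \<open>Collisions approximating the Landau operator\<close>

lemma has_derivative_partial_deriv:
  fixes \<phi> :: "real^3 \<Rightarrow> real"
  assumes "\<phi> differentiable_on UNIV"
  shows "(\<phi> has_derivative (\<lambda>d. \<Sum>k\<in>UNIV. partial_deriv k \<phi> v * d $ k)) (at v)"
proof -
  have der: "(\<phi> has_derivative frechet_derivative \<phi> (at v)) (at v)"
    using assms frechet_derivative_works by (auto simp: differentiable_on_def)
  then have lin: "linear (frechet_derivative \<phi> (at v))"
    by (rule has_derivative_linear)
  have "frechet_derivative \<phi> (at v) d = (\<Sum>k\<in>UNIV. partial_deriv k \<phi> v * d $ k)" for d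
  proof -
    have "frechet_derivative \<phi> (at v) d = frechet_derivative \<phi> (at v) (\<Sum>k\<in>UNIV. d $ k *\<^sub>R axis k 1)"
      using basis_expansion[of d] by (simp add: scalar_mult_eq_scaleR)
    also have "\<dots> = (\<Sum>k\<in>UNIV. d $ k * frechet_derivative \<phi> (at v) (axis k 1))"
      by (simp add: linear_sum[OF lin] linear_scale[OF lin])
    finally show ?thesis by (simp add: partial_deriv_def mult.commute)
  qed
  with der show ?thesis by (metis (no_types, lifting) ext)
qed

text \<open>Taylor's formula along the segment, in Lagrange form: as the second derivatives are
  merely continuous, the remainder is kept at an intermediate point whose distance from v is
  controlled by d.\<close>

lemma C2b_taylor:
  assumes \<phi>: "\<phi> \<in> C2b"
  shows "\<exists>\<xi>. norm (\<xi> - v) \<le> norm d \<and> \<phi> (v + d) = \<phi> v + (\<Sum>k\<in>UNIV. partial_deriv k \<phi> v * d $ k)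
    + 1 / 2 * (\<Sum>k\<in>UNIV. \<Sum>l\<in>UNIV. partial_deriv k (partial_deriv l \<phi>) \<xi> * (d $ k * d $ l))"
proof -
  have d1: "\<phi> differentiable_on UNIV" and d2: "\<And>k. partial_deriv k \<phi> differentiable_on UNIV"
    using \<phi> by (auto simp: C2b_def)
  have chain: "((\<lambda>t. \<psi> (v + t *\<^sub>R d)) has_real_derivative (\<Sum>k\<in>UNIV. partial_deriv k \<psi> (v + t *\<^sub>R d) * d $ k)) (at t)"
    if "\<psi> differentiable_on UNIV" for \<psi> :: "real^3 \<Rightarrow> real" and t :: real
  proof -
    have "((\<lambda>t. v + t *\<^sub>R d) has_derivative (\<lambda>s. s *\<^sub>R d)) (at t)"
      by (auto intro!: derivative_eq_intros)
    from has_derivative_compose[OF this has_derivative_partial_deriv[OF that]]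
    have "((\<lambda>t. \<psi> (v + t *\<^sub>R d)) has_derivative (\<lambda>s. \<Sum>k\<in>UNIV. partial_deriv k \<psi> (v + t *\<^sub>R d) * (s *\<^sub>R d) $ k)) (at t)" .
    moreover have "(\<lambda>s. \<Sum>k\<in>UNIV. partial_deriv k \<psi> (v + t *\<^sub>R d) * (s *\<^sub>R d) $ k)
      = (*) (\<Sum>k\<in>UNIV. partial_deriv k \<psi> (v + t *\<^sub>R d) * d $ k)"
      by (auto simp: fun_eq_iff sum_distrib_left mult_ac)
    ultimately show ?thesis
      unfolding has_field_derivative_def by simp
  qed
  define diff where "diff m t = (if m = 0 then \<phi> (v + t *\<^sub>R d)
     else if m = 1 then (\<Sum>k\<in>UNIV. partial_deriv k \<phi> (v + t *\<^sub>R d) * d $ k)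
     else (\<Sum>k\<in>UNIV. \<Sum>l\<in>UNIV. partial_deriv k (partial_deriv l \<phi>) (v + t *\<^sub>R d) * (d $ k * d $ l)))" for m :: nat and t
  have "DERIV (diff m) t :> diff (Suc m) t" if "m < 2" for m t
  proof -
    have "m = 0 \<or> m = 1" using that by auto
    then show ?thesis
    proof
      assume "m = 0"
      then show ?thesis using chain[OF d1] by (simp add: diff_def[abs_def])
    next
      assume m: "m = 1"
      have "((\<lambda>t. \<Sum>l\<in>UNIV. partial_deriv l \<phi> (v + t *\<^sub>R d) * d $ l) has_real_derivative
        (\<Sum>l\<in>UNIV. (\<Sum>k\<in>UNIV. partial_deriv k (partial_deriv l \<phi>) (v + t *\<^sub>R d) * d $ k) * d $ l)) (at t)"
        by (intro DERIV_sum DERIV_cmult_right chain d2)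
      also have "(\<Sum>l\<in>UNIV. (\<Sum>k\<in>UNIV. partial_deriv k (partial_deriv l \<phi>) (v + t *\<^sub>R d) * d $ k) * d $ l)
        = (\<Sum>l\<in>UNIV. \<Sum>k\<in>UNIV. partial_deriv k (partial_deriv l \<phi>) (v + t *\<^sub>R d) * (d $ k * d $ l))"
        by (simp add: sum_distrib_right mult.assoc)
      also have "\<dots> = (\<Sum>k\<in>UNIV. \<Sum>l\<in>UNIV. partial_deriv k (partial_deriv l \<phi>) (v + t *\<^sub>R d) * (d $ k * d $ l))"
        by (rule sum.swap)
      finally show ?thesis using m by (simp add: diff_def[abs_def])
    qed
  qed
  then obtain t where t: "0 < t" "t < 1"
    "diff 0 1 = (\<Sum>m<2. diff m 0 / fact m * 1 ^ m) + diff 2 t / fact 2 * 1 ^ 2"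
    using Maclaurin[of 1 2 diff "diff 0"] by auto
  have "norm ((v + t *\<^sub>R d) - v) \<le> norm d" using t mult_left_le_one_le[of "norm d" t] by simp
  moreover have "\<phi> (v + d) = \<phi> v + (\<Sum>k\<in>UNIV. partial_deriv k \<phi> v * d $ k)
    + 1 / 2 * (\<Sum>k\<in>UNIV. \<Sum>l\<in>UNIV. partial_deriv k (partial_deriv l \<phi>) (v + t *\<^sub>R d) * (d $ k * d $ l))"
    using t(3) by (simp add: diff_def numeral_2_eq_2 lessThan_Suc)
  ultimately show ?thesis by blast
qed

text \<open>A collision of \<open>v\<close> with \<open>w\<close> rotates the relative velocity \<open>x = v - w\<close> about one of the
  coordinate axes, by an angle \<open>\<plusminus>\<theta>\<close> with \<open>1 - cos \<theta> = \<kappa>\<close>, and keeps \<open>v + w\<close>; \<open>jump\<close> is the displacement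
  of \<open>v\<close>.  Averaging the squares of the three infinitesimal rotations of \<open>x\<close> yields
  \<open>\<bar>x\<bar>\<^sup>2 I - x x\<^sup>*\<close>, which is why six rotations suffice to produce the Landau matrix.\<close>

definition jump :: "real \<Rightarrow> 3 \<times> bool \<Rightarrow> real^3 \<Rightarrow> real^3" where
  "jump \<kappa> j x = (1 / 2) *\<^sub>R (((if snd j then 1 else - 1) * sqrt (2 * \<kappa> - \<kappa>\<^sup>2)) *\<^sub>R cross3 (axis (fst j) 1) x
     - \<kappa> *\<^sub>R (x - (x $ fst j) *\<^sub>R axis (fst j) 1))"

text \<open>The cap keeps the angle at most a right angle, so 2 \<kappa> - \<kappa>^2, its squared
  sine, is nonnegative. The factor 6 fits the drift: the six displacements sum to - 2 \<kappa> x,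
  their mean divided by h is - \<kappa> x / (3 h), and this is \<open>landau_b \<gamma> x\<close>
  when \<kappa> = 6 h |x|^\<gamma>.\<close>

definition angle_gap :: "real \<Rightarrow> real \<Rightarrow> real^3 \<Rightarrow> real" where
  "angle_gap \<gamma> h x = min 1 (6 * h * norm x powr \<gamma>)"

definition post :: "real \<Rightarrow> real \<Rightarrow> 3 \<times> bool \<Rightarrow> real^3 \<Rightarrow> real^3 \<Rightarrow> real^3" where
  "post \<gamma> h j v w = v + jump (angle_gap \<gamma> h (v - w)) j (v - w)"

definition discrete_L :: "real \<Rightarrow> real \<Rightarrow> (real^3 \<Rightarrow> real) \<Rightarrow> real^3 \<Rightarrow> real^3 \<Rightarrow> real" where
  "discrete_L \<gamma> h \<phi> v w = ((\<Sum>j\<in>UNIV. \<phi> (post \<gamma> h j v w)) / 6 - \<phi> v) / h"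

lemma sum_UNIV_3_bool: "(\<Sum>j\<in>UNIV. f j) = (\<Sum>k\<in>UNIV. f (k, True) + f (k, False))" for f :: "3 \<times> bool \<Rightarrow> 'a::comm_monoid_add"
proof -
  have "(\<Sum>j\<in>UNIV. f j) = (\<Sum>k\<in>UNIV. \<Sum>b\<in>UNIV. f (k, b))"
    unfolding UNIV_Times_UNIV[symmetric] sum.cartesian_product by simp
  then show ?thesis by (simp add: UNIV_bool add.commute)
qed

lemma angle_gap_bounds:
  assumes "0 \<le> h"
  shows "0 \<le> angle_gap \<gamma> h x" "angle_gap \<gamma> h x \<le> 1" "angle_gap \<gamma> h x \<le> 6 * h * norm x powr \<gamma>"
  using assms by (auto simp: angle_gap_def)

text \<open>The part of x orthogonal to the axis has squared length |x|^2 - x_i^2; rotating it by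
  the angle gives a chord of squared length 2 \<kappa> times this, and the displacement is half the
  chord.\<close>

lemma norm_jump_eq:
  assumes "0 \<le> \<kappa>" "\<kappa> \<le> 1"
  shows "(norm (jump \<kappa> j x))\<^sup>2 = \<kappa> / 2 * ((norm x)\<^sup>2 - (x $ fst j)\<^sup>2)"
proof -
  have q: "(sqrt (2 * \<kappa> - \<kappa>\<^sup>2))\<^sup>2 = 2 * \<kappa> - \<kappa>\<^sup>2"
    using assms mult_left_le_one_le[of \<kappa> \<kappa>] by (simp add: power2_eq_square)
  obtain i b where j: "j = (i, b)" by (cases j)
  define c where "c = (if b then 1 else - 1) * sqrt (2 * \<kappa> - \<kappa>\<^sup>2)"
  have c2: "c * c = 2 * \<kappa> - \<kappa>\<^sup>2" using q by (auto simp: c_def power2_eq_square)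
  define u where "u = c *\<^sub>R cross3 (axis i 1) x - \<kappa> *\<^sub>R (x - (x $ i) *\<^sub>R axis i 1)"
  have "jump \<kappa> j x = (1 / 2) *\<^sub>R u"
    by (simp add: jump_def j c_def u_def)
  then have "4 * (norm (jump \<kappa> j x))\<^sup>2 = (norm u)\<^sup>2" by (simp add: power_divide)
  also have "\<dots> = (c * c + \<kappa> * \<kappa>) * ((norm x)\<^sup>2 - (x $ i)\<^sup>2)"
    unfolding power2_norm_eq_inner u_def using exhaust_3[of i]
    by (auto simp: inner_vec_def sum_3 cross3_def vector_def axis_def power2_eq_square algebra_simps)
  finally show ?thesis by (simp add: j c2 power2_eq_square algebra_simps)
qed

lemma norm_jump:
  assumes "0 \<le> \<kappa>" "\<kappa> \<le> 1"
  shows "(norm (jump \<kappa> j x))\<^sup>2 \<le> \<kappa> / 2 * (norm x)\<^sup>2"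
  unfolding norm_jump_eq[OF assms] using assms by (intro mult_left_mono) auto

lemma sum_jump: "(\<Sum>j\<in>UNIV. jump \<kappa> j x $ k) = - 2 * \<kappa> * x $ k"
  using exhaust_3[of k]
  by (auto simp: sum_UNIV_3_bool sum_3 jump_def cross3_def vector_def axis_def algebra_simps)

section \<open>Expansion, growth and limit of the discrete operator\<close>

lemma C2b_bounds:
  assumes "\<phi> \<in> C2b"
  obtains B where "0 \<le> B" "\<And>k v. \<bar>partial_deriv k \<phi> v\<bar> \<le> B" "\<And>k l v. \<bar>partial_deriv k (partial_deriv l \<phi>) v\<bar> \<le> B"
    "\<And>v. \<bar>\<phi> v\<bar> \<le> B"
proof -
  have "\<forall>k. \<exists>B. \<forall>v. \<bar>partial_deriv k \<phi> v\<bar> \<le> B" "\<forall>k l. \<exists>B. \<forall>v. \<bar>partial_deriv k (partial_deriv l \<phi>) v\<bar> \<le> B"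
    "\<exists>B. \<forall>v. \<bar>\<phi> v\<bar> \<le> B"
    using assms by (auto simp: C2b_def bounded_iff)
  then obtain B1 B2 B3 where B: "\<And>k v. \<bar>partial_deriv k \<phi> v\<bar> \<le> B1 k"
    "\<And>k l v. \<bar>partial_deriv k (partial_deriv l \<phi>) v\<bar> \<le> B2 k l" "\<And>v. \<bar>\<phi> v\<bar> \<le> B3"
    by metis
  have nn: "0 \<le> B1 k" "0 \<le> B2 k l" "0 \<le> B3" for k l using B(1)[of k 0] B(2)[of k l 0] B(3)[of 0] by auto
  define B where "B = (\<Sum>k\<in>UNIV. B1 k) + (\<Sum>k\<in>UNIV. \<Sum>l\<in>UNIV. B2 k l) + B3"
  have s1: "B1 k \<le> (\<Sum>k\<in>UNIV. B1 k)" for k using nn by (intro member_le_sum) auto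
  have s2: "B2 k l \<le> (\<Sum>k\<in>UNIV. \<Sum>l\<in>UNIV. B2 k l)" for k l
  proof -
    have "B2 k l \<le> (\<Sum>l\<in>UNIV. B2 k l)" using nn by (intro member_le_sum) auto
    also have "\<dots> \<le> (\<Sum>k\<in>UNIV. \<Sum>l\<in>UNIV. B2 k l)"
      using nn by (intro member_le_sum[where f="\<lambda>k. \<Sum>l\<in>UNIV. B2 k l"]) (auto intro: sum_nonneg)
    finally show ?thesis .
  qed
  have p: "0 \<le> (\<Sum>k\<in>UNIV. B1 k)" "0 \<le> (\<Sum>k\<in>UNIV. \<Sum>l\<in>UNIV. B2 k l)" using nn by (auto intro!: sum_nonneg)
  show ?thesis
  proof (rule that[of B])
    show "\<bar>partial_deriv k \<phi> v\<bar> \<le> B" for k v using B(1)[of k v] s1[of k] p nn unfolding B_def by linarith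
    show "\<bar>partial_deriv k (partial_deriv l \<phi>) v\<bar> \<le> B" for k l v using B(2)[of k l v] s2[of k l] p nn unfolding B_def by linarith
    show "\<bar>\<phi> v\<bar> \<le> B" for v using B(3)[of v] p unfolding B_def by linarith
  qed (use p nn in \<open>auto simp: B_def\<close>)
qed

lemma norm_diff_powr_le:
  fixes v w :: "real^3"
  assumes "0 \<le> q"
  shows "norm (v - w) powr q \<le> 2 powr q * (norm v powr q + norm w powr q)"
proof -
  have "norm (v - w) \<le> 2 * max (norm v) (norm w)" using norm_triangle_ineq4[of v w] by auto
  then have "norm (v - w) powr q \<le> (2 * max (norm v) (norm w)) powr q"
    using assms by (intro powr_mono2) auto
  also have "\<dots> = 2 powr q * (max (norm v) (norm w)) powr q" by (simp add: powr_mult)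
  also have "\<dots> \<le> 2 powr q * (norm v powr q + norm w powr q)"
    by (intro mult_left_mono) (auto simp: max_def)
  finally show ?thesis .
qed

text \<open>The first-order terms are summed exactly by \<open>sum_jump\<close>, since they are all
  taken at v; the second-order terms sit at different points for different rotations and stay under
  the sum. The factor 1 / 12 is the mean over six times the Taylor factor 1 / 2.\<close>

lemma discrete_L_expand:
  assumes \<phi>: "\<phi> \<in> C2b" and h: "h > 0"
  shows "\<exists>\<xi>. (\<forall>j. norm (\<xi> j - v) \<le> norm (jump (angle_gap \<gamma> h (v - w)) j (v - w))) \<and>
    discrete_L \<gamma> h \<phi> v w = - (angle_gap \<gamma> h (v - w) / h) / 3 * (\<Sum>k\<in>UNIV. partial_deriv k \<phi> v * (v - w) $ k)
     + 1 / 12 * (\<Sum>j\<in>UNIV. \<Sum>k\<in>UNIV. \<Sum>l\<in>UNIV. partial_deriv k (partial_deriv l \<phi>) (\<xi> j) *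
         (jump (angle_gap \<gamma> h (v - w)) j (v - w) $ k * jump (angle_gap \<gamma> h (v - w)) j (v - w) $ l / h))"
proof -
  define d where "d j = jump (angle_gap \<gamma> h (v - w)) j (v - w)" for j
  define Lin where "Lin j = (\<Sum>k\<in>UNIV. partial_deriv k \<phi> v * d j $ k)" for j
  define Quad where "Quad j \<xi> = (\<Sum>k\<in>UNIV. \<Sum>l\<in>UNIV. partial_deriv k (partial_deriv l \<phi>) \<xi> * (d j $ k * d j $ l))" for j \<xi>
  have "\<forall>j. \<exists>\<xi>. norm (\<xi> - v) \<le> norm (d j) \<and> \<phi> (v + d j) = \<phi> v + Lin j + 1 / 2 * Quad j \<xi>"
    unfolding Lin_def Quad_def by (intro allI C2b_taylor[OF \<phi>])
  from choice[OF this] obtain \<xi> where \<xi>: "\<And>j. norm (\<xi> j - v) \<le> norm (d j)"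
    "\<And>j. \<phi> (v + d j) = \<phi> v + Lin j + 1 / 2 * Quad j (\<xi> j)"
    by blast
  have "(\<Sum>j\<in>UNIV. \<Sum>k\<in>UNIV. partial_deriv k \<phi> v * d j $ k) = (\<Sum>k\<in>UNIV. partial_deriv k \<phi> v * (\<Sum>j\<in>UNIV. d j $ k))"
    by (subst sum.swap) (simp add: sum_distrib_left)
  also have "\<dots> = - 2 * angle_gap \<gamma> h (v - w) * (\<Sum>k\<in>UNIV. partial_deriv k \<phi> v * (v - w) $ k)"
    unfolding d_def sum_jump by (simp add: sum_distrib_left mult_ac sum_negf)
  finally have lin: "(\<Sum>j\<in>UNIV. \<Sum>k\<in>UNIV. partial_deriv k \<phi> v * d j $ k)
    = - 2 * angle_gap \<gamma> h (v - w) * (\<Sum>k\<in>UNIV. partial_deriv k \<phi> v * (v - w) $ k)" .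
  have card: "card (UNIV :: (3 \<times> bool) set) = 6" by simp
  have scale: "(s / 6 - p) / h = a / h / 6 + 1 / 12 * (b / h)" if "s = 6 * p + a + 1 / 2 * b" for s p a b :: real
    using h unfolding that by (simp add: field_simps)
  have "(\<Sum>j\<in>UNIV. \<phi> (post \<gamma> h j v w)) = (\<Sum>j\<in>UNIV. \<phi> v + Lin j + 1 / 2 * Quad j (\<xi> j))"
    unfolding post_def d_def[symmetric] \<xi>(2) ..
  also have "\<dots> = 6 * \<phi> v + (\<Sum>j\<in>UNIV. Lin j) + 1 / 2 * (\<Sum>j\<in>UNIV. Quad j (\<xi> j))"
    by (simp add: sum.distrib card sum_divide_distrib)
  finally have "discrete_L \<gamma> h \<phi> v w = (\<Sum>j\<in>UNIV. Lin j) / h / 6 + 1 / 12 * ((\<Sum>j\<in>UNIV. Quad j (\<xi> j)) / h)"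
    unfolding discrete_L_def by (rule scale)
  also have "(\<Sum>j\<in>UNIV. Lin j) / h / 6 = - (angle_gap \<gamma> h (v - w) / h) / 3 * (\<Sum>k\<in>UNIV. partial_deriv k \<phi> v * (v - w) $ k)"
    unfolding Lin_def lin using h by (simp add: field_simps)
  also have "(\<Sum>j\<in>UNIV. Quad j (\<xi> j)) / h = (\<Sum>j\<in>UNIV. \<Sum>k\<in>UNIV. \<Sum>l\<in>UNIV. partial_deriv k (partial_deriv l \<phi>) (\<xi> j) * (d j $ k * d j $ l / h))"
    unfolding Quad_def by (simp add: sum_divide_distrib)
  finally show ?thesis using \<xi>(1) unfolding d_def by blast
qed

text \<open>Uniform in h because \<kappa> / h \<le> 6 |x|^\<gamma> and products of two displacement
  components, divided by h, are at most 3 |x|^(2 + \<gamma>).\<close>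

lemma discrete_L_bound:
  assumes \<phi>: "\<phi> \<in> C2b" and \<gamma>: "0 < \<gamma>" "\<gamma> \<le> 1"
  shows "\<exists>C\<ge>0. \<forall>h>0. \<forall>v w. \<bar>discrete_L \<gamma> h \<phi> v w\<bar> \<le> C * (1 + norm v powr (2 + \<gamma>) + norm w powr (2 + \<gamma>))"
proof -
  obtain B where B: "0 \<le> B" "\<And>k v. \<bar>partial_deriv k \<phi> v\<bar> \<le> B" "\<And>k l v. \<bar>partial_deriv k (partial_deriv l \<phi>) v\<bar> \<le> B"
    using C2b_bounds[OF \<phi>] by metis
  \<comment> \<open>There are 54 = 6 * 3 * 3 second-order terms, contributing 54 * 3 / 12 < 14; with
    the first-order 6 this makes 20, and 160 = 20 * 2^3 comes from splitting |v - w|^(2 +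
    \<gamma>).\<close>
  have "\<bar>discrete_L \<gamma> h \<phi> v w\<bar> \<le> 160 * B * (1 + norm v powr (2 + \<gamma>) + norm w powr (2 + \<gamma>))" if h: "h > 0" for h v w
  proof -
    define x where "x = v - w"
    define \<kappa> where "\<kappa> = angle_gap \<gamma> h x"
    have \<kappa>: "0 \<le> \<kappa>" "\<kappa> \<le> 1" "\<kappa> \<le> 6 * h * norm x powr \<gamma>"
      using angle_gap_bounds[of h \<gamma> x] h by (auto simp: \<kappa>_def)
    obtain \<xi> where "discrete_L \<gamma> h \<phi> v w = - (\<kappa> / h) / 3 * (\<Sum>k\<in>UNIV. partial_deriv k \<phi> v * x $ k)
       + 1 / 12 * (\<Sum>j\<in>UNIV. \<Sum>k\<in>UNIV. \<Sum>l\<in>UNIV. partial_deriv k (partial_deriv l \<phi>) (\<xi> j) * (jump \<kappa> j x $ k * jump \<kappa> j x $ l / h))"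
      using discrete_L_expand[OF \<phi> h, of v \<gamma> w] unfolding x_def[symmetric] \<kappa>_def[symmetric] by blast
    then obtain S1 S2 where e: "discrete_L \<gamma> h \<phi> v w = - (\<kappa> / h) / 3 * S1 + 1 / 12 * S2"
      and S1: "S1 = (\<Sum>k\<in>UNIV. partial_deriv k \<phi> v * x $ k)"
      and S2: "S2 = (\<Sum>j\<in>UNIV. \<Sum>k\<in>UNIV. \<Sum>l\<in>UNIV. partial_deriv k (partial_deriv l \<phi>) (\<xi> j) * (jump \<kappa> j x $ k * jump \<kappa> j x $ l / h))"
      by blast
    have kh: "\<kappa> / h \<le> 6 * norm x powr \<gamma>" using \<kappa>(3) h by (simp add: field_simps)
    have t1: "\<bar>S1\<bar> \<le> 3 * (B * norm x)"
    proof -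
      have "\<bar>\<Sum>k\<in>UNIV. partial_deriv k \<phi> v * x $ k\<bar> \<le> (\<Sum>k\<in>(UNIV :: 3 set). B * norm x)"
        by (intro order_trans[OF sum_abs] sum_mono) (use B component_le_norm_cart[of x] in \<open>auto simp: abs_mult intro!: mult_mono\<close>)
      then show ?thesis by (simp add: S1)
    qed
    have jj: "\<bar>jump \<kappa> j x $ k * jump \<kappa> j x $ l / h\<bar> \<le> 3 * norm x powr (2 + \<gamma>)" for j k l
    proof -
      have "\<bar>jump \<kappa> j x $ k * jump \<kappa> j x $ l\<bar> \<le> norm (jump \<kappa> j x) * norm (jump \<kappa> j x)"
        unfolding abs_mult by (intro mult_mono component_le_norm_cart) auto
      also have "\<dots> \<le> \<kappa> / 2 * (norm x)\<^sup>2" using norm_jump[OF \<kappa>(1,2)] by (simp add: power2_eq_square)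
      also have "\<dots> \<le> (6 * h * norm x powr \<gamma>) / 2 * (norm x)\<^sup>2" using \<kappa>(3) by (intro mult_right_mono) auto
      also have "\<dots> = h * (3 * norm x powr (2 + \<gamma>))" by (cases "x = 0") (auto simp: powr_add powr_numeral)
      finally show ?thesis using h by (simp add: abs_mult field_simps)
    qed
    have t2: "\<bar>S2\<bar> \<le> 54 * (B * (3 * norm x powr (2 + \<gamma>)))"
    proof -
      have "\<bar>\<Sum>j\<in>UNIV. \<Sum>k\<in>UNIV. \<Sum>l\<in>UNIV. partial_deriv k (partial_deriv l \<phi>) (\<xi> j) * (jump \<kappa> j x $ k * jump \<kappa> j x $ l / h)\<bar>
        \<le> (\<Sum>j\<in>(UNIV :: (3 \<times> bool) set). \<Sum>k\<in>(UNIV :: 3 set). \<Sum>l\<in>(UNIV :: 3 set). B * (3 * norm x powr (2 + \<gamma>)))"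
      proof (intro order_trans[OF sum_abs] sum_mono)
        fix j k l
        show "\<bar>partial_deriv k (partial_deriv l \<phi>) (\<xi> j) * (jump \<kappa> j x $ k * jump \<kappa> j x $ l / h)\<bar> \<le> B * (3 * norm x powr (2 + \<gamma>))"
          unfolding abs_mult[of "partial_deriv k _ _"] by (intro mult_mono B jj) auto
      qed
      then show ?thesis by (simp add: S2)
    qed
    have p: "norm x powr \<gamma> * norm x \<le> 1 + norm x powr (2 + \<gamma>)"
    proof (cases "norm x \<le> 1")
      case True
      then have "norm x powr \<gamma> * norm x \<le> 1 * 1" using \<gamma> by (intro mult_mono powr_le1) auto
      then show ?thesis by (smt (verit) powr_ge_zero)
    next
      case False
      then have "norm x powr \<gamma> * norm x = norm x powr (1 + \<gamma>)" by (simp add: powr_add)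
      also have "\<dots> \<le> norm x powr (2 + \<gamma>)" using False by (intro powr_mono) auto
      finally show ?thesis by simp
    qed
    have "\<bar>discrete_L \<gamma> h \<phi> v w\<bar> \<le> (\<kappa> / h) / 3 * (3 * (B * norm x)) + 1 / 12 * (54 * (B * (3 * norm x powr (2 + \<gamma>))))"
      unfolding e
    proof (intro order_trans[OF abs_triangle_ineq] add_mono)
      have "\<bar>- (\<kappa> / h) / 3 * S1\<bar> = (\<kappa> / h) / 3 * \<bar>S1\<bar>" using \<kappa> h by (simp add: abs_mult)
      also have "\<dots> \<le> (\<kappa> / h) / 3 * (3 * (B * norm x))" using \<kappa> h by (intro mult_left_mono t1) auto
      finally show "\<bar>- (\<kappa> / h) / 3 * S1\<bar> \<le> (\<kappa> / h) / 3 * (3 * (B * norm x))" .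
      show "\<bar>1 / 12 * S2\<bar> \<le> 1 / 12 * (54 * (B * (3 * norm x powr (2 + \<gamma>))))" using t2 by simp
    qed
    also have "\<dots> \<le> 6 * B * (norm x powr \<gamma> * norm x) + 14 * B * norm x powr (2 + \<gamma>)"
    proof -
      have "(\<kappa> / h) / 3 * (3 * (B * norm x)) = (\<kappa> / h) * (B * norm x)" by simp
      also have "\<dots> \<le> (6 * norm x powr \<gamma>) * (B * norm x)" using kh B by (intro mult_right_mono) auto
      finally have a: "(\<kappa> / h) / 3 * (3 * (B * norm x)) \<le> 6 * B * (norm x powr \<gamma> * norm x)" by (simp add: mult_ac)
      have "1 / 12 * (54 * (B * (3 * norm x powr (2 + \<gamma>)))) \<le> 14 * B * norm x powr (2 + \<gamma>)" using B by simp
      with a show ?thesis by linarith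
    qed
    also have "\<dots> \<le> 6 * B * (1 + norm x powr (2 + \<gamma>)) + 14 * B * norm x powr (2 + \<gamma>)"
      using B p by (intro add_right_mono mult_left_mono) auto
    also have "\<dots> = B * (6 + 20 * norm x powr (2 + \<gamma>))" by (simp add: algebra_simps)
    also have "\<dots> \<le> B * (160 + 160 * (norm v powr (2 + \<gamma>) + norm w powr (2 + \<gamma>)))"
    proof (intro mult_left_mono B)
      have "norm x powr (2 + \<gamma>) \<le> 2 powr (2 + \<gamma>) * (norm v powr (2 + \<gamma>) + norm w powr (2 + \<gamma>))"
        unfolding x_def using \<gamma> by (intro norm_diff_powr_le) auto
      also have "\<dots> \<le> 8 * (norm v powr (2 + \<gamma>) + norm w powr (2 + \<gamma>))"
      proof (intro mult_right_mono)
        have "2 powr (2 + \<gamma>) \<le> (2 :: real) powr 3" using \<gamma> by (intro powr_mono) auto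
        then show "2 powr (2 + \<gamma>) \<le> (8 :: real)" by (simp add: powr_numeral)
      qed auto
      finally show "6 + 20 * norm x powr (2 + \<gamma>) \<le> 160 + 160 * (norm v powr (2 + \<gamma>) + norm w powr (2 + \<gamma>))" by simp
    qed
    finally show ?thesis by (simp add: algebra_simps)
  qed
  then show ?thesis using B(1) by (intro exI[of _ "160 * B"]) auto
qed

lemma sum_cross_axis:
  "(\<Sum>i\<in>UNIV. cross3 (axis i 1) x $ k * cross3 (axis i 1) x $ l) = (if k = l then (norm x)\<^sup>2 else 0) - x $ k * x $ l"
  unfolding power2_norm_eq_inner using exhaust_3[of k] exhaust_3[of l]
  by (auto simp: inner_vec_def sum_3 cross3_def vector_def axis_def power2_eq_square algebra_simps)

lemma landau_a_nth:
  "landau_a \<gamma> x $ k $ l = norm x powr \<gamma> * ((if k = l then (norm x)\<^sup>2 else 0) - x $ k * x $ l)"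
proof (cases "x = 0")
  case False
  then have "norm x powr (2 + \<gamma>) = (norm x)\<^sup>2 * norm x powr \<gamma>" by (simp add: powr_add powr_numeral)
  with False show ?thesis by (simp add: landau_a_def mat_def field_simps)
qed (simp add: landau_a_def)

text \<open>Convergence is needed along moving arguments, not only pointwise, because
  \<open>weakly_converges_double_integral\<close> asks for continuous convergence of the
  kernels.\<close>

lemma discrete_L_tendsto:
  assumes \<phi>: "\<phi> \<in> C2b" and \<gamma>: "0 < \<gamma>"
    and h: "\<And>n. h n > 0" "h \<longlonglongrightarrow> 0" and v: "v \<longlonglongrightarrow> v0" and w: "w \<longlonglongrightarrow> w0"
  shows "(\<lambda>n. discrete_L \<gamma> (h n) \<phi> (v n) (w n)) \<longlonglongrightarrow> landau_L \<gamma> \<phi> v0 w0"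
proof -
  define x where "x n = v n - w n" for n
  define x0 where "x0 = v0 - w0"
  have x: "x \<longlonglongrightarrow> x0" unfolding x_def x0_def by (intro tendsto_intros v w)
  have xk: "(\<lambda>n. x n $ k) \<longlonglongrightarrow> x0 $ k" for k by (intro tendsto_intros x)
  define \<kappa> where "\<kappa> n = angle_gap \<gamma> (h n) (x n)" for n
  define P where "P = norm x0 powr \<gamma>"
  have p: "(\<lambda>n. norm (x n) powr \<gamma>) \<longlonglongrightarrow> P"
    unfolding P_def using \<gamma> by (intro tendsto_powr' tendsto_norm x tendsto_const) auto
  have \<kappa>b: "0 \<le> \<kappa> n" "\<kappa> n \<le> 1" "\<kappa> n \<le> 6 * h n * norm (x n) powr \<gamma>" for n
    using angle_gap_bounds[of "h n" \<gamma> "x n"] h(1)[of n] by (auto simp: \<kappa>_def)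
  have hp: "(\<lambda>n. 6 * h n * norm (x n) powr \<gamma>) \<longlonglongrightarrow> 0"
    using tendsto_mult[OF tendsto_mult[OF tendsto_const[of 6] h(2)] p] by simp
  have \<kappa>0: "\<kappa> \<longlonglongrightarrow> 0"
    by (rule tendsto_sandwich[OF _ _ tendsto_const hp]) (use \<kappa>b in auto)
  \<comment> \<open>The cap is eventually inactive since h tends to 0 while the relative velocities
    converge.\<close>
  have q: "(\<lambda>n. \<kappa> n / h n) \<longlonglongrightarrow> 6 * P"
  proof (rule Lim_transform_eventually[OF tendsto_mult[OF tendsto_const[of 6] p]])
    have "\<forall>\<^sub>F n in sequentially. 6 * h n * norm (x n) powr \<gamma> < 1"
      using order_tendstoD(2)[OF hp, of 1] by simp
    then show "\<forall>\<^sub>F n in sequentially. 6 * norm (x n) powr \<gamma> = \<kappa> n / h n"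
    proof eventually_elim
      case (elim n)
      then have "\<kappa> n = 6 * h n * norm (x n) powr \<gamma>" by (simp add: \<kappa>_def angle_gap_def)
      then show ?case using h(1)[of n] by (simp add: field_simps)
    qed
  qed
  define sg where "sg j = (if snd j then 1 else - 1 :: real)" for j :: "3 \<times> bool"
  \<comment> \<open>Limit of the displacement divided by sqrt h. The rotational part is of order
    sqrt h and survives; the contraction towards the axis is of order h and drops out.\<close>
  define J where "J j k = (1 / 2) * (sg j * sqrt (12 * P) * cross3 (axis (fst j) 1) x0 $ k)" for j k
  have jl: "(\<lambda>n. jump (\<kappa> n) j (x n) $ k / sqrt (h n)) \<longlonglongrightarrow> J j k" for j k
  proof -
    have s: "(\<lambda>n. sqrt (2 * (\<kappa> n / h n) - \<kappa> n * (\<kappa> n / h n))) \<longlonglongrightarrow> sqrt (2 * (6 * P) - 0 * (6 * P))"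
      by (intro tendsto_intros q \<kappa>0)
    have sh: "(\<lambda>n. sqrt (h n)) \<longlonglongrightarrow> 0" using tendsto_real_sqrt[OF h(2)] by simp
    have cr: "(\<lambda>n. cross3 (axis (fst j) 1) (x n) $ k) \<longlonglongrightarrow> cross3 (axis (fst j) 1) x0 $ k"
      using exhaust_3[of k] by (auto simp: cross3_def intro!: tendsto_diff tendsto_mult tendsto_const xk)
    have "(\<lambda>n. (1 / 2) * (sg j * sqrt (2 * (\<kappa> n / h n) - \<kappa> n * (\<kappa> n / h n)) * cross3 (axis (fst j) 1) (x n) $ k
        - (\<kappa> n / h n) * sqrt (h n) * (x n $ k - x n $ fst j * axis (fst j) 1 $ k)))
      \<longlonglongrightarrow> (1 / 2) * (sg j * sqrt (2 * (6 * P) - 0 * (6 * P)) * cross3 (axis (fst j) 1) x0 $ k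
        - (6 * P) * 0 * (x0 $ k - x0 $ fst j * axis (fst j) 1 $ k))"
      by (intro tendsto_mult tendsto_diff tendsto_const s cr q sh xk)
    moreover have "(1 / 2) * (sg j * sqrt (2 * (\<kappa> n / h n) - \<kappa> n * (\<kappa> n / h n)) * cross3 (axis (fst j) 1) (x n) $ k
        - (\<kappa> n / h n) * sqrt (h n) * (x n $ k - x n $ fst j * axis (fst j) 1 $ k)) = jump (\<kappa> n) j (x n) $ k / sqrt (h n)" for n
    proof -
      have hn: "h n > 0" by (rule h)
      have "sqrt (2 * (\<kappa> n / h n) - \<kappa> n * (\<kappa> n / h n)) = sqrt ((2 * \<kappa> n - (\<kappa> n)\<^sup>2) / h n)"
        by (simp add: diff_divide_distrib power2_eq_square)
      also have "\<dots> = sqrt (2 * \<kappa> n - (\<kappa> n)\<^sup>2) / sqrt (h n)" by (rule real_sqrt_divide)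
      finally have a: "sqrt (2 * (\<kappa> n / h n) - \<kappa> n * (\<kappa> n / h n)) = sqrt (2 * \<kappa> n - (\<kappa> n)\<^sup>2) / sqrt (h n)" .
      have "h n = sqrt (h n) * sqrt (h n)" using hn by simp
      then have b: "(\<kappa> n / h n) * sqrt (h n) = \<kappa> n / sqrt (h n)" using hn by (metis divide_divide_eq_left nonzero_eq_divide_eq real_sqrt_eq_zero_cancel_iff times_divide_eq_left less_irrefl)
      show ?thesis unfolding a b by (simp add: jump_def sg_def diff_divide_distrib right_diff_distrib)
    qed
    ultimately show ?thesis by (simp add: J_def)
  qed
  have "\<exists>\<xi>. (\<forall>j. norm (\<xi> j - v n) \<le> norm (jump (\<kappa> n) j (x n))) \<and>
    discrete_L \<gamma> (h n) \<phi> (v n) (w n) = - (\<kappa> n / h n) / 3 * (\<Sum>k\<in>UNIV. partial_deriv k \<phi> (v n) * x n $ k)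
     + 1 / 12 * (\<Sum>j\<in>UNIV. \<Sum>k\<in>UNIV. \<Sum>l\<in>UNIV. partial_deriv k (partial_deriv l \<phi>) (\<xi> j) *
         (jump (\<kappa> n) j (x n) $ k * jump (\<kappa> n) j (x n) $ l / h n))" for n
    using discrete_L_expand[OF \<phi> h(1)[of n], of "v n" \<gamma> "w n"] unfolding x_def \<kappa>_def .
  then have "\<forall>n. \<exists>\<xi>. (\<forall>j. norm (\<xi> j - v n) \<le> norm (jump (\<kappa> n) j (x n))) \<and>
    discrete_L \<gamma> (h n) \<phi> (v n) (w n) = - (\<kappa> n / h n) / 3 * (\<Sum>k\<in>UNIV. partial_deriv k \<phi> (v n) * x n $ k)
     + 1 / 12 * (\<Sum>j\<in>UNIV. \<Sum>k\<in>UNIV. \<Sum>l\<in>UNIV. partial_deriv k (partial_deriv l \<phi>) (\<xi> j) *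
         (jump (\<kappa> n) j (x n) $ k * jump (\<kappa> n) j (x n) $ l / h n))" ..
  from choice[OF this] obtain \<xi> where \<xi>: "\<And>n j. norm (\<xi> n j - v n) \<le> norm (jump (\<kappa> n) j (x n))"
    and e: "\<And>n. discrete_L \<gamma> (h n) \<phi> (v n) (w n) = - (\<kappa> n / h n) / 3 * (\<Sum>k\<in>UNIV. partial_deriv k \<phi> (v n) * x n $ k)
     + 1 / 12 * (\<Sum>j\<in>UNIV. \<Sum>k\<in>UNIV. \<Sum>l\<in>UNIV. partial_deriv k (partial_deriv l \<phi>) (\<xi> n j) *
         (jump (\<kappa> n) j (x n) $ k * jump (\<kappa> n) j (x n) $ l / h n))"
    by blast
  have \<xi>l: "(\<lambda>n. \<xi> n j) \<longlonglongrightarrow> v0" for j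
  proof -
    have "(\<lambda>n. sqrt (\<kappa> n / 2 * (norm (x n))\<^sup>2)) \<longlonglongrightarrow> sqrt (0 / 2 * (norm x0)\<^sup>2)"
      by (intro tendsto_intros \<kappa>0 x) auto
    then have b: "(\<lambda>n. sqrt (\<kappa> n / 2 * (norm (x n))\<^sup>2)) \<longlonglongrightarrow> 0" by simp
    have "norm (\<xi> n j - v n) \<le> sqrt (\<kappa> n / 2 * (norm (x n))\<^sup>2)" for n
      using \<xi>[of n j] real_le_rsqrt[OF norm_jump[OF \<kappa>b(1,2)[of n], of j "x n"]] by linarith
    then have "(\<lambda>n. \<xi> n j - v n) \<longlonglongrightarrow> 0" by (intro Lim_null_comparison[OF _ b]) auto
    from tendsto_add[OF this v] show ?thesis by simp
  qed
  have c2: "isCont (partial_deriv k (partial_deriv l \<phi>)) v0" for k l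
    using \<phi> by (auto simp: C2b_def continuous_on_eq_continuous_at)
  have c1: "isCont (partial_deriv k \<phi>) v0" for k
    using \<phi> differentiable_imp_continuous_on[of "partial_deriv k \<phi>" UNIV] by (auto simp: C2b_def continuous_on_eq_continuous_at)
  have "(\<lambda>n. jump (\<kappa> n) j (x n) $ k / sqrt (h n) * (jump (\<kappa> n) j (x n) $ l / sqrt (h n))) \<longlonglongrightarrow> J j k * J j l" for j k l
    by (intro tendsto_mult jl)
  moreover have "jump (\<kappa> n) j (x n) $ k / sqrt (h n) * (jump (\<kappa> n) j (x n) $ l / sqrt (h n)) = jump (\<kappa> n) j (x n) $ k * jump (\<kappa> n) j (x n) $ l / h n" for n j k l
    using h(1)[of n] by simp
  ultimately have jj: "(\<lambda>n. jump (\<kappa> n) j (x n) $ k * jump (\<kappa> n) j (x n) $ l / h n) \<longlonglongrightarrow> J j k * J j l" for j k l by (simp only:)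
  have lim: "(\<lambda>n. discrete_L \<gamma> (h n) \<phi> (v n) (w n)) \<longlonglongrightarrow> - (6 * P) / 3 * (\<Sum>k\<in>UNIV. partial_deriv k \<phi> v0 * x0 $ k)
     + 1 / 12 * (\<Sum>j\<in>UNIV. \<Sum>k\<in>UNIV. \<Sum>l\<in>UNIV. partial_deriv k (partial_deriv l \<phi>) v0 * (J j k * J j l))"
    unfolding e
    by (intro tendsto_add tendsto_mult tendsto_sum tendsto_divide tendsto_minus tendsto_const q xk jj
        isCont_tendsto_compose[OF c1 v] isCont_tendsto_compose[OF c2 \<xi>l]) auto
  define H where "H k l = partial_deriv k (partial_deriv l \<phi>) v0" for k l
  have JJ: "J j k * J j l = 3 * P * (cross3 (axis (fst j) 1) x0 $ k * cross3 (axis (fst j) 1) x0 $ l)" for j k l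
  proof -
    have "sqrt (12 * P) * sqrt (12 * P) = 12 * P" by (simp add: P_def)
    moreover have "sg j * sg j = 1" by (simp add: sg_def)
    ultimately have "(sg j * sg j) * (sqrt (12 * P) * sqrt (12 * P)) = 12 * P" by simp
    then show ?thesis unfolding J_def by (simp add: mult_ac)
  qed
  \<comment> \<open>Both signs of the angle give the same product, hence the factor 2. With 3 P this
    yields 6 times the matrix \<open>landau_a\<close>, and 6 / 12 is the factor 1 / 2 in
    \<open>landau_L\<close>.\<close>
  have "(\<Sum>j\<in>UNIV. \<Sum>k\<in>UNIV. \<Sum>l\<in>UNIV. H k l * (J j k * J j l))
    = 2 * (\<Sum>i\<in>UNIV. \<Sum>k\<in>UNIV. \<Sum>l\<in>UNIV. H k l * (3 * P * (cross3 (axis i 1) x0 $ k * cross3 (axis i 1) x0 $ l)))"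
    unfolding sum_UNIV_3_bool JJ fst_conv sum.distrib by simp
  also have "(\<Sum>i\<in>UNIV. \<Sum>k\<in>UNIV. \<Sum>l\<in>UNIV. H k l * (3 * P * (cross3 (axis i 1) x0 $ k * cross3 (axis i 1) x0 $ l)))
    = (\<Sum>k\<in>UNIV. \<Sum>i\<in>UNIV. \<Sum>l\<in>UNIV. H k l * (3 * P * (cross3 (axis i 1) x0 $ k * cross3 (axis i 1) x0 $ l)))"
    by (rule sum.swap)
  also have "\<dots> = (\<Sum>k\<in>UNIV. \<Sum>l\<in>UNIV. \<Sum>i\<in>UNIV. H k l * (3 * P * (cross3 (axis i 1) x0 $ k * cross3 (axis i 1) x0 $ l)))"
    by (intro sum.cong refl sum.swap)
  also have "\<dots> = (\<Sum>k\<in>UNIV. \<Sum>l\<in>UNIV. 3 * (landau_a \<gamma> x0 $ k $ l * H k l))"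
  proof (intro sum.cong refl)
    fix k l
    have "(\<Sum>i\<in>UNIV. H k l * (3 * P * (cross3 (axis i 1) x0 $ k * cross3 (axis i 1) x0 $ l)))
      = H k l * (3 * P * ((if k = l then (norm x0)\<^sup>2 else 0) - x0 $ k * x0 $ l))"
      unfolding sum_distrib_left[symmetric] sum_cross_axis ..
    then show "(\<Sum>i\<in>UNIV. H k l * (3 * P * (cross3 (axis i 1) x0 $ k * cross3 (axis i 1) x0 $ l)))
      = 3 * (landau_a \<gamma> x0 $ k $ l * H k l)"
      by (simp only: landau_a_nth P_def mult_ac)
  qed
  also have "\<dots> = 3 * (\<Sum>k\<in>UNIV. \<Sum>l\<in>UNIV. landau_a \<gamma> x0 $ k $ l * H k l)"
    unfolding sum_distrib_left ..
  finally have quad: "(\<Sum>j\<in>UNIV. \<Sum>k\<in>UNIV. \<Sum>l\<in>UNIV. H k l * (J j k * J j l)) = 6 * (\<Sum>k\<in>UNIV. \<Sum>l\<in>UNIV. landau_a \<gamma> x0 $ k $ l * H k l)"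
    by simp
  have lin: "- (6 * P) / 3 * (\<Sum>k\<in>UNIV. partial_deriv k \<phi> v0 * x0 $ k) = (\<Sum>k\<in>UNIV. landau_b \<gamma> x0 $ k * partial_deriv k \<phi> v0)"
    unfolding sum_distrib_left by (intro sum.cong refl) (simp add: landau_b_def P_def mult_ac)
  have "- (6 * P) / 3 * (\<Sum>k\<in>UNIV. partial_deriv k \<phi> v0 * x0 $ k)
     + 1 / 12 * (\<Sum>j\<in>UNIV. \<Sum>k\<in>UNIV. \<Sum>l\<in>UNIV. partial_deriv k (partial_deriv l \<phi>) v0 * (J j k * J j l)) = landau_L \<gamma> \<phi> v0 w0"
    unfolding lin H_def[symmetric] quad landau_L_def x0_def[symmetric] by simp
  with lim show ?thesis by simp
qed

section \<open>Measurability and growth of the operators\<close>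

lemma borel_measurable_cross3[measurable]: "(\<lambda>x. cross3 a x) \<in> borel_measurable borel"
  by (intro borel_measurable_continuous_onI continuous_on_cross continuous_on_const continuous_on_id)

lemma borel_measurable_vec_component[measurable]: "(\<lambda>x :: real^3. x $ i) \<in> borel_measurable borel"
  by (intro borel_measurable_continuous_onI continuous_intros)

lemma angle_gap_measurable[measurable]: "angle_gap \<gamma> h \<in> borel_measurable borel"
  unfolding angle_gap_def[abs_def] by measurable

lemma post_measurable[measurable]: "(\<lambda>(v, w). post \<gamma> h j v w) \<in> borel_measurable (borel \<Otimes>\<^sub>M borel)"
  unfolding post_def jump_def by measurable

lemma C2b_continuous: "\<phi> \<in> C2b \<Longrightarrow> continuous_on UNIV \<phi>"
  using differentiable_imp_continuous_on by (auto simp: C2b_def)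

lemma C2b_measurable: "\<phi> \<in> C2b \<Longrightarrow> \<phi> \<in> borel_measurable borel"
  by (intro borel_measurable_continuous_onI C2b_continuous)

lemma discrete_L_measurable:
  assumes "\<phi> \<in> C2b"
  shows "(\<lambda>(v, w). discrete_L \<gamma> h \<phi> v w) \<in> borel_measurable (borel \<Otimes>\<^sub>M borel)"
proof -
  note C2b_measurable[OF assms, measurable]
  show ?thesis unfolding discrete_L_def by measurable
qed

text \<open>Through this limit \<open>landau_L\<close> inherits measurability and the growth bound
  of the discrete operators without any computation on its formula.\<close>

lemma discrete_L_tendsto_landau_L:
  assumes "\<phi> \<in> C2b" "0 < \<gamma>"
  shows "(\<lambda>n. discrete_L \<gamma> (inverse (real (Suc n))) \<phi> v w) \<longlonglongrightarrow> landau_L \<gamma> \<phi> v w"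
  by (rule discrete_L_tendsto[OF assms _ LIMSEQ_inverse_real_of_nat tendsto_const tendsto_const]) simp

lemma landau_L_measurable:
  assumes "\<phi> \<in> C2b" "0 < \<gamma>"
  shows "(\<lambda>(v, w). landau_L \<gamma> \<phi> v w) \<in> borel_measurable (borel \<Otimes>\<^sub>M borel)"
  by (rule borel_measurable_LIMSEQ_real[OF _ discrete_L_measurable[OF assms(1)]])
    (use discrete_L_tendsto_landau_L[OF assms] in auto)

lemma landau_L_bound:
  assumes "\<phi> \<in> C2b" "0 < \<gamma>"
    and C: "\<And>h v w. h > 0 \<Longrightarrow> \<bar>discrete_L \<gamma> h \<phi> v w\<bar> \<le> C * (1 + norm v powr (2 + \<gamma>) + norm w powr (2 + \<gamma>))"
  shows "\<bar>landau_L \<gamma> \<phi> v w\<bar> \<le> C * (1 + norm v powr (2 + \<gamma>) + norm w powr (2 + \<gamma>))"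
  by (rule LIMSEQ_le_const2[OF tendsto_rabs[OF discrete_L_tendsto_landau_L[OF assms(1,2)]]])
    (use C in auto)

section \<open>Energy exchange in a collision\<close>

text \<open>Half the difference of the two outgoing energies; for \<kappa> = 0 it is half the
  difference of the incoming ones.\<close>

definition energy_shift :: "real \<Rightarrow> 3 \<times> bool \<Rightarrow> real^3 \<Rightarrow> real^3 \<Rightarrow> real" where
  "energy_shift \<kappa> j v w = (norm (v + jump \<kappa> j (v - w)))\<^sup>2 - ((norm v)\<^sup>2 + (norm w)\<^sup>2) / 2"

lemma jump_uminus: "jump \<kappa> j (- x) = - jump \<kappa> j x"
proof -
  have "cross3 a (- x) = - cross3 a x" for a by (simp add: cross3_def vec_eq_iff forall_3)
  then show ?thesis unfolding jump_def by (simp add: algebra_simps)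
qed

lemma inner_jump: "x \<bullet> jump \<kappa> j x = - \<kappa> / 2 * ((norm x)\<^sup>2 - (x $ fst j)\<^sup>2)"
  unfolding jump_def power2_norm_eq_inner
  by (simp add: inner_diff_right dot_cross_self inner_axis power2_eq_square algebra_simps)

text \<open>Energy is conserved because the inner product of x with its displacement J is - |J|^2,
  by \<open>inner_jump\<close> and \<open>norm_jump_eq\<close>. The bound on the shift expresses
  that both outgoing energies are nonnegative.\<close>

lemma collision_energies:
  fixes v w :: "real^3"
  assumes "0 \<le> \<kappa>" "\<kappa> \<le> 1"
  defines "s' \<equiv> \<lambda>j. energy_shift \<kappa> j v w"
  shows "(norm (v + jump \<kappa> j (v - w)))\<^sup>2 = ((norm v)\<^sup>2 + (norm w)\<^sup>2) / 2 + s' j"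
    and "(norm (w + jump \<kappa> j (w - v)))\<^sup>2 = ((norm v)\<^sup>2 + (norm w)\<^sup>2) / 2 - s' j"
    and "\<bar>s' j\<bar> \<le> ((norm v)\<^sup>2 + (norm w)\<^sup>2) / 2"
proof -
  define J where "J = jump \<kappa> j (v - w)"
  have split: "a + b = c \<Longrightarrow> a = c / 2 + d \<Longrightarrow> b = c / 2 - d" for a b c d :: real by simp
  show 1: "(norm (v + jump \<kappa> j (v - w)))\<^sup>2 = ((norm v)\<^sup>2 + (norm w)\<^sup>2) / 2 + s' j"
    by (simp add: s'_def energy_shift_def)
  have J': "jump \<kappa> j (w - v) = - J" unfolding J_def jump_uminus[symmetric] by simp
  have "(norm (v + J))\<^sup>2 + (norm (w - J))\<^sup>2 = (norm v)\<^sup>2 + (norm w)\<^sup>2 + 2 * ((v - w) \<bullet> J) + 2 * (norm J)\<^sup>2"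
    unfolding power2_norm_eq_inner by (simp add: inner_add inner_diff inner_commute algebra_simps)
  also have "\<dots> = (norm v)\<^sup>2 + (norm w)\<^sup>2"
    unfolding J_def inner_jump norm_jump_eq[OF assms(1,2)] by (simp add: algebra_simps)
  finally have "(norm (v + J))\<^sup>2 + (norm (w - J))\<^sup>2 = (norm v)\<^sup>2 + (norm w)\<^sup>2" .
  moreover have "w + jump \<kappa> j (w - v) = w - J" by (simp add: J')
  ultimately show 2: "(norm (w + jump \<kappa> j (w - v)))\<^sup>2 = ((norm v)\<^sup>2 + (norm w)\<^sup>2) / 2 - s' j"
    using 1 split[of "(norm (v + J))\<^sup>2" "(norm (w - J))\<^sup>2"] by (simp add: J_def)
  show "\<bar>s' j\<bar> \<le> ((norm v)\<^sup>2 + (norm w)\<^sup>2) / 2"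
    using 1 2 zero_le_power2[of "norm (v + jump \<kappa> j (v - w))"] zero_le_power2[of "norm (w + jump \<kappa> j (w - v))"] by linarith
qed

text \<open>The sixth moment and the tail energy see a collision only through these two sums:
  squared shifts, and squared deviations from the incoming shift s. By Lagrange's identity U is the
  squared length of the cross product of v and w.\<close>

lemma energy_shift_sums:
  fixes v w :: "real^3"
  assumes \<kappa>: "0 \<le> \<kappa>" "\<kappa> \<le> 1"
  defines "E \<equiv> ((norm v)\<^sup>2 + (norm w)\<^sup>2) / 2" and "s \<equiv> ((norm v)\<^sup>2 - (norm w)\<^sup>2) / 2"
    and "U \<equiv> (norm v)\<^sup>2 * (norm w)\<^sup>2 - (v \<bullet> w)\<^sup>2"
  shows "(\<Sum>j\<in>UNIV. (energy_shift \<kappa> j v w)\<^sup>2) \<le> 6 * s\<^sup>2 + 4 * \<kappa> * (U - s\<^sup>2)"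
    and "(\<Sum>j\<in>UNIV. (energy_shift \<kappa> j v w - s)\<^sup>2) \<le> 4 * \<kappa>\<^sup>2 * E\<^sup>2 + 4 * \<kappa> * U"
    and "0 \<le> U" "U \<le> (norm v)\<^sup>2 * (norm w)\<^sup>2"
proof -
  have q: "sqrt (2 * \<kappa> - \<kappa>\<^sup>2) * sqrt (2 * \<kappa> - \<kappa>\<^sup>2) = 2 * \<kappa> - \<kappa>\<^sup>2"
    using \<kappa> mult_left_le_one_le[of \<kappa> \<kappa>] by (simp add: power2_eq_square)
  define t where "t = sqrt (2 * \<kappa> - \<kappa>\<^sup>2)"
  have t2: "t\<^sup>2 = 2 * \<kappa> - \<kappa>\<^sup>2" using q by (simp add: t_def power2_eq_square)
  define p where "p k = ((v $ k)\<^sup>2 - (w $ k)\<^sup>2) / 2" for k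
  define \<tau> where "\<tau> k = cross3 (axis k 1) (v - w) \<bullet> v" for k
  \<comment> \<open>The shift is affine in the sign of the angle: s contracts by 1 - \<kappa>,
    \<open>p k\<close> is the part of the rotation axis, and \<open>\<tau> k\<close> is up to sign a
    component of the cross product of v and w. Adding both signs cancels the mixed terms with
    \<tau>.\<close>
  have shift: "energy_shift \<kappa> (k, b) v w = (1 - \<kappa>) * s + \<kappa> * p k + (if b then 1 else - 1) * t * \<tau> k" for k b
  proof -
    have "energy_shift \<kappa> (k, b) v w = (norm v)\<^sup>2 + 2 * (jump \<kappa> (k, b) (v - w) \<bullet> v) + (norm (jump \<kappa> (k, b) (v - w)))\<^sup>2 - E"
      unfolding energy_shift_def E_def power2_norm_eq_inner by (simp add: inner_add inner_commute algebra_simps)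
    also have "jump \<kappa> (k, b) (v - w) \<bullet> v = ((if b then 1 else - 1) * t * \<tau> k - \<kappa> * ((v - w) \<bullet> v - (v $ k - w $ k) * v $ k)) / 2"
      unfolding jump_def \<tau>_def t_def by (simp add: inner_diff_left inner_axis' algebra_simps)
    also have "(norm (jump \<kappa> (k, b) (v - w)))\<^sup>2 = \<kappa> / 2 * ((v - w) \<bullet> (v - w) - (v $ k - w $ k)\<^sup>2)"
      unfolding norm_jump_eq[OF \<kappa>] by (simp add: power2_norm_eq_inner)
    finally show ?thesis
      unfolding s_def E_def p_def power2_norm_eq_inner
      by (simp add: inner_diff_left inner_diff_right inner_commute power2_eq_square field_simps)
  qed
  have sp: "(\<Sum>k\<in>UNIV. p k) = s"
    unfolding p_def s_def power2_norm_eq_inner by (simp add: inner_vec_def sum_3 power2_eq_square field_simps)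
  have s\<tau>: "(\<Sum>k\<in>UNIV. (\<tau> k)\<^sup>2) = U"
    unfolding \<tau>_def U_def power2_norm_eq_inner
    by (simp add: inner_vec_def sum_3 cross3_def vector_def axis_def power2_eq_square algebra_simps)
  have sU: "s\<^sup>2 + U = (norm ((1 / 2) *\<^sub>R (v + w)))\<^sup>2 * (norm (v - w))\<^sup>2"
    unfolding s_def U_def power2_norm_eq_inner
    by (simp add: inner_add inner_diff inner_commute power2_eq_square field_simps)
  \<comment> \<open>Each \<open>p k\<close> is a component of the midpoint c times a component of v
    - w. Bounding the latter by the norm leaves |c|^2 |v - w|^2, which is s^2 + U by Lagrange's
    identity for c and v - w.\<close>
  have sp2: "(\<Sum>k\<in>UNIV. (p k)\<^sup>2) \<le> s\<^sup>2 + U"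
  proof -
    define c where "c = (1 / 2) *\<^sub>R (v + w)"
    have pk: "(p k)\<^sup>2 = (c $ k)\<^sup>2 * ((v - w) $ k)\<^sup>2" for k
      unfolding p_def c_def by (simp add: power2_eq_square field_simps)
    have comp: "((v - w) $ k)\<^sup>2 \<le> (norm (v - w))\<^sup>2" for k
      using component_le_norm_cart[of "v - w" k] power_mono[of "\<bar>(v - w) $ k\<bar>" "norm (v - w)" 2] by simp
    have "(\<Sum>k\<in>UNIV. (p k)\<^sup>2) \<le> (\<Sum>k\<in>UNIV. (c $ k)\<^sup>2 * (norm (v - w))\<^sup>2)"
      unfolding pk by (intro sum_mono mult_left_mono comp) auto
    also have "\<dots> = (norm c)\<^sup>2 * (norm (v - w))\<^sup>2"
      unfolding power2_norm_eq_inner[of c] by (simp add: sum_distrib_right inner_vec_def power2_eq_square)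
    finally show ?thesis using sU by (simp add: c_def)
  qed
  show U0: "0 \<le> U" unfolding s\<tau>[symmetric] by (intro sum_nonneg) auto
  show "U \<le> (norm v)\<^sup>2 * (norm w)\<^sup>2" by (simp add: U_def)
  have \<kappa>2: "\<kappa>\<^sup>2 \<le> \<kappa>" using \<kappa> mult_left_le_one_le[of \<kappa> \<kappa>] by (simp add: power2_eq_square)
  have "(\<Sum>j\<in>UNIV. (energy_shift \<kappa> j v w)\<^sup>2) = (\<Sum>k\<in>UNIV. 2 * (1 - \<kappa>)\<^sup>2 * s\<^sup>2 + 4 * (1 - \<kappa>) * \<kappa> * s * p k + 2 * \<kappa>\<^sup>2 * (p k)\<^sup>2 + 2 * t\<^sup>2 * (\<tau> k)\<^sup>2)"
    unfolding sum_UNIV_3_bool shift by (intro sum.cong refl) (simp add: power2_eq_square algebra_simps)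
  also have "\<dots> = 6 * (1 - \<kappa>)\<^sup>2 * s\<^sup>2 + 4 * (1 - \<kappa>) * \<kappa> * s * s + 2 * \<kappa>\<^sup>2 * (\<Sum>k\<in>UNIV. (p k)\<^sup>2) + 2 * t\<^sup>2 * U"
    unfolding sum.distrib sum_distrib_left[symmetric] sp s\<tau> by simp
  also have "\<dots> \<le> 6 * (1 - \<kappa>)\<^sup>2 * s\<^sup>2 + 4 * (1 - \<kappa>) * \<kappa> * s * s + 2 * \<kappa>\<^sup>2 * (s\<^sup>2 + U) + 2 * t\<^sup>2 * U"
    using mult_left_mono[OF sp2, of "2 * \<kappa>\<^sup>2"] by simp
  also have "\<dots> = 6 * s\<^sup>2 + 4 * \<kappa> * (U - s\<^sup>2) - 4 * (\<kappa> - \<kappa>\<^sup>2) * s\<^sup>2"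
    unfolding t2 by (simp add: power2_eq_square algebra_simps)
  also have "\<dots> \<le> 6 * s\<^sup>2 + 4 * \<kappa> * (U - s\<^sup>2)" using \<kappa>2 by simp
  finally show "(\<Sum>j\<in>UNIV. (energy_shift \<kappa> j v w)\<^sup>2) \<le> 6 * s\<^sup>2 + 4 * \<kappa> * (U - s\<^sup>2)" .
  have sE: "s\<^sup>2 \<le> E\<^sup>2" unfolding s_def E_def by (intro abs_le_square_iff[THEN iffD1]) (simp add: abs_le_iff)
  have "(\<Sum>j\<in>UNIV. (energy_shift \<kappa> j v w - s)\<^sup>2) = (\<Sum>k\<in>UNIV. 2 * \<kappa>\<^sup>2 * s\<^sup>2 - 4 * \<kappa>\<^sup>2 * s * p k + 2 * \<kappa>\<^sup>2 * (p k)\<^sup>2 + 2 * t\<^sup>2 * (\<tau> k)\<^sup>2)"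
    unfolding sum_UNIV_3_bool shift by (intro sum.cong refl) (simp add: power2_eq_square algebra_simps)
  also have "\<dots> = 6 * \<kappa>\<^sup>2 * s\<^sup>2 - 4 * \<kappa>\<^sup>2 * s * s + 2 * \<kappa>\<^sup>2 * (\<Sum>k\<in>UNIV. (p k)\<^sup>2) + 2 * t\<^sup>2 * U"
    unfolding sum.distrib sum_subtractf sum_distrib_left[symmetric] sp s\<tau> by simp
  also have "\<dots> \<le> 6 * \<kappa>\<^sup>2 * s\<^sup>2 - 4 * \<kappa>\<^sup>2 * s * s + 2 * \<kappa>\<^sup>2 * (s\<^sup>2 + U) + 2 * t\<^sup>2 * U"
    using mult_left_mono[OF sp2, of "2 * \<kappa>\<^sup>2"] by simp
  also have "\<dots> = 4 * \<kappa>\<^sup>2 * s\<^sup>2 + 4 * \<kappa> * U"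
    unfolding t2 by (simp add: power2_eq_square algebra_simps)
  also have "\<dots> \<le> 4 * \<kappa>\<^sup>2 * E\<^sup>2 + 4 * \<kappa> * U" using mult_left_mono[OF sE, of "4 * \<kappa>\<^sup>2"] by simp
  finally show "(\<Sum>j\<in>UNIV. (energy_shift \<kappa> j v w - s)\<^sup>2) \<le> 4 * \<kappa>\<^sup>2 * E\<^sup>2 + 4 * \<kappa> * U" .
qed

lemma norm_powr_le_Suc_square:
  fixes x :: "real^3"
  assumes "0 \<le> q" "q \<le> 2"
  shows "norm x powr q \<le> 1 + (norm x)\<^sup>2"
proof (cases "norm x \<le> 1")
  case True
  then have "norm x powr q \<le> 1" using assms by (intro powr_le1) auto
  then show ?thesis by (smt (verit) zero_le_power2)
next
  case False
  then have "norm x powr q \<le> norm x powr 2" using assms by (intro powr_mono) auto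
  then show ?thesis using False by (simp add: powr_numeral)
qed

lemma norm_diff_square_le: "(norm (v - w))\<^sup>2 \<le> 2 * ((norm v)\<^sup>2 + (norm w)\<^sup>2)" for v w :: "real^3"
proof -
  have "0 \<le> (norm (v + w))\<^sup>2" by simp
  then show ?thesis unfolding power2_norm_eq_inner by (simp add: inner_add inner_diff inner_commute)
qed

text \<open>The sixth moment is propagated because \<open>(E + s')\<^sup>3 + (E - s')\<^sup>3\<close> depends on \<open>s'\<^sup>2\<close> only.\<close>

lemma collision_sixth_moment:
  fixes v w :: "real^3"
  assumes \<gamma>: "0 \<le> \<gamma>" "\<gamma> \<le> 1" and h: "0 \<le> h"
  shows "(\<Sum>j\<in>UNIV. norm (post \<gamma> h j v w) ^ 6 + norm (post \<gamma> h j w v) ^ 6) / 12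
    \<le> (norm v ^ 6 + norm w ^ 6) / 2
      + 12 * h * ((norm v)\<^sup>2 * (norm w)\<^sup>2 + 3 * (norm v ^ 6 * (norm w)\<^sup>2 + norm w ^ 6 * (norm v)\<^sup>2))"
proof -
  define \<kappa> where "\<kappa> = angle_gap \<gamma> h (v - w)"
  have \<kappa>w: "angle_gap \<gamma> h (w - v) = \<kappa>" by (simp add: \<kappa>_def angle_gap_def norm_minus_commute)
  note \<kappa> = angle_gap_bounds[OF h, of \<gamma> "v - w", folded \<kappa>_def]
  define V where "V = (norm v)\<^sup>2"
  define W where "W = (norm w)\<^sup>2"
  define E where "E = (V + W) / 2"
  define s where "s = (V - W) / 2"
  define U where "U = V * W - (v \<bullet> w)\<^sup>2"
  define s' where "s' j = energy_shift \<kappa> j v w" for j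
  have nn: "0 \<le> V" "0 \<le> W" "0 \<le> E" by (auto simp: V_def W_def E_def)
  have n6: "norm u ^ 6 = ((norm u)\<^sup>2) ^ 3" for u :: "real^3" by (simp add: power_mult[symmetric])
  have "norm (post \<gamma> h j v w) ^ 6 + norm (post \<gamma> h j w v) ^ 6 = 2 * E ^ 3 + 6 * E * (s' j)\<^sup>2" for j
    unfolding n6 post_def \<kappa>w \<kappa>_def[symmetric] collision_energies(1,2)[OF \<kappa>(1,2), where v=v and w=w]
    unfolding V_def[symmetric] W_def[symmetric] E_def[symmetric] s'_def[symmetric]
    by (simp add: power2_eq_square power3_eq_cube algebra_simps)
  then have "(\<Sum>j\<in>UNIV. norm (post \<gamma> h j v w) ^ 6 + norm (post \<gamma> h j w v) ^ 6) / 12 = E ^ 3 + E / 2 * (\<Sum>j\<in>UNIV. (s' j)\<^sup>2)"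
    by (simp add: sum.distrib sum_distrib_left[symmetric])
  also have "\<dots> \<le> E ^ 3 + E / 2 * (6 * s\<^sup>2 + 4 * \<kappa> * (U - s\<^sup>2))"
    using energy_shift_sums(1)[OF \<kappa>(1,2), of v w] nn
    unfolding s'_def s_def U_def V_def W_def by (intro add_left_mono mult_left_mono) auto
  also have "\<dots> \<le> E ^ 3 + 3 * E * s\<^sup>2 + 2 * \<kappa> * E * U"
  proof -
    have "0 \<le> 2 * (E * (\<kappa> * s\<^sup>2))" using \<kappa> nn by (intro mult_nonneg_nonneg) auto
    then show ?thesis by (simp add: algebra_simps)
  qed
  also have "2 * \<kappa> * E * U \<le> 2 * (6 * h * (1 + 4 * E)) * E * (V * W)"
  proof (intro mult_mono)
    have "norm (v - w) powr \<gamma> \<le> 1 + (norm (v - w))\<^sup>2" using \<gamma> by (intro norm_powr_le_Suc_square) auto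
    also have "\<dots> \<le> 1 + 4 * E" using norm_diff_square_le[of v w] by (simp add: E_def V_def W_def)
    finally have "6 * h * norm (v - w) powr \<gamma> \<le> 6 * h * (1 + 4 * E)" using h by (intro mult_left_mono) auto
    with \<kappa>(3) show "\<kappa> \<le> 6 * h * (1 + 4 * E)" by linarith
    show "U \<le> V * W" by (simp add: U_def)
    show "0 \<le> U" using energy_shift_sums(3)[OF \<kappa>(1,2), of v w] by (simp add: U_def V_def W_def)
  qed (use nn h \<kappa> in auto)
  also have "2 * (6 * h * (1 + 4 * E)) * E * (V * W) = 12 * h * ((1 + 4 * E) * E * (V * W))" by simp
  \<comment> \<open>The terms of top degree pair a cube with a first power, so the integrated bound
    is linear in the sixth moment with the conserved energy as coefficient. This is what can be
    iterated.\<close>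
  also have "\<dots> \<le> 12 * h * (V * W + 3 * (V ^ 3 * W + W ^ 3 * V))"
  proof (intro mult_left_mono)
    have c: "a\<^sup>2 \<le> a + a ^ 3" if "0 \<le> a" for a :: real
    proof -
      have "0 \<le> a * ((a - 1)\<^sup>2 + a)" using that by (intro mult_nonneg_nonneg) auto
      then show ?thesis by (simp add: power2_eq_square power3_eq_cube algebra_simps)
    qed
    have "E * (V * W) = (V\<^sup>2 * W + W\<^sup>2 * V) / 2" by (simp add: E_def power2_eq_square field_simps)
    also have "\<dots> \<le> ((V + V ^ 3) * W + (W + W ^ 3) * V) / 2"
      using c[OF nn(1)] c[OF nn(2)] nn by (intro divide_right_mono add_mono mult_right_mono) auto
    also have "\<dots> = V * W + (V ^ 3 * W + W ^ 3 * V) / 2" by (simp add: field_simps)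
    finally have 1: "E * (V * W) \<le> V * W + (V ^ 3 * W + W ^ 3 * V) / 2" .
    have "4 * E * E * (V * W) = (V + W)\<^sup>2 * (V * W)" by (simp add: E_def power2_eq_square)
    also have "\<dots> \<le> (2 * (V\<^sup>2 + W\<^sup>2)) * (V * W)"
      using nn sum_squares_bound[of V W] by (intro mult_right_mono) (auto simp: power2_eq_square algebra_simps)
    also have "\<dots> = 2 * (V ^ 3 * W + W ^ 3 * V)" by (simp add: power2_eq_square power3_eq_cube algebra_simps)
    finally have 2: "4 * E * E * (V * W) \<le> 2 * (V ^ 3 * W + W ^ 3 * V)" .
    have "0 \<le> V ^ 3 * W + W ^ 3 * V" using nn by auto
    then have 3: "a + (V ^ 3 * W + W ^ 3 * V) / 2 + 2 * (V ^ 3 * W + W ^ 3 * V) \<le> a + 3 * (V ^ 3 * W + W ^ 3 * V)" for a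
      by (simp add: mult.commute)
    have "(1 + 4 * E) * E * (V * W) = E * (V * W) + 4 * E * E * (V * W)" by (simp add: algebra_simps)
    also note add_mono[OF 1 2]
    also note 3
    finally show "(1 + 4 * E) * E * (V * W) \<le> V * W + 3 * (V ^ 3 * W + W ^ 3 * V)" .
  qed (use h in auto)
  also have "E ^ 3 + 3 * E * s\<^sup>2 = (V ^ 3 + W ^ 3) / 2"
    by (simp add: E_def s_def power2_eq_square power3_eq_cube field_simps)
  finally show ?thesis unfolding n6 V_def W_def by simp
qed

section \<open>Tail energy of a colliding pair\<close>

lemma rational_profile_identity:
  assumes "0 < R" "0 \<le> (r :: real)"
  shows "r\<^sup>2 / (R + r) = r - R + R\<^sup>2 / (R + r)"
  using assms by (simp add: field_simps power2_eq_square)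

text \<open>By \<open>rational_profile_identity\<close> the pair sum at shift t is 2 E - 2 R + 2 A
  R^2 divided by the product of the two denominators. That product changes from q to q - \<delta>,
  and 1 / (q - \<delta>) = 1 / q + \<delta> / q^2 + \<delta>^2 / (q^2 (q - \<delta>)) is
  exact.\<close>

lemma rational_profile_pair:
  fixes R E s s' :: real
  assumes R: "0 < R" and s: "\<bar>s\<bar> \<le> E" and s': "\<bar>s'\<bar> \<le> E"
  defines "A \<equiv> R + E" and "q \<equiv> (R + (E + s)) * (R + (E - s))"
  shows "(E + s')\<^sup>2 / (R + (E + s')) + (E - s')\<^sup>2 / (R + (E - s'))
    \<le> (E + s)\<^sup>2 / (R + (E + s)) + (E - s)\<^sup>2 / (R + (E - s))
      + 2 * A * R\<^sup>2 / q\<^sup>2 * (s'\<^sup>2 - s\<^sup>2) + 8 * R * E\<^sup>2 / q\<^sup>2 * (s' - s)\<^sup>2"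
proof -
  define q' where "q' = (R + (E + s')) * (R + (E - s'))"
  define \<delta> where "\<delta> = s'\<^sup>2 - s\<^sup>2"
  have E: "0 \<le> E" using s by simp
  have p: "0 < R + (E + s)" "0 < R + (E - s)" "0 < R + (E + s')" "0 < R + (E - s')"
    using R s s' by auto
  have qp: "0 < q" "0 < q'" unfolding q_def q'_def using p by auto
  have q': "q' = q - \<delta>" by (simp add: q'_def q_def \<delta>_def power2_eq_square algebra_simps)
  have A0: "0 < A" using R E by (simp add: A_def)
  \<comment> \<open>Used in the remainder, where it cancels A together with one factor R.\<close>
  have q'A: "R * A \<le> q'"
  proof -
    have "q' = R * A + R * E + (E\<^sup>2 - s'\<^sup>2)" by (simp add: q'_def A_def power2_eq_square algebra_simps)
    moreover have "s'\<^sup>2 \<le> E\<^sup>2" using s' E by (intro abs_le_square_iff[THEN iffD1]) auto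
    moreover have "0 \<le> R * E" using R E by simp
    ultimately show ?thesis by linarith
  qed
  have pair: "(E + t)\<^sup>2 / (R + (E + t)) + (E - t)\<^sup>2 / (R + (E - t)) = 2 * E - 2 * R + 2 * A * R\<^sup>2 / ((R + (E + t)) * (R + (E - t)))"
    if t: "\<bar>t\<bar> \<le> E" for t
  proof -
    have pt: "0 < R + (E + t)" "0 < R + (E - t)" using R t by auto
    have "R\<^sup>2 / (R + (E + t)) + R\<^sup>2 / (R + (E - t)) = R\<^sup>2 * (2 * A) / ((R + (E + t)) * (R + (E - t)))"
      using pt by (simp add: add_frac_eq A_def algebra_simps)
    moreover have "(E + t)\<^sup>2 / (R + (E + t)) = (E + t) - R + R\<^sup>2 / (R + (E + t))"
      "(E - t)\<^sup>2 / (R + (E - t)) = (E - t) - R + R\<^sup>2 / (R + (E - t))"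
      by (rule rational_profile_identity, use R t in auto)+
    ultimately show ?thesis by (simp add: mult_ac)
  qed
  have "2 * A * R\<^sup>2 / q' = 2 * A * R\<^sup>2 / q + 2 * A * R\<^sup>2 / q\<^sup>2 * \<delta> + 2 * A * R\<^sup>2 * \<delta>\<^sup>2 / (q\<^sup>2 * q')"
  proof -
    have "1 / q' = 1 / q + \<delta> / q\<^sup>2 + \<delta>\<^sup>2 / (q\<^sup>2 * q')"
      using qp unfolding q' by (simp add: divide_simps power2_eq_square) (simp add: algebra_simps)
    from arg_cong[OF this, of "\<lambda>y. 2 * A * R\<^sup>2 * y"] show ?thesis by (simp add: algebra_simps)
  qed
  also have "2 * A * R\<^sup>2 * \<delta>\<^sup>2 / (q\<^sup>2 * q') \<le> 2 * A * R\<^sup>2 * \<delta>\<^sup>2 / (q\<^sup>2 * (R * A))"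
    using qp q'A A0 R by (intro divide_left_mono mult_left_mono mult_pos_pos) auto
  also have "2 * A * R\<^sup>2 * \<delta>\<^sup>2 / (q\<^sup>2 * (R * A)) = 2 * R / q\<^sup>2 * \<delta>\<^sup>2"
    using A0 R qp by (simp add: field_simps power2_eq_square)
  also have "\<dots> \<le> 2 * R / q\<^sup>2 * (4 * E\<^sup>2 * (s' - s)\<^sup>2)"
  proof (intro mult_left_mono)
    have "\<delta>\<^sup>2 = (s' + s)\<^sup>2 * (s' - s)\<^sup>2" by (simp add: \<delta>_def power2_eq_square algebra_simps)
    moreover have "(s' + s)\<^sup>2 \<le> (2 * E)\<^sup>2" using s s' E by (intro abs_le_square_iff[THEN iffD1]) auto
    ultimately show "\<delta>\<^sup>2 \<le> 4 * E\<^sup>2 * (s' - s)\<^sup>2" by (simp add: mult_right_mono power_mult_distrib)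
  qed (use R in auto)
  finally have "2 * A * R\<^sup>2 / q' \<le> 2 * A * R\<^sup>2 / q + 2 * A * R\<^sup>2 / q\<^sup>2 * \<delta> + 8 * R * E\<^sup>2 / q\<^sup>2 * (s' - s)\<^sup>2"
    by (simp add: mult_ac)
  then show ?thesis unfolding pair[OF s] pair[OF s'] q_def[symmetric] q'_def[symmetric] \<delta>_def by simp
qed

text \<open>With r = |v|^2 it behaves like r^2 / R well below level R and like r - R well above it:
  the energy in excess of R, smoothed to an explicit convex function of r.\<close>

definition tail_energy :: "real \<Rightarrow> real^3 \<Rightarrow> real" where
  "tail_energy R v = ((norm v)\<^sup>2)\<^sup>2 / (R + (norm v)\<^sup>2)"

text \<open>Convexity of the profile \<open>r\<^sup>2 / (R + r)\<close> makes a collision between a fast particle \<open>v\<close> and a slow one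
  decrease the sum of their tail energies by about \<open>h * norm v powr (2 + \<gamma>)\<close>; this is the only source of
  integrability beyond the energy.\<close>

lemma collision_tail_energy_aux:
  fixes v w :: "real^3"
  assumes \<gamma>: "0 < \<gamma>" "\<gamma> \<le> 1" and h: "0 \<le> h" and R: "1 \<le> R"
  defines "V \<equiv> (norm v)\<^sup>2" and "W \<equiv> (norm w)\<^sup>2" and "\<kappa> \<equiv> angle_gap \<gamma> h (v - w)"
  defines "E \<equiv> (V + W) / 2" and "s \<equiv> (V - W) / 2" and "q \<equiv> (R + V) * (R + W)"
  shows "(\<Sum>j\<in>UNIV. tail_energy R (post \<gamma> h j v w) + tail_energy R (post \<gamma> h j w v)) / 12
      + (2 / 3) * \<kappa> * ((R + E) * R\<^sup>2 * s\<^sup>2 / q\<^sup>2)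
    \<le> (tail_energy R v + tail_energy R w) / 2 + 4 * \<kappa> * (V * W) / R + \<kappa>\<^sup>2 * E\<^sup>2 / R"
proof -
  have \<kappa>w: "angle_gap \<gamma> h (w - v) = \<kappa>" by (simp add: \<kappa>_def angle_gap_def norm_minus_commute)
  note \<kappa> = angle_gap_bounds[OF h, of \<gamma> "v - w", folded \<kappa>_def]
  define U where "U = V * W - (v \<bullet> w)\<^sup>2"
  define s' where "s' j = energy_shift \<kappa> j v w" for j
  have R0: "0 < R" using R by simp
  have nn: "0 \<le> V" "0 \<le> W" "0 \<le> E" by (auto simp: V_def W_def E_def)
  have U: "0 \<le> U" "U \<le> V * W"
    using energy_shift_sums(3,4)[OF \<kappa>(1,2), of v w] by (auto simp: U_def V_def W_def)
  have VW: "E + s = V" "E - s = W" by (auto simp: E_def s_def field_simps)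
  have sE: "\<bar>s\<bar> \<le> E" using nn unfolding E_def s_def by (simp add: abs_le_iff)
  have q_eq: "q = (R + (E + s)) * (R + (E - s))" by (simp add: q_def VW)
  have qpos: "0 < q" unfolding q_def using R0 nn by (intro mult_pos_pos) auto
  have tails: "tail_energy R (post \<gamma> h j v w) + tail_energy R (post \<gamma> h j w v)
    = (E + s' j)\<^sup>2 / (R + (E + s' j)) + (E - s' j)\<^sup>2 / (R + (E - s' j))" for j
    unfolding tail_energy_def post_def \<kappa>w \<kappa>_def[symmetric] collision_energies(1,2)[OF \<kappa>(1,2), where v=v and w=w]
    unfolding V_def[symmetric] W_def[symmetric] E_def[symmetric] s'_def[symmetric] ..
  have s'E: "\<bar>s' j\<bar> \<le> E" for j
    using collision_energies(3)[OF \<kappa>(1,2), where v=v and w=w and j=j] by (simp add: s'_def E_def V_def W_def)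
  have tv: "tail_energy R v + tail_energy R w = (E + s)\<^sup>2 / (R + (E + s)) + (E - s)\<^sup>2 / (R + (E - s))"
    unfolding VW by (simp add: tail_energy_def V_def W_def)
  \<comment> \<open>\<open>a\<close> weighs the first-order change of the squared shift and
    \<open>b\<close> the quadratic remainder; the dissipation is the part - a s^2.\<close>
  define a where "a = 2 * (R + E) * R\<^sup>2 / q\<^sup>2"
  define b where "b = 8 * R * E\<^sup>2 / q\<^sup>2"
  have ab: "0 \<le> a" "0 \<le> b" using R0 nn by (auto simp: a_def b_def)
  have "(\<Sum>j\<in>UNIV. tail_energy R (post \<gamma> h j v w) + tail_energy R (post \<gamma> h j w v))
    \<le> (\<Sum>j\<in>(UNIV :: (3 \<times> bool) set). (tail_energy R v + tail_energy R w) + a * ((s' j)\<^sup>2 - s\<^sup>2) + b * (s' j - s)\<^sup>2)"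
    unfolding tails tv a_def b_def q_eq by (intro sum_mono rational_profile_pair R0 sE s'E)
  also have "\<dots> = 6 * (tail_energy R v + tail_energy R w) + a * ((\<Sum>j\<in>UNIV. (s' j)\<^sup>2) - 6 * s\<^sup>2) + b * (\<Sum>j\<in>UNIV. (s' j - s)\<^sup>2)"
    by (simp add: sum.distrib sum_subtractf sum_distrib_left right_diff_distrib)
  also have "\<dots> \<le> 6 * (tail_energy R v + tail_energy R w) + a * (4 * \<kappa> * (U - s\<^sup>2)) + b * (4 * \<kappa>\<^sup>2 * E\<^sup>2 + 4 * \<kappa> * U)"
    using energy_shift_sums(1,2)[OF \<kappa>(1,2), of v w] ab
    unfolding s'_def s_def U_def E_def V_def W_def
    by (intro add_mono mult_left_mono order.refl) auto
  also have "\<dots> = 6 * (tail_energy R v + tail_energy R w) - 4 * \<kappa> * (a * s\<^sup>2) + 4 * \<kappa> * (a * U + b * U) + 4 * \<kappa>\<^sup>2 * (b * E\<^sup>2)"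
    by (simp add: algebra_simps)
  \<comment> \<open>The production terms reduce to V W / R, to which a contributes 2 and b
    contributes 8. The second-order term in \<kappa> meets only b E^2, which is at most 2 E^2 /
    R.\<close>
  also have "\<dots> \<le> 6 * (tail_energy R v + tail_energy R w) - 4 * \<kappa> * (a * s\<^sup>2) + 4 * \<kappa> * (10 * (V * W / R)) + 4 * \<kappa>\<^sup>2 * (2 * (E\<^sup>2 / R))"
  proof -
    have inv: "1 / (R + y)\<^sup>2 \<le> 1 / R\<^sup>2" "1 / (R + y) \<le> 1 / R" "y / (R + y) \<le> 1" if "0 \<le> y" for y
      using that R0 by (auto intro!: divide_left_mono power_mono mult_pos_pos)
    have q2: "q\<^sup>2 = (R + V)\<^sup>2 * (R + W)\<^sup>2" by (simp add: q_def power_mult_distrib)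
    have RV: "0 < R + V" "0 < R + W" using R0 nn by auto
    have A: "R + E = ((R + V) + (R + W)) / 2" by (simp add: E_def)
    have "a * (V * W) = R\<^sup>2 * (V * W) * (1 / ((R + V) * (R + W)\<^sup>2) + 1 / ((R + V)\<^sup>2 * (R + W)))"
      unfolding a_def q2 A using RV by (simp add: divide_simps power2_eq_square) (simp add: algebra_simps)
    also have "\<dots> \<le> R\<^sup>2 * (V * W) * (1 / (R * R\<^sup>2) + 1 / (R\<^sup>2 * R))"
      using R0 nn RV
      by (intro mult_left_mono add_mono divide_left_mono mult_mono power_mono mult_pos_pos) auto
    also have "\<dots> = 2 * (V * W / R)" using R0 by (simp add: field_simps power2_eq_square)
    finally have aVW: "a * (V * W) \<le> 2 * (V * W / R)" .
    have "b * (V * W) \<le> 8 * (V * W / R)"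
    proof -
      have E2: "E\<^sup>2 \<le> (V\<^sup>2 + W\<^sup>2) / 2"
        using sum_squares_bound[of V W] by (simp add: E_def power2_eq_square field_simps)
      have "b * (V * W) \<le> 8 * R * ((V\<^sup>2 + W\<^sup>2) / 2) / q\<^sup>2 * (V * W)"
        unfolding b_def using R0 nn E2 by (intro mult_right_mono divide_right_mono mult_left_mono) auto
      also have "\<dots> = 4 * R * (V * W) * ((V / (R + V))\<^sup>2 * (1 / (R + W)\<^sup>2) + (W / (R + W))\<^sup>2 * (1 / (R + V)\<^sup>2))"
        unfolding q2 using RV by (simp add: divide_simps power2_eq_square)
      also have "\<dots> \<le> 4 * R * (V * W) * (1 * (1 / R\<^sup>2) + 1 * (1 / R\<^sup>2))"
        using R0 nn RV inv by (intro mult_left_mono add_mono mult_mono power_le_one) auto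
      also have "\<dots> = 8 * (V * W / R)" using R0 by (simp add: field_simps power2_eq_square)
      finally show ?thesis .
    qed
    with aVW have "(a + b) * (V * W) \<le> 10 * (V * W / R)" unfolding distrib_right by linarith
    moreover have "(a + b) * U \<le> (a + b) * (V * W)" using U ab by (intro mult_left_mono) auto
    ultimately have 1: "a * U + b * U \<le> 10 * (V * W / R)" by (simp add: algebra_simps)
    have "b * E\<^sup>2 \<le> 2 * (E\<^sup>2 / R)"
    proof (cases "E = 0")
      case False
      then have Ep: "0 < E" using nn by simp
      have "2 * R * E \<le> q" using R0 nn by (simp add: q_def E_def algebra_simps)
      then have "(2 * R * E)\<^sup>2 \<le> q\<^sup>2" using R0 nn by (intro power_mono) auto
      then have "b \<le> 8 * R * E\<^sup>2 / (2 * R * E)\<^sup>2"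
        unfolding b_def using R0 Ep qpos by (intro divide_left_mono mult_pos_pos) auto
      also have "\<dots> = 2 / R" using R0 Ep by (simp add: field_simps power2_eq_square)
      finally show ?thesis using mult_right_mono[of b "2 / R" "E\<^sup>2"] by simp
    qed simp
    with 1 show ?thesis using \<kappa> by (intro add_mono order.refl mult_left_mono) auto
  qed
  finally have fin: "(\<Sum>j\<in>UNIV. tail_energy R (post \<gamma> h j v w) + tail_energy R (post \<gamma> h j w v))
    \<le> 6 * (tail_energy R v + tail_energy R w) - 4 * \<kappa> * (a * s\<^sup>2) + 4 * \<kappa> * (10 * (V * W / R)) + 4 * \<kappa>\<^sup>2 * (2 * (E\<^sup>2 / R))" .
  define Y where "Y = (R + E) * R\<^sup>2 * s\<^sup>2 / q\<^sup>2"
  have eqs: "4 * \<kappa> * (a * s\<^sup>2) = 8 * (\<kappa> * Y)" "4 * \<kappa> * (10 * (V * W / R)) = 40 * (\<kappa> * (V * W / R))"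
    "4 * \<kappa>\<^sup>2 * (2 * (E\<^sup>2 / R)) = 8 * (\<kappa>\<^sup>2 * (E\<^sup>2 / R))"
    "4 * \<kappa> * (V * W) / R = 4 * (\<kappa> * (V * W / R))" "\<kappa>\<^sup>2 * E\<^sup>2 / R = \<kappa>\<^sup>2 * (E\<^sup>2 / R)"
    "(2 / 3) * \<kappa> * Y = (2 / 3) * (\<kappa> * Y)"
    by (simp_all add: a_def Y_def)
  have p: "0 \<le> \<kappa> * (V * W / R)" "0 \<le> \<kappa>\<^sup>2 * (E\<^sup>2 / R)" using \<kappa> nn R0 by auto
  \<comment> \<open>After division by 12: 8 / 12 = 2 / 3, while 40 / 12 \<le> 4 and 8 / 12 \<le>
    1.\<close>
  have "S / 12 + 2 / 3 * y \<le> T / 2 + 4 * c + d"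
    if "S \<le> 6 * T - 8 * y + 40 * c + 8 * d" "0 \<le> c" "0 \<le> d" for S T y c d :: real
    using that by linarith
  from this[OF fin[unfolded eqs] p] show ?thesis unfolding Y_def[symmetric] eqs .
qed

text \<open>Dissipation is kept only when v is fast and w slow, since then it is bounded below
  explicitly; 4 \<rho> \<le> R makes w at most half as fast as v. All production is either of order
  h / R, to be absorbed, or of order h^2, to vanish with the time step.\<close>

lemma collision_tail_energy:
  fixes v w :: "real^3"
  assumes \<gamma>: "0 < \<gamma>" "\<gamma> \<le> 1" and h: "0 \<le> h" and R: "1 \<le> R" "4 * \<rho> \<le> R"
  shows "(\<Sum>j\<in>UNIV. tail_energy R (post \<gamma> h j v w) + tail_energy R (post \<gamma> h j w v)) / 12
      + h / 25 * (norm v powr (2 + \<gamma>) * indicator {v. R \<le> (norm v)\<^sup>2} v * indicator {w. (norm w)\<^sup>2 \<le> \<rho>} w)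
    \<le> (tail_energy R v + tail_energy R w) / 2
      + 48 * h / R * (norm v powr (2 + \<gamma>) * (norm w)\<^sup>2 + norm w powr (2 + \<gamma>) * (norm v)\<^sup>2)
      + 36 * h\<^sup>2 * (6 + 5 * (norm v ^ 6 + norm w ^ 6))"
proof -
  define V where "V = (norm v)\<^sup>2"
  define W where "W = (norm w)\<^sup>2"
  define \<kappa> where "\<kappa> = angle_gap \<gamma> h (v - w)"
  define E where "E = (V + W) / 2"
  define s where "s = (V - W) / 2"
  define q where "q = (R + V) * (R + W)"
  define z where "z = 6 * h * norm (v - w) powr \<gamma>"
  define X where "X = (R + E) * R\<^sup>2 * s\<^sup>2 / q\<^sup>2"
  note \<kappa> = angle_gap_bounds[OF h, of \<gamma> "v - w", folded \<kappa>_def, folded z_def]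
  have R0: "0 < R" using R by simp
  have nn: "0 \<le> V" "0 \<le> W" "0 \<le> E" "0 \<le> z" using h by (auto simp: V_def W_def E_def z_def)
  have qpos: "0 < q" unfolding q_def using R0 nn by (intro mult_pos_pos) auto
  have X0: "0 \<le> X" using R0 nn by (simp add: X_def)
  \<comment> \<open>The cap loses at most z - \<kappa> \<le> z^2. As X is at most of the size of the
    energy, exchanging \<kappa> for z in the dissipation costs no more than z^2 E, a second-order
    error in h.\<close>
  have XE: "X \<le> E / 2"
  proof (cases "E = 0")
    case True
    then have "s = 0" using nn by (simp add: E_def s_def)
    then show ?thesis using nn by (simp add: X_def)
  next
    case False
    then have Ep: "0 < E" using nn by simp
    have "0 \<le> V * W" using nn by simp
    moreover have "q = R * R + 2 * R * E + V * W" by (simp add: q_def E_def algebra_simps)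
    ultimately have q1: "R * (R + E) \<le> q" "2 * R * E \<le> q" using R0 Ep by (auto simp: algebra_simps intro: add_nonneg_nonneg)
    have "(R * (R + E)) * (2 * R * E) \<le> q * q" using q1 R0 Ep qpos by (intro mult_mono) auto
    moreover have "s\<^sup>2 \<le> E\<^sup>2" using nn unfolding s_def E_def by (intro abs_le_square_iff[THEN iffD1]) (simp add: abs_le_iff)
    ultimately have "X \<le> (R + E) * R\<^sup>2 * E\<^sup>2 / ((R * (R + E)) * (2 * R * E))"
      unfolding X_def power2_eq_square[of q] using R0 Ep qpos by (intro frac_le mult_left_mono) auto
    also have "\<dots> = E / 2" using R0 Ep by (simp add: divide_simps power2_eq_square)
    finally show ?thesis .
  qed
  have kz: "z - z\<^sup>2 \<le> \<kappa>"
  proof -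
    have "z - z\<^sup>2 \<le> 1" using nn(4) sum_squares_bound[of z 1] zero_le_power2[of "z - 1"] by (simp add: power2_eq_square algebra_simps)
    moreover have "z - z\<^sup>2 \<le> z" by simp
    moreover have "\<kappa> = min 1 z" by (simp add: \<kappa>_def angle_gap_def z_def)
    ultimately show ?thesis by simp
  qed
  have diss: "h / 25 * (norm v powr (2 + \<gamma>) * indicator {v. R \<le> (norm v)\<^sup>2} v * indicator {w. (norm w)\<^sup>2 \<le> \<rho>} w) \<le> (2 / 3) * z * X"
  proof (cases "R \<le> V \<and> W \<le> \<rho>")
    case False
    then show ?thesis using nn X0 by (auto simp: V_def W_def indicator_def)
  next
    case True
    then have RV: "R \<le> V" and W4: "4 * W \<le> R" using R by auto
    have Vp: "0 < V" using RV R0 by simp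
    have v0: "0 < norm v" using Vp by (simp add: V_def)
    \<comment> \<open>W \<le> V / 4 gives s \<ge> 3/8 V, and W \<le> R / 4 gives q \<le> 5/4 R (R +
      V); the quotient is 9/200 V^2 / (R + V), at least 9/400 V. With z \<ge> 3 h |v|^\<gamma> and
      the factor 2/3 this becomes 9/200, above the required 1/25.\<close>
    have "9 / 400 * V \<le> X"
    proof -
      have s38: "(3 / 8 * V)\<^sup>2 \<le> s\<^sup>2" using RV W4 Vp unfolding s_def by (intro power_mono) auto
      have q54: "q \<le> (R + V) * (5 / 4 * R)" unfolding q_def using W4 R0 Vp by (intro mult_left_mono) auto
      have q2: "q\<^sup>2 \<le> ((R + V) * (5 / 4 * R))\<^sup>2" using qpos q54 by (intro power_mono) auto
      have A2: "(R + V) / 2 \<le> R + E" using R0 nn by (simp add: E_def field_simps)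
      have "9 / 400 * V = 9 / 200 * V\<^sup>2 / (2 * V)" using Vp by (simp add: power2_eq_square)
      also have "\<dots> \<le> 9 / 200 * V\<^sup>2 / (R + V)" using RV R0 Vp by (intro divide_left_mono mult_pos_pos) auto
      also have "\<dots> = (R + V) / 2 * R\<^sup>2 * (3 / 8 * V)\<^sup>2 / ((R + V) * (5 / 4 * R))\<^sup>2"
        using R0 Vp by (simp add: divide_simps power2_eq_square)
      also have "\<dots> \<le> X" unfolding X_def
        using s38 q2 A2 R0 Vp nn qpos by (intro frac_le mult_mono) auto
      finally show ?thesis .
    qed
    moreover have "3 * h * norm v powr \<gamma> \<le> z"
    proof -
      have "norm w \<le> norm v / 2"
      proof (rule power2_le_imp_le)
        show "(norm w)\<^sup>2 \<le> (norm v / 2)\<^sup>2" using RV W4 by (simp add: V_def W_def power_divide)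
      qed auto
      then have "norm v / 2 \<le> norm (v - w)" using norm_triangle_ineq2[of v w] by linarith
      then have "(norm v / 2) powr \<gamma> \<le> norm (v - w) powr \<gamma>" using \<gamma> by (intro powr_mono2) auto
      moreover have "(norm v / 2) powr \<gamma> = norm v powr \<gamma> / 2 powr \<gamma>" by (rule powr_divide)
      moreover have "norm v powr \<gamma> / 2 \<le> norm v powr \<gamma> / 2 powr \<gamma>"
        using powr_mono[of \<gamma> 1 2] \<gamma> by (intro divide_left_mono) auto
      ultimately have "norm v powr \<gamma> / 2 \<le> norm (v - w) powr \<gamma>" by linarith
      from mult_left_mono[OF this, of "6 * h"] h show ?thesis by (simp add: z_def)
    qed
    ultimately have "(3 * h * norm v powr \<gamma>) * (9 / 400 * V) \<le> z * X" using h nn Vp by (intro mult_mono) auto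
    moreover have "norm v powr (2 + \<gamma>) = norm v powr \<gamma> * V" using v0 by (simp add: powr_add powr_numeral V_def)
    moreover have "0 \<le> h * (norm v powr \<gamma> * V)" using h nn by simp
    ultimately show ?thesis using True by (simp add: V_def[symmetric] W_def[symmetric])
  qed
  have "(2 / 3) * z * X \<le> (2 / 3) * \<kappa> * X + (2 / 3) * z\<^sup>2 * X"
    using mult_right_mono[OF kz X0] by (simp add: algebra_simps)
  moreover have "(2 / 3) * z\<^sup>2 * X \<le> (2 / 3) * z\<^sup>2 * (E / 2)" using XE by (intro mult_left_mono) auto
  moreover have "(2 / 3) * z\<^sup>2 * (E / 2) \<le> z\<^sup>2 * E" using nn by simp
  ultimately have zX: "(2 / 3) * z * X \<le> (2 / 3) * \<kappa> * X + z\<^sup>2 * E" by linarith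
  have k2: "\<kappa>\<^sup>2 * E\<^sup>2 / R \<le> z\<^sup>2 * E\<^sup>2"
  proof -
    have "\<kappa>\<^sup>2 * E\<^sup>2 / R \<le> \<kappa>\<^sup>2 * E\<^sup>2 / 1" using R by (intro divide_left_mono) auto
    also have "\<dots> \<le> z\<^sup>2 * E\<^sup>2 / 1" using \<kappa> by (intro divide_right_mono mult_right_mono power_mono) auto
    finally show ?thesis by simp
  qed
  have pw: "(norm (v - w) powr \<gamma>)\<^sup>2 \<le> 1 + 4 * E"
  proof -
    have "(norm (v - w) powr \<gamma>)\<^sup>2 = norm (v - w) powr (2 * \<gamma>)"
      by (simp add: power2_eq_square powr_add[symmetric])
    also have "\<dots> \<le> 1 + (norm (v - w))\<^sup>2" using \<gamma> by (intro norm_powr_le_Suc_square) auto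
    also have "\<dots> \<le> 1 + 4 * E" using norm_diff_square_le[of v w] by (simp add: E_def V_def W_def)
    finally show ?thesis .
  qed
  \<comment> \<open>Sixth moments may enter only with h^2, because they depend on the truncation.
    The product of 1 + 4 E with E + E^2 is cubic in the energies, that is, of degree six in the
    velocities.\<close>
  have err: "z\<^sup>2 * E + z\<^sup>2 * E\<^sup>2 \<le> 36 * h\<^sup>2 * (6 + 5 * (V ^ 3 + W ^ 3))"
  proof -
    have "z\<^sup>2 = 36 * h\<^sup>2 * (norm (v - w) powr \<gamma>)\<^sup>2" by (simp add: z_def power_mult_distrib)
    also have "\<dots> \<le> 36 * h\<^sup>2 * (1 + 4 * E)" by (intro mult_left_mono pw) auto
    finally have z2: "z\<^sup>2 \<le> 36 * h\<^sup>2 * (1 + 4 * E)" .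
    have "z\<^sup>2 * E + z\<^sup>2 * E\<^sup>2 = z\<^sup>2 * (E + E\<^sup>2)" by (simp add: algebra_simps)
    also have "\<dots> \<le> (36 * h\<^sup>2 * (1 + 4 * E)) * (E + E\<^sup>2)" using z2 nn by (intro mult_right_mono) auto
    also have "\<dots> = 36 * h\<^sup>2 * (E + 5 * E\<^sup>2 + 4 * E ^ 3)" by (simp add: power2_eq_square power3_eq_cube algebra_simps)
    also have "\<dots> \<le> 36 * h\<^sup>2 * (6 + 5 * (V ^ 3 + W ^ 3))"
    proof (intro mult_left_mono)
      have pw3: "y \<le> 1 + y ^ 3" "y\<^sup>2 \<le> 1 + y ^ 3" if "0 \<le> y" for y :: real
      proof -
        show "y \<le> 1 + y ^ 3"
        proof (cases "y \<le> 1")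
          case False
          then have "y ^ 1 \<le> y ^ 3" by (intro power_increasing) auto
          then show ?thesis by simp
        qed (use that in \<open>simp add: add_increasing2\<close>)
        show "y\<^sup>2 \<le> 1 + y ^ 3"
        proof (cases "y \<le> 1")
          case True
          then have "y\<^sup>2 \<le> 1" using that by (simp add: power_le_one)
          then show ?thesis using that by (simp add: add_increasing2)
        next
          case False
          then have "y ^ 2 \<le> y ^ 3" by (intro power_increasing) auto
          then show ?thesis by simp
        qed
      qed
      have "E + 5 * E\<^sup>2 + 4 * E ^ 3 \<le> 6 + 10 * E ^ 3" using pw3[OF nn(3)] by linarith
      also have "E ^ 3 \<le> (V ^ 3 + W ^ 3) / 2"
      proof -
        have "(V ^ 3 + W ^ 3) / 2 - E ^ 3 = 3 / 8 * ((V + W) * (V - W)\<^sup>2)"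
          by (simp add: E_def power2_eq_square power3_eq_cube field_simps)
        also have "\<dots> \<ge> 0" using nn by (intro mult_nonneg_nonneg) auto
        finally show ?thesis by simp
      qed
      finally show "E + 5 * E\<^sup>2 + 4 * E ^ 3 \<le> 6 + 5 * (V ^ 3 + W ^ 3)" by (simp add: add_divide_distrib)
    qed auto
    finally show ?thesis .
  qed
  have kVW: "4 * \<kappa> * (V * W) / R \<le> 48 * h / R * (norm v powr (2 + \<gamma>) * W + norm w powr (2 + \<gamma>) * V)"
  proof -
    have g2: "norm u powr (2 + \<gamma>) = norm u powr \<gamma> * (norm u)\<^sup>2" for u :: "real^3"
      by (cases "u = 0") (auto simp: powr_add powr_numeral)
    have "norm (v - w) powr \<gamma> \<le> 2 powr \<gamma> * (norm v powr \<gamma> + norm w powr \<gamma>)"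
      using \<gamma> by (intro norm_diff_powr_le) auto
    also have "\<dots> \<le> 2 * (norm v powr \<gamma> + norm w powr \<gamma>)"
      using powr_mono[of \<gamma> 1 2] \<gamma> by (intro mult_right_mono) auto
    finally have "6 * h * norm (v - w) powr \<gamma> \<le> 6 * h * (2 * (norm v powr \<gamma> + norm w powr \<gamma>))"
      using h by (intro mult_left_mono) auto
    then have k12: "\<kappa> \<le> 12 * h * (norm v powr \<gamma> + norm w powr \<gamma>)" using \<kappa>(3) unfolding z_def by linarith
    have "4 * \<kappa> * (V * W) / R \<le> 4 * (12 * h * (norm v powr \<gamma> + norm w powr \<gamma>)) * (V * W) / R"
      using k12 nn R0 by (intro divide_right_mono mult_right_mono mult_left_mono) auto
    also have "\<dots> = 48 * h / R * (norm v powr (2 + \<gamma>) * W + norm w powr (2 + \<gamma>) * V)"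
      unfolding g2 V_def[symmetric] W_def[symmetric] by (simp add: algebra_simps add_divide_distrib)
    finally show ?thesis .
  qed
  have n6: "norm u ^ 6 = ((norm u)\<^sup>2) ^ 3" for u :: "real^3" by (simp add: power_mult[symmetric])
  note aux = collision_tail_energy_aux[OF \<gamma> h R(1), of v w, folded V_def W_def \<kappa>_def, folded E_def s_def q_def, folded X_def]
  show ?thesis
    unfolding n6 V_def[symmetric] W_def[symmetric]
    using aux diss zX k2 err kVW unfolding V_def[symmetric] W_def[symmetric] by linarith
qed

section \<open>One collision step for measures\<close>

text \<open>Law of one outgoing velocity when two independent particles with law F collide, j being
  uniform over the six rotations. The partner is discarded; by exchangeability it has the same
  law.\<close>

definition collision_step :: "real \<Rightarrow> real \<Rightarrow> (real^3) measure \<Rightarrow> (real^3) measure" where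
  "collision_step \<gamma> h F = distr (measure_pmf (pmf_of_set (UNIV :: (3 \<times> bool) set)) \<Otimes>\<^sub>M (F \<Otimes>\<^sub>M F)) borel
     (\<lambda>(j, v, w). post \<gamma> h j v w)"

lemma post_measurable_prod:
  assumes F: "F \<in> prob_measures"
  shows "(\<lambda>(j, v, w). post \<gamma> h j v w) \<in> measure_pmf (pmf_of_set (UNIV :: (3 \<times> bool) set)) \<Otimes>\<^sub>M (F \<Otimes>\<^sub>M F) \<rightarrow>\<^sub>M borel"
proof -
  note prob_measuresD(2)[OF F, measurable_cong]
  have "(\<lambda>(j, v, w). post \<gamma> h j v w) \<in> count_space UNIV \<Otimes>\<^sub>M (F \<Otimes>\<^sub>M F) \<rightarrow>\<^sub>M borel"
    by (rule measurable_pair_measure_countable1) auto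
  then show ?thesis
    by (subst measurable_cong_sets[OF sets_pair_measure_cong[OF sets_measure_pmf_count_space refl] refl])
qed

lemma collision_step_prob:
  assumes F: "F \<in> prob_measures"
  shows "collision_step \<gamma> h F \<in> prob_measures"
proof -
  interpret F: prob_space F using prob_measuresD[OF F] by simp
  interpret FF: pair_prob_space F F ..
  interpret P: pair_prob_space "measure_pmf (pmf_of_set (UNIV :: (3 \<times> bool) set))" "F \<Otimes>\<^sub>M F" ..
  show ?thesis unfolding collision_step_def
    by (rule prob_measures_distr[OF P.prob_space_axioms post_measurable_prod[OF F]])
qed

lemma nn_integral_pair_swap:
  assumes F: "F \<in> prob_measures" and f: "(\<lambda>(v, w). f v w) \<in> borel_measurable (borel \<Otimes>\<^sub>M borel)"
  shows "(\<integral>\<^sup>+v. \<integral>\<^sup>+w. f v w \<partial>F \<partial>F) = (\<integral>\<^sup>+v. \<integral>\<^sup>+w. f w v \<partial>F \<partial>F)"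
proof -
  interpret F: prob_space F using prob_measuresD[OF F] by simp
  interpret FF: pair_prob_space F F ..
  note prob_measuresD(2)[OF F, measurable_cong] f[measurable]
  show ?thesis by (rule FF.Fubini') measurable
qed

text \<open>Exchanging v and w symmetrises the integrand; 12 is six rotations times two particles.
  Conservation and dissipation hold for pairs, not for single particles, so the moment estimates
  start from this form.\<close>

lemma nn_integral_collision_step:
  fixes g :: "real^3 \<Rightarrow> real"
  assumes F: "F \<in> prob_measures" and g[measurable]: "g \<in> borel_measurable borel" and nn: "\<And>v. 0 \<le> g v"
  shows "(\<integral>\<^sup>+u. ennreal (g u) \<partial>collision_step \<gamma> h F)
    = (\<integral>\<^sup>+v. \<integral>\<^sup>+w. ennreal ((\<Sum>j\<in>UNIV. g (post \<gamma> h j v w) + g (post \<gamma> h j w v)) / 12) \<partial>F \<partial>F)"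
proof -
  interpret F: prob_space F using prob_measuresD[OF F] by simp
  interpret FF: pair_prob_space F F ..
  note prob_measuresD(2)[OF F, measurable_cong] post_measurable_prod[OF F, measurable]
  have "(\<integral>\<^sup>+u. ennreal (g u) \<partial>collision_step \<gamma> h F)
    = (\<integral>\<^sup>+x. (case x of (j, v, w) \<Rightarrow> ennreal (g (post \<gamma> h j v w))) \<partial>(measure_pmf (pmf_of_set (UNIV :: (3 \<times> bool) set)) \<Otimes>\<^sub>M (F \<Otimes>\<^sub>M F)))"
    unfolding collision_step_def by (subst nn_integral_distr) (auto intro!: nn_integral_cong)
  also have "\<dots> = (\<integral>\<^sup>+j. \<integral>\<^sup>+x. (case x of (v, w) \<Rightarrow> ennreal (g (post \<gamma> h j v w))) \<partial>(F \<Otimes>\<^sub>M F) \<partial>measure_pmf (pmf_of_set (UNIV :: (3 \<times> bool) set)))"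
  proof (subst FF.nn_integral_fst[symmetric])
    have "(\<lambda>x. ennreal (g (case x of (j, v, w) \<Rightarrow> post \<gamma> h j v w))) \<in> borel_measurable (measure_pmf (pmf_of_set (UNIV :: (3 \<times> bool) set)) \<Otimes>\<^sub>M (F \<Otimes>\<^sub>M F))"
      by measurable
    then show "(\<lambda>x. case x of (j, v, w) \<Rightarrow> ennreal (g (post \<gamma> h j v w))) \<in> borel_measurable (measure_pmf (pmf_of_set (UNIV :: (3 \<times> bool) set)) \<Otimes>\<^sub>M (F \<Otimes>\<^sub>M F))"
      by (simp add: case_prod_beta)
  qed simp
  also have "\<dots> = (\<Sum>j\<in>UNIV. \<integral>\<^sup>+x. (case x of (v, w) \<Rightarrow> ennreal (g (post \<gamma> h j v w))) \<partial>(F \<Otimes>\<^sub>M F)) / 6"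
    by (subst nn_integral_pmf_of_set) auto
  also have "(\<lambda>j. \<integral>\<^sup>+x. (case x of (v, w) \<Rightarrow> ennreal (g (post \<gamma> h j v w))) \<partial>(F \<Otimes>\<^sub>M F))
    = (\<lambda>j. \<integral>\<^sup>+v. \<integral>\<^sup>+w. ennreal (g (post \<gamma> h j v w)) \<partial>F \<partial>F)"
    by (rule ext, subst F.nn_integral_fst[symmetric]) auto
  also have "(\<Sum>j\<in>UNIV. \<integral>\<^sup>+v. \<integral>\<^sup>+w. ennreal (g (post \<gamma> h j v w)) \<partial>F \<partial>F) / 6
    = ((\<Sum>j\<in>UNIV. \<integral>\<^sup>+v. \<integral>\<^sup>+w. ennreal (g (post \<gamma> h j v w)) \<partial>F \<partial>F) + (\<Sum>j\<in>UNIV. \<integral>\<^sup>+v. \<integral>\<^sup>+w. ennreal (g (post \<gamma> h j w v)) \<partial>F \<partial>F)) / 12"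
  proof -
    have "(\<integral>\<^sup>+v. \<integral>\<^sup>+w. ennreal (g (post \<gamma> h j w v)) \<partial>F \<partial>F) = (\<integral>\<^sup>+v. \<integral>\<^sup>+w. ennreal (g (post \<gamma> h j v w)) \<partial>F \<partial>F)" for j
      by (rule nn_integral_pair_swap[OF F, symmetric]) measurable
    moreover have "a / 6 = (a + a) / 12" for a :: ennreal
      by (cases a) (simp_all add: ennreal_numeral[symmetric] divide_ennreal ennreal_plus[symmetric]
          ennreal_top_divide del: ennreal_numeral ennreal_plus)
    ultimately show ?thesis by simp
  qed
  also have "\<dots> = (\<integral>\<^sup>+v. \<integral>\<^sup>+w. ((\<Sum>j\<in>UNIV. ennreal (g (post \<gamma> h j v w))) + (\<Sum>j\<in>UNIV. ennreal (g (post \<gamma> h j w v)))) / 12 \<partial>F \<partial>F)"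
    by (simp add: nn_integral_add nn_integral_sum nn_integral_divide)
  also have "\<dots> = (\<integral>\<^sup>+v. \<integral>\<^sup>+w. ennreal ((\<Sum>j\<in>UNIV. g (post \<gamma> h j v w) + g (post \<gamma> h j w v)) / 12) \<partial>F \<partial>F)"
    by (intro nn_integral_cong)
      (simp add: nn sum.distrib sum_nonneg ennreal_plus[symmetric] divide_ennreal[symmetric] del: ennreal_plus)
  finally show ?thesis .
qed

text \<open>By the choice of \<open>discrete_L\<close>, a collision step is exactly an explicit
  Euler step of the weak equation; all error sits in the operator.\<close>

lemma integral_collision_step:
  fixes \<phi> :: "real^3 \<Rightarrow> real"
  assumes F: "F \<in> prob_measures" and \<phi>: "\<phi> \<in> C2b" and h: "0 < h"
  shows "(\<integral>u. \<phi> u \<partial>collision_step \<gamma> h F) - (\<integral>u. \<phi> u \<partial>F) = h * (\<integral>v. (\<integral>w. discrete_L \<gamma> h \<phi> v w \<partial>F) \<partial>F)"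
proof -
  interpret F: prob_space F using prob_measuresD[OF F] by simp
  interpret FF: pair_prob_space F F ..
  interpret P: pair_prob_space "measure_pmf (pmf_of_set (UNIV :: (3 \<times> bool) set))" "F \<Otimes>\<^sub>M F" ..
  note prob_measuresD(2)[OF F, measurable_cong] post_measurable_prod[OF F, measurable] C2b_measurable[OF \<phi>, measurable]
  obtain B where B: "\<And>v. \<bar>\<phi> v\<bar> \<le> B" using C2b_bounds[OF \<phi>] by metis
  have int: "integrable (F \<Otimes>\<^sub>M F) (\<lambda>(v, w). \<phi> (post \<gamma> h j v w))" for j
    by (rule FF.P.integrable_const_bound[where B=B]) (use B in \<open>auto simp: case_prod_beta\<close>)
  have "(\<integral>u. \<phi> u \<partial>collision_step \<gamma> h F)
    = (\<integral>x. \<phi> (case x of (j, v, w) \<Rightarrow> post \<gamma> h j v w) \<partial>(measure_pmf (pmf_of_set (UNIV :: (3 \<times> bool) set)) \<Otimes>\<^sub>M (F \<Otimes>\<^sub>M F)))"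
    unfolding collision_step_def by (rule integral_distr) auto
  also have "\<dots> = (\<integral>j. \<integral>x. \<phi> (case (j, x) of (j, v, w) \<Rightarrow> post \<gamma> h j v w) \<partial>(F \<Otimes>\<^sub>M F) \<partial>measure_pmf (pmf_of_set (UNIV :: (3 \<times> bool) set)))"
    by (rule P.integral_fst'[symmetric], rule P.P.integrable_const_bound[where B=B]) (use B in auto)
  also have "\<dots> = (\<Sum>j\<in>UNIV. \<integral>x. (case x of (v, w) \<Rightarrow> \<phi> (post \<gamma> h j v w)) \<partial>(F \<Otimes>\<^sub>M F)) / 6"
    by (subst integral_pmf_of_set) (auto simp: case_prod_unfold)
  also have "\<dots> = (\<integral>x. (\<Sum>j\<in>UNIV. (case x of (v, w) \<Rightarrow> \<phi> (post \<gamma> h j v w))) / 6 \<partial>(F \<Otimes>\<^sub>M F))"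
    using int by (simp add: Bochner_Integration.integral_sum)
  also have "\<dots> = (\<integral>x. h * (case x of (v, w) \<Rightarrow> discrete_L \<gamma> h \<phi> v w) + \<phi> (fst x) \<partial>(F \<Otimes>\<^sub>M F))"
    using h by (intro Bochner_Integration.integral_cong refl) (auto simp: discrete_L_def field_simps)
  also have "\<dots> = h * (\<integral>x. (case x of (v, w) \<Rightarrow> discrete_L \<gamma> h \<phi> v w) \<partial>(F \<Otimes>\<^sub>M F)) + (\<integral>x. \<phi> (fst x) \<partial>(F \<Otimes>\<^sub>M F))"
  proof -
    have i1: "integrable (F \<Otimes>\<^sub>M F) (\<lambda>x. \<phi> (fst x))"
      by (rule FF.P.integrable_const_bound[where B=B]) (use B in auto)
    have "integrable (F \<Otimes>\<^sub>M F) (\<lambda>x. ((\<Sum>j\<in>UNIV. (case x of (v, w) \<Rightarrow> \<phi> (post \<gamma> h j v w))) / 6 - \<phi> (fst x)) / h)"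
      using int i1 by (intro Bochner_Integration.integrable_diff integrable_divide_zero Bochner_Integration.integrable_sum) auto
    then have i2: "integrable (F \<Otimes>\<^sub>M F) (\<lambda>x. (case x of (v, w) \<Rightarrow> discrete_L \<gamma> h \<phi> v w))"
      by (simp add: discrete_L_def case_prod_beta)
    show ?thesis using i1 i2 by simp
  qed
  also have "(\<integral>x. \<phi> (fst x) \<partial>(F \<Otimes>\<^sub>M F)) = (\<integral>v. \<phi> v \<partial>F)"
  proof -
    have "(\<integral>x. \<phi> (fst x) \<partial>(F \<Otimes>\<^sub>M F)) = (\<integral>v. \<integral>w. \<phi> (fst (v, w)) \<partial>F \<partial>F)"
      by (rule FF.integral_fst'[symmetric], rule FF.P.integrable_const_bound[where B=B]) (use B in auto)
    then show ?thesis by (simp add: F.prob_space)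
  qed
  also have "(\<integral>x. (case x of (v, w) \<Rightarrow> discrete_L \<gamma> h \<phi> v w) \<partial>(F \<Otimes>\<^sub>M F)) = (\<integral>v. \<integral>w. discrete_L \<gamma> h \<phi> v w \<partial>F \<partial>F)"
  proof -
    have "\<bar>discrete_L \<gamma> h \<phi> v w\<bar> \<le> 2 * B / h" for v w
    proof -
      have "\<bar>\<Sum>j\<in>UNIV. \<phi> (post \<gamma> h j v w)\<bar> \<le> (\<Sum>j\<in>(UNIV :: (3 \<times> bool) set). B)"
        by (intro order_trans[OF sum_abs] sum_mono B)
      then have "\<bar>(\<Sum>j\<in>UNIV. \<phi> (post \<gamma> h j v w)) / 6 - \<phi> v\<bar> \<le> 2 * B" using B[of v] by simp
      then show ?thesis using h unfolding discrete_L_def by (simp add: divide_right_mono)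
    qed
    then have "integrable (F \<Otimes>\<^sub>M F) (\<lambda>(v, w). discrete_L \<gamma> h \<phi> v w)"
      using discrete_L_measurable[OF \<phi>, of \<gamma> h]
      by (intro FF.P.integrable_const_bound[where B="2 * B / h"]) (auto simp: case_prod_beta)
    from FF.integral_fst'[OF this] show ?thesis by simp
  qed
  finally show ?thesis by simp
qed

section \<open>Moments after one collision step\<close>

lemma nn_integral_product:
  assumes F: "F \<in> prob_measures" and [measurable]: "a \<in> borel_measurable borel" "b \<in> borel_measurable borel"
    and "\<And>v. 0 \<le> a v" "\<And>v. 0 \<le> b v"
  shows "(\<integral>\<^sup>+v. \<integral>\<^sup>+w. ennreal (a v * b w) \<partial>F \<partial>F) = (\<integral>\<^sup>+v. ennreal (a v) \<partial>F) * (\<integral>\<^sup>+w. ennreal (b w) \<partial>F)"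
proof -
  note prob_measuresD(2)[OF F, measurable_cong]
  show ?thesis using assms(4,5) by (simp add: ennreal_mult nn_integral_cmult nn_integral_multc)
qed

lemma moment_2_eq: "moment 2 F = (\<integral>\<^sup>+v. ennreal ((norm v)\<^sup>2) \<partial>F)"
  unfolding moment_def by (simp add: powr_numeral)

lemma moment_2_collision_step:
  assumes F: "F \<in> prob_measures" and h: "0 \<le> h"
  shows "moment 2 (collision_step \<gamma> h F) = moment 2 F"
proof -
  interpret F: prob_space F using prob_measuresD[OF F] by simp
  note prob_measuresD(2)[OF F, measurable_cong]
  have pt: "(\<Sum>j\<in>UNIV. (norm (post \<gamma> h j v w))\<^sup>2 + (norm (post \<gamma> h j w v))\<^sup>2) / 12 = ((norm v)\<^sup>2 + (norm w)\<^sup>2) / 2" for v w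
  proof -
    have \<kappa>w: "angle_gap \<gamma> h (w - v) = angle_gap \<gamma> h (v - w)" by (simp add: angle_gap_def norm_minus_commute)
    have "(norm (post \<gamma> h j v w))\<^sup>2 + (norm (post \<gamma> h j w v))\<^sup>2 = (norm v)\<^sup>2 + (norm w)\<^sup>2" for j
      using collision_energies(1,2)[OF angle_gap_bounds(1,2)[OF h, of \<gamma> "v - w"], where v=v and w=w and j=j]
      by (simp add: post_def \<kappa>w)
    then show ?thesis by simp
  qed
  have "moment 2 (collision_step \<gamma> h F) = (\<integral>\<^sup>+v. \<integral>\<^sup>+w. ennreal (((norm v)\<^sup>2 + (norm w)\<^sup>2) / 2) \<partial>F \<partial>F)"
    unfolding moment_2_eq by (subst nn_integral_collision_step[OF F]) (auto simp: pt)
  also have "\<dots> = (\<integral>\<^sup>+v. \<integral>\<^sup>+w. ennreal ((norm v)\<^sup>2) / 2 + ennreal ((norm w)\<^sup>2) / 2 \<partial>F \<partial>F)"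
    by (intro nn_integral_cong) (simp add: add_divide_distrib divide_ennreal[symmetric])
  also have "\<dots> = moment 2 F / 2 + moment 2 F / 2"
    unfolding moment_2_eq by (simp add: nn_integral_add nn_integral_divide F.emeasure_space_1)
  also have "\<dots> = moment 2 F"
    by (cases "moment 2 F") (simp_all add: ennreal_numeral[symmetric] divide_ennreal ennreal_plus[symmetric]
          ennreal_top_divide del: ennreal_numeral ennreal_plus)
  finally show ?thesis .
qed

lemma pair_nn_integral_add:
  assumes F: "F \<in> prob_measures"
    and P: "(\<lambda>(v, w). P v w) \<in> borel_measurable (borel \<Otimes>\<^sub>M borel)" and Q: "(\<lambda>(v, w). Q v w) \<in> borel_measurable (borel \<Otimes>\<^sub>M borel)"
    and nn: "\<And>v w. 0 \<le> P v w" "\<And>v w. 0 \<le> (Q v w :: real)"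
  shows "(\<integral>\<^sup>+v. \<integral>\<^sup>+w. ennreal (P v w + Q v w) \<partial>F \<partial>F)
    = (\<integral>\<^sup>+v. \<integral>\<^sup>+w. ennreal (P v w) \<partial>F \<partial>F) + (\<integral>\<^sup>+v. \<integral>\<^sup>+w. ennreal (Q v w) \<partial>F \<partial>F)"
proof -
  interpret F: prob_space F using prob_measuresD[OF F] by simp
  note prob_measuresD(2)[OF F, measurable_cong] P[measurable] Q[measurable]
  show ?thesis using nn by (simp add: nn_integral_add)
qed

lemma pair_nn_integral_cmult:
  assumes F: "F \<in> prob_measures"
    and P: "(\<lambda>(v, w). P v w) \<in> borel_measurable (borel \<Otimes>\<^sub>M borel)"
    and nn: "\<And>v w. 0 \<le> P v w" "0 \<le> (c :: real)"
  shows "(\<integral>\<^sup>+v. \<integral>\<^sup>+w. ennreal (c * P v w) \<partial>F \<partial>F) = ennreal c * (\<integral>\<^sup>+v. \<integral>\<^sup>+w. ennreal (P v w) \<partial>F \<partial>F)"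
proof -
  interpret F: prob_space F using prob_measuresD[OF F] by simp
  note prob_measuresD(2)[OF F, measurable_cong] P[measurable]
  show ?thesis using nn by (simp add: nn_integral_cmult ennreal_mult)
qed

lemma pair_nn_integral_average:
  assumes F: "F \<in> prob_measures" and a[measurable]: "a \<in> borel_measurable borel" and nn: "\<And>v. 0 \<le> (a v :: real)"
  shows "(\<integral>\<^sup>+v. \<integral>\<^sup>+w. ennreal ((a v + a w) / 2) \<partial>F \<partial>F) = (\<integral>\<^sup>+v. ennreal (a v) \<partial>F)"
proof -
  interpret F: prob_space F using prob_measuresD[OF F] by simp
  note prob_measuresD(2)[OF F, measurable_cong]
  have "(\<integral>\<^sup>+v. \<integral>\<^sup>+w. ennreal ((a v + a w) / 2) \<partial>F \<partial>F) = (\<integral>\<^sup>+v. \<integral>\<^sup>+w. ennreal (a v) / 2 + ennreal (a w) / 2 \<partial>F \<partial>F)"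
    by (intro nn_integral_cong) (simp add: nn add_divide_distrib divide_ennreal[symmetric])
  also have "\<dots> = (\<integral>\<^sup>+v. ennreal (a v) \<partial>F) / 2 + (\<integral>\<^sup>+v. ennreal (a v) \<partial>F) / 2"
    by (simp add: nn_integral_add nn_integral_divide F.emeasure_space_1)
  also have "\<dots> = (\<integral>\<^sup>+v. ennreal (a v) \<partial>F)"
    by (cases "\<integral>\<^sup>+v. ennreal (a v) \<partial>F") (simp_all add: ennreal_numeral[symmetric] divide_ennreal ennreal_plus[symmetric]
          ennreal_top_divide del: ennreal_numeral ennreal_plus)
  finally show ?thesis .
qed

definition sixth_moment :: "(real^3) measure \<Rightarrow> ennreal" where
  "sixth_moment F = (\<integral>\<^sup>+v. ennreal (norm v ^ 6) \<partial>F)"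

definition high_moment_tail :: "real \<Rightarrow> real \<Rightarrow> (real^3) measure \<Rightarrow> ennreal" where
  "high_moment_tail \<gamma> R F = (\<integral>\<^sup>+v. ennreal (norm v powr (2 + \<gamma>) * indicator {v. R \<le> (norm v)\<^sup>2} v) \<partial>F)"

lemma sixth_moment_collision_step:
  assumes F: "F \<in> prob_measures" and \<gamma>: "0 < \<gamma>" "\<gamma> \<le> 1" and h: "0 \<le> h"
  shows "sixth_moment (collision_step \<gamma> h F)
    \<le> sixth_moment F + ennreal (12 * h) * (moment 2 F * moment 2 F + 6 * (sixth_moment F * moment 2 F))"
proof -
  have "sixth_moment (collision_step \<gamma> h F)
    = (\<integral>\<^sup>+v. \<integral>\<^sup>+w. ennreal ((\<Sum>j\<in>UNIV. norm (post \<gamma> h j v w) ^ 6 + norm (post \<gamma> h j w v) ^ 6) / 12) \<partial>F \<partial>F)"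
    unfolding sixth_moment_def by (rule nn_integral_collision_step[OF F]) auto
  also have "\<dots> \<le> (\<integral>\<^sup>+v. \<integral>\<^sup>+w. ennreal ((norm v ^ 6 + norm w ^ 6) / 2
      + 12 * h * ((norm v)\<^sup>2 * (norm w)\<^sup>2 + 3 * (norm v ^ 6 * (norm w)\<^sup>2 + (norm v)\<^sup>2 * norm w ^ 6))) \<partial>F \<partial>F)"
    by (intro nn_integral_mono ennreal_leI order_trans[OF collision_sixth_moment]) (use \<gamma> h in \<open>auto simp: mult_ac\<close>)
  also have "\<dots> = sixth_moment F + ennreal (12 * h) * (moment 2 F * moment 2 F
      + ennreal 3 * (sixth_moment F * moment 2 F + moment 2 F * sixth_moment F))"
  proof -
    have "(\<integral>\<^sup>+v. \<integral>\<^sup>+w. ennreal (norm v ^ 6 * (norm w)\<^sup>2 + (norm v)\<^sup>2 * norm w ^ 6) \<partial>F \<partial>F)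
      = (\<integral>\<^sup>+v. \<integral>\<^sup>+w. ennreal (norm v ^ 6 * (norm w)\<^sup>2) \<partial>F \<partial>F) + (\<integral>\<^sup>+v. \<integral>\<^sup>+w. ennreal ((norm v)\<^sup>2 * norm w ^ 6) \<partial>F \<partial>F)"
      by (rule pair_nn_integral_add[OF F]) auto
    also have "\<dots> = sixth_moment F * moment 2 F + moment 2 F * sixth_moment F"
      unfolding sixth_moment_def moment_2_eq by (intro arg_cong2[where f="(+)"] nn_integral_product[OF F]) auto
    finally have e1: "(\<integral>\<^sup>+v. \<integral>\<^sup>+w. ennreal (norm v ^ 6 * (norm w)\<^sup>2 + (norm v)\<^sup>2 * norm w ^ 6) \<partial>F \<partial>F)
      = sixth_moment F * moment 2 F + moment 2 F * sixth_moment F" .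
    have e2: "(\<integral>\<^sup>+v. \<integral>\<^sup>+w. ennreal (3 * (norm v ^ 6 * (norm w)\<^sup>2 + (norm v)\<^sup>2 * norm w ^ 6)) \<partial>F \<partial>F)
      = ennreal 3 * (sixth_moment F * moment 2 F + moment 2 F * sixth_moment F)"
      unfolding e1[symmetric] by (rule pair_nn_integral_cmult[OF F]) auto
    have "(\<integral>\<^sup>+v. \<integral>\<^sup>+w. ennreal ((norm v)\<^sup>2 * (norm w)\<^sup>2 + 3 * (norm v ^ 6 * (norm w)\<^sup>2 + (norm v)\<^sup>2 * norm w ^ 6)) \<partial>F \<partial>F)
      = (\<integral>\<^sup>+v. \<integral>\<^sup>+w. ennreal ((norm v)\<^sup>2 * (norm w)\<^sup>2) \<partial>F \<partial>F) + ennreal 3 * (sixth_moment F * moment 2 F + moment 2 F * sixth_moment F)"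
      unfolding e2[symmetric] by (rule pair_nn_integral_add[OF F]) auto
    also have "(\<integral>\<^sup>+v. \<integral>\<^sup>+w. ennreal ((norm v)\<^sup>2 * (norm w)\<^sup>2) \<partial>F \<partial>F) = moment 2 F * moment 2 F"
      unfolding moment_2_eq by (rule nn_integral_product[OF F]) auto
    finally have e3: "(\<integral>\<^sup>+v. \<integral>\<^sup>+w. ennreal (12 * h * ((norm v)\<^sup>2 * (norm w)\<^sup>2 + 3 * (norm v ^ 6 * (norm w)\<^sup>2 + (norm v)\<^sup>2 * norm w ^ 6))) \<partial>F \<partial>F)
      = ennreal (12 * h) * (moment 2 F * moment 2 F + ennreal 3 * (sixth_moment F * moment 2 F + moment 2 F * sixth_moment F))"
      by (subst pair_nn_integral_cmult[OF F]) (use h in auto)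
    have e4: "(\<integral>\<^sup>+v. \<integral>\<^sup>+w. ennreal ((norm v ^ 6 + norm w ^ 6) / 2) \<partial>F \<partial>F) = sixth_moment F"
      unfolding sixth_moment_def by (rule pair_nn_integral_average[OF F]) auto
    show ?thesis unfolding e3[symmetric]
      by (subst pair_nn_integral_add[OF F]) (use h in \<open>auto simp: e4\<close>)
  qed
  also have "ennreal 3 * (sixth_moment F * moment 2 F + moment 2 F * sixth_moment F) = 6 * (sixth_moment F * moment 2 F)"
  proof -
    have "ennreal 3 * (a + a) = 6 * a" for a
      by (simp add: mult_2[symmetric] mult.assoc[symmetric])
    then show ?thesis by (simp only: mult.commute[of "moment 2 F"])
  qed
  finally show ?thesis .
qed

section \<open>Dissipation of the tail energy of a measure\<close>

lemma tail_energy_nonneg: "0 \<le> R \<Longrightarrow> 0 \<le> tail_energy R v"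
  by (simp add: tail_energy_def)

lemma tail_energy_measurable[measurable]: "tail_energy R \<in> borel_measurable borel"
  unfolding tail_energy_def[abs_def] by measurable

text \<open>Markov's inequality. Dissipation needs a fast particle to meet a slow one, and this
  supplies the slow ones; the summand 1 keeps the level positive when E0 = 0.\<close>

lemma slow_mass_ge_half:
  assumes F: "F \<in> prob_measures" and m2: "moment 2 F \<le> ennreal E0" and E0: "0 \<le> E0"
  shows "1 / 2 \<le> emeasure F {w. (norm w)\<^sup>2 \<le> 2 * E0 + 1}"
proof -
  interpret F: prob_space F using prob_measuresD[OF F] by simp
  note prob_measuresD(2)[OF F, measurable_cong, simp] prob_measuresD(3)[OF F, simp]
  note m = moment_2_real[OF F m2 E0]
  have "measure F {w. 2 * E0 + 1 \<le> (norm w)\<^sup>2} \<le> (\<integral>w. (norm w)\<^sup>2 \<partial>F) / (2 * E0 + 1)"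
    using integral_Markov_inequality_measure[OF m(1), of "{}" "2 * E0 + 1"] E0 by simp
  also have "\<dots> \<le> E0 / (2 * E0 + 1)" using m(2) E0 by (intro divide_right_mono) auto
  also have "\<dots> \<le> 1 / 2" using E0 by (simp add: field_simps)
  finally have 1: "measure F {w. 2 * E0 + 1 \<le> (norm w)\<^sup>2} \<le> 1 / 2" .
  have "{w. (norm w)\<^sup>2 \<le> 2 * E0 + 1} \<union> {w. 2 * E0 + 1 \<le> (norm w)\<^sup>2} = (UNIV :: (real^3) set)" by auto
  then have "1 = measure F ({w. (norm w)\<^sup>2 \<le> 2 * E0 + 1} \<union> {w. 2 * E0 + 1 \<le> (norm w)\<^sup>2})"
    using F.prob_space by simp
  also have "\<dots> \<le> measure F {w. (norm w)\<^sup>2 \<le> 2 * E0 + 1} + measure F {w. 2 * E0 + 1 \<le> (norm w)\<^sup>2}"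
    by (intro measure_Un_le) auto
  finally have "1 / 2 \<le> measure F {w. (norm w)\<^sup>2 \<le> 2 * E0 + 1}" using 1 by linarith
  then show ?thesis
    unfolding F.emeasure_eq_measure using divide_ennreal[of 1 2] by (metis ennreal_1 ennreal_leI ennreal_numeral zero_le_one zero_le_numeral zero_less_numeral)
qed

text \<open>The pair inequality, integrated: 25 becomes 50 because at least half of the partners are
  slow, and 48 becomes 96 by symmetry. The gain carries E0 / R and can therefore be absorbed for
  large R.\<close>

lemma tail_energy_collision_step:
  assumes F: "F \<in> prob_measures" and \<gamma>: "0 < \<gamma>" "\<gamma> \<le> 1" and h: "0 \<le> h"
    and m2: "moment 2 F \<le> ennreal E0" and E0: "0 \<le> E0" and R: "4 * (2 * E0 + 1) \<le> R"
  shows "(\<integral>\<^sup>+v. ennreal (tail_energy R v) \<partial>collision_step \<gamma> h F) + ennreal (h / 50) * high_moment_tail \<gamma> R F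
    \<le> (\<integral>\<^sup>+v. ennreal (tail_energy R v) \<partial>F) + ennreal (96 * h / R * E0) * moment (2 + \<gamma>) F
      + ennreal (36 * h\<^sup>2) * (6 + 10 * sixth_moment F)"
proof -
  interpret F: prob_space F using prob_measuresD[OF F] by simp
  note prob_measuresD(2)[OF F, measurable_cong]
  have R1: "1 \<le> R" using R E0 by simp
  define \<rho> where "\<rho> = 2 * E0 + 1"
  define T :: "real^3 \<Rightarrow> real" where "T = (\<lambda>v. norm v powr (2 + \<gamma>) * indicator {v. R \<le> (norm v)\<^sup>2} v)"
  define P where "P v w = (\<Sum>j\<in>UNIV. tail_energy R (post \<gamma> h j v w) + tail_energy R (post \<gamma> h j w v)) / 12" for v w
  define I :: "real^3 \<Rightarrow> real" where "I = indicator {w. (norm w)\<^sup>2 \<le> \<rho>}"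
  have T[measurable]: "T \<in> borel_measurable borel" unfolding T_def by measurable
  have Tn: "\<And>v. 0 \<le> T v" unfolding T_def by simp
  have I[measurable]: "I \<in> borel_measurable borel" unfolding I_def by measurable
  have In: "\<And>v. 0 \<le> I v" unfolding I_def by simp
  have P[measurable]: "(\<lambda>(v, w). P v w) \<in> borel_measurable (borel \<Otimes>\<^sub>M borel)"
  proof -
    have "(\<lambda>(v, w). post \<gamma> h j w v) \<in> borel_measurable (borel \<Otimes>\<^sub>M borel)" for j
      using measurable_compose[OF measurable_pair_swap' post_measurable] by (simp add: case_prod_unfold)
    note this[measurable]
    show ?thesis unfolding P_def by measurable
  qed
  have Pn: "0 \<le> P v w" for v w
    unfolding P_def using R1 by (intro divide_nonneg_nonneg sum_nonneg add_nonneg_nonneg tail_energy_nonneg) auto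
  have "(\<integral>\<^sup>+v. ennreal (tail_energy R v) \<partial>collision_step \<gamma> h F) + ennreal (h / 25) * (high_moment_tail \<gamma> R F * emeasure F {w. (norm w)\<^sup>2 \<le> \<rho>})
    = (\<integral>\<^sup>+v. \<integral>\<^sup>+w. ennreal (P v w + h / 25 * (T v * I w)) \<partial>F \<partial>F)"
  proof -
    have "(\<integral>\<^sup>+w. ennreal (I w) \<partial>F) = emeasure F {w. (norm w)\<^sup>2 \<le> \<rho>}"
      unfolding I_def by (simp add: ennreal_indicator)
    moreover have "(\<integral>\<^sup>+v. ennreal (tail_energy R v) \<partial>collision_step \<gamma> h F) = (\<integral>\<^sup>+v. \<integral>\<^sup>+w. ennreal (P v w) \<partial>F \<partial>F)"
      unfolding P_def using R1 by (intro nn_integral_collision_step[OF F] tail_energy_nonneg) auto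
    moreover have "(\<integral>\<^sup>+v. \<integral>\<^sup>+w. ennreal (P v w + h / 25 * (T v * I w)) \<partial>F \<partial>F)
      = (\<integral>\<^sup>+v. \<integral>\<^sup>+w. ennreal (P v w) \<partial>F \<partial>F) + ennreal (h / 25) * ((\<integral>\<^sup>+v. ennreal (T v) \<partial>F) * (\<integral>\<^sup>+w. ennreal (I w) \<partial>F))"
    proof -
      have "(\<integral>\<^sup>+v. \<integral>\<^sup>+w. ennreal (h / 25 * (T v * I w)) \<partial>F \<partial>F) = ennreal (h / 25) * (\<integral>\<^sup>+v. \<integral>\<^sup>+w. ennreal (T v * I w) \<partial>F \<partial>F)"
        by (rule pair_nn_integral_cmult[OF F]) (use h Tn In in auto)
      also have "(\<integral>\<^sup>+v. \<integral>\<^sup>+w. ennreal (T v * I w) \<partial>F \<partial>F) = (\<integral>\<^sup>+v. ennreal (T v) \<partial>F) * (\<integral>\<^sup>+w. ennreal (I w) \<partial>F)"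
        by (rule nn_integral_product[OF F T I Tn In])
      finally show ?thesis
        by (subst pair_nn_integral_add[OF F P]) (use h Tn In Pn in auto)
    qed
    ultimately show ?thesis by (simp add: high_moment_tail_def T_def)
  qed
  also have "\<dots> \<le> (\<integral>\<^sup>+v. \<integral>\<^sup>+w. ennreal ((tail_energy R v + tail_energy R w) / 2
      + (48 * h / R * (norm v powr (2 + \<gamma>) * (norm w)\<^sup>2 + (norm v)\<^sup>2 * norm w powr (2 + \<gamma>))
      + 36 * h\<^sup>2 * (6 + 10 * ((norm v ^ 6 + norm w ^ 6) / 2)))) \<partial>F \<partial>F)"
    using collision_tail_energy[OF \<gamma> h R1 R]
    by (intro nn_integral_mono ennreal_leI) (simp add: P_def T_def I_def \<rho>_def mult_ac add.assoc add_divide_distrib)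
  also have "\<dots> = (\<integral>\<^sup>+v. ennreal (tail_energy R v) \<partial>F)
      + (ennreal (48 * h / R) * (moment (2 + \<gamma>) F * moment 2 F + moment 2 F * moment (2 + \<gamma>) F)
      + ennreal (36 * h\<^sup>2) * (6 + ennreal 10 * sixth_moment F))"
  proof -
    have "(\<integral>\<^sup>+v. \<integral>\<^sup>+w. ennreal (norm v powr (2 + \<gamma>) * (norm w)\<^sup>2 + (norm v)\<^sup>2 * norm w powr (2 + \<gamma>)) \<partial>F \<partial>F)
      = (\<integral>\<^sup>+v. \<integral>\<^sup>+w. ennreal (norm v powr (2 + \<gamma>) * (norm w)\<^sup>2) \<partial>F \<partial>F) + (\<integral>\<^sup>+v. \<integral>\<^sup>+w. ennreal ((norm v)\<^sup>2 * norm w powr (2 + \<gamma>)) \<partial>F \<partial>F)"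
      by (rule pair_nn_integral_add[OF F]) auto
    also have "\<dots> = moment (2 + \<gamma>) F * moment 2 F + moment 2 F * moment (2 + \<gamma>) F"
      unfolding moment_2_eq moment_def[of "2 + \<gamma>"] by (intro arg_cong2[where f="(+)"] nn_integral_product[OF F]) auto
    finally have "(\<integral>\<^sup>+v. \<integral>\<^sup>+w. ennreal (48 * h / R * (norm v powr (2 + \<gamma>) * (norm w)\<^sup>2 + (norm v)\<^sup>2 * norm w powr (2 + \<gamma>))) \<partial>F \<partial>F)
      = ennreal (48 * h / R) * (moment (2 + \<gamma>) F * moment 2 F + moment 2 F * moment (2 + \<gamma>) F)"
      by (subst pair_nn_integral_cmult[OF F]) (use h R1 in auto)
    note e1 = this[symmetric]
    have e2: "(\<integral>\<^sup>+v. \<integral>\<^sup>+w. ennreal ((norm v ^ 6 + norm w ^ 6) / 2) \<partial>F \<partial>F) = sixth_moment F"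
      unfolding sixth_moment_def by (rule pair_nn_integral_average[OF F]) auto
    have "(\<integral>\<^sup>+v. \<integral>\<^sup>+w. ennreal (10 * ((norm v ^ 6 + norm w ^ 6) / 2)) \<partial>F \<partial>F) = ennreal 10 * sixth_moment F"
      unfolding e2[symmetric] by (rule pair_nn_integral_cmult[OF F]) auto
    then have "(\<integral>\<^sup>+v. \<integral>\<^sup>+w. ennreal (6 + 10 * ((norm v ^ 6 + norm w ^ 6) / 2)) \<partial>F \<partial>F) = 6 + ennreal 10 * sixth_moment F"
      by (subst pair_nn_integral_add[OF F]) (auto simp: F.emeasure_space_1)
    then have "(\<integral>\<^sup>+v. \<integral>\<^sup>+w. ennreal (36 * h\<^sup>2 * (6 + 10 * ((norm v ^ 6 + norm w ^ 6) / 2))) \<partial>F \<partial>F) = ennreal (36 * h\<^sup>2) * (6 + ennreal 10 * sixth_moment F)"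
      by (subst pair_nn_integral_cmult[OF F]) auto
    note e3 = this[symmetric]
    have e4: "(\<integral>\<^sup>+v. ennreal (tail_energy R v) \<partial>F) = (\<integral>\<^sup>+v. \<integral>\<^sup>+w. ennreal ((tail_energy R v + tail_energy R w) / 2) \<partial>F \<partial>F)"
      using R1 by (intro pair_nn_integral_average[OF F, symmetric] tail_energy_nonneg) auto
    have nn: "0 \<le> 48 * h / R * (norm v powr (2 + \<gamma>) * (norm w)\<^sup>2 + (norm v)\<^sup>2 * norm w powr (2 + \<gamma>))"
      "0 \<le> 36 * h\<^sup>2 * (6 + 10 * ((norm v ^ 6 + norm w ^ 6) / 2))" "0 \<le> (tail_energy R v + tail_energy R w) / 2" for v w :: "real^3"
      using h R1 by (auto intro!: add_nonneg_nonneg tail_energy_nonneg)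
    have "(\<integral>\<^sup>+v. \<integral>\<^sup>+w. ennreal (48 * h / R * (norm v powr (2 + \<gamma>) * (norm w)\<^sup>2 + (norm v)\<^sup>2 * norm w powr (2 + \<gamma>))
      + 36 * h\<^sup>2 * (6 + 10 * ((norm v ^ 6 + norm w ^ 6) / 2))) \<partial>F \<partial>F)
      = ennreal (48 * h / R) * (moment (2 + \<gamma>) F * moment 2 F + moment 2 F * moment (2 + \<gamma>) F)
      + ennreal (36 * h\<^sup>2) * (6 + ennreal 10 * sixth_moment F)"
      unfolding e1 e3 by (rule pair_nn_integral_add[OF F _ _ nn(1,2)]) measurable
    note e5 = this[symmetric]
    show ?thesis unfolding e4 e5
      by (rule pair_nn_integral_add[OF F _ _ nn(3) add_nonneg_nonneg[OF nn(1,2)]]) measurable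
  qed
  also have "moment (2 + \<gamma>) F * moment 2 F + moment 2 F * moment (2 + \<gamma>) F = 2 * (moment 2 F * moment (2 + \<gamma>) F)"
    by (simp add: mult_2 mult.commute)
  also have "ennreal (48 * h / R) * (2 * (moment 2 F * moment (2 + \<gamma>) F)) \<le> ennreal (48 * h / R) * (2 * (ennreal E0 * moment (2 + \<gamma>) F))"
    using m2 by (intro mult_left_mono mult_right_mono) auto
  also have "ennreal (48 * h / R) * (2 * (ennreal E0 * moment (2 + \<gamma>) F)) = ennreal (96 * h / R * E0) * moment (2 + \<gamma>) F"
  proof -
    have "ennreal (48 * h / R) * (2 * (ennreal E0 * x)) = ennreal (48 * h / R) * (ennreal 2 * ennreal E0) * x" for x
      by (simp add: mult_ac)
    also have "ennreal (48 * h / R) * (ennreal 2 * ennreal E0) = ennreal (96 * h / R * E0)"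
      using h R1 E0 by (simp add: ennreal_mult[symmetric] del: ennreal_numeral)
    finally show ?thesis .
  qed
  finally have main: "(\<integral>\<^sup>+v. ennreal (tail_energy R v) \<partial>collision_step \<gamma> h F) + ennreal (h / 25) * (high_moment_tail \<gamma> R F * emeasure F {w. (norm w)\<^sup>2 \<le> \<rho>})
    \<le> (\<integral>\<^sup>+v. ennreal (tail_energy R v) \<partial>F) + (ennreal (96 * h / R * E0) * moment (2 + \<gamma>) F + ennreal (36 * h\<^sup>2) * (6 + ennreal 10 * sixth_moment F))"
    by (simp add: add_left_mono add_right_mono)
  have "ennreal (h / 50) * high_moment_tail \<gamma> R F = ennreal (h / 25) * (high_moment_tail \<gamma> R F * (1 / 2))"
  proof -
    have "(1 / 2 :: ennreal) = ennreal (1 / 2)" using divide_ennreal[of 1 2] by simp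
    then have "ennreal (h / 25) * (high_moment_tail \<gamma> R F * (1 / 2)) = (ennreal (h / 25) * ennreal (1 / 2)) * high_moment_tail \<gamma> R F"
      by (simp only: mult_ac)
    also have "ennreal (h / 25) * ennreal (1 / 2) = ennreal (h / 50)" using h by (subst ennreal_mult[symmetric]) auto
    finally show ?thesis by simp
  qed
  also have "\<dots> \<le> ennreal (h / 25) * (high_moment_tail \<gamma> R F * emeasure F {w. (norm w)\<^sup>2 \<le> \<rho>})"
    using slow_mass_ge_half[OF F m2 E0] by (intro mult_left_mono) (auto simp: \<rho>_def)
  finally have "(\<integral>\<^sup>+v. ennreal (tail_energy R v) \<partial>collision_step \<gamma> h F) + ennreal (h / 50) * high_moment_tail \<gamma> R F
    \<le> (\<integral>\<^sup>+v. ennreal (tail_energy R v) \<partial>collision_step \<gamma> h F) + ennreal (h / 25) * (high_moment_tail \<gamma> R F * emeasure F {w. (norm w)\<^sup>2 \<le> \<rho>})"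
    by (rule add_left_mono)
  also note main
  finally show ?thesis by (simp add: add.assoc)
qed

text \<open>Discrete Gronwall argument: the energy is constant along the iterates, so the sixth
  moment grows at most exponentially in the elapsed time h k, at a rate depending on E0
  only.\<close>

lemma collision_iterates:
  assumes F0: "F0 \<in> prob_measures" and \<gamma>: "0 < \<gamma>" "\<gamma> \<le> 1" and h: "0 \<le> h"
    and m2: "moment 2 F0 \<le> ennreal E0" and E0: "0 \<le> E0" and M: "sixth_moment F0 \<le> ennreal M" "0 \<le> M"
  shows "(collision_step \<gamma> h ^^ k) F0 \<in> prob_measures" "moment 2 ((collision_step \<gamma> h ^^ k) F0) = moment 2 F0"
    "sixth_moment ((collision_step \<gamma> h ^^ k) F0) \<le> ennreal ((M + E0) * exp (72 * E0 * (h * real k)))"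
proof -
  define F where "F k = (collision_step \<gamma> h ^^ k) F0" for k
  have F_Suc: "F (Suc k) = collision_step \<gamma> h (F k)" for k by (simp add: F_def)
  have prob: "F k \<in> prob_measures" for k
    by (induction k) (auto simp: F_Suc collision_step_prob, simp add: F_def F0)
  have m2k: "moment 2 (F k) = moment 2 F0" for k
    by (induction k) (auto simp: F_Suc moment_2_collision_step[OF prob h], simp add: F_def)
  \<comment> \<open>Shifting by E0 turns the affine recursion into a geometric one, as 12 h (E0^2 +
    6 c E0) is at most 72 h E0 (c + E0). Nonnegativity is carried along because
    \<open>ennreal\<close> sends negative numbers to 0.\<close>
  have "sixth_moment (F k) \<le> ennreal ((M + E0) * (1 + 72 * h * E0) ^ k - E0)
    \<and> 0 \<le> (M + E0) * (1 + 72 * h * E0) ^ k - E0" for k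
  proof (induction k)
    case 0
    then show ?case using M E0 by (simp add: F_def)
  next
    case (Suc k)
    define c where "c = (M + E0) * (1 + 72 * h * E0) ^ k - E0"
    have c: "sixth_moment (F k) \<le> ennreal c" "0 \<le> c" using Suc by (auto simp: c_def)
    have "sixth_moment (F (Suc k)) \<le> sixth_moment (F k)
      + ennreal (12 * h) * (moment 2 (F k) * moment 2 (F k) + 6 * (sixth_moment (F k) * moment 2 (F k)))"
      unfolding F_Suc by (rule sixth_moment_collision_step[OF prob \<gamma> h])
    also have "\<dots> \<le> ennreal c + ennreal (12 * h) * (ennreal E0 * ennreal E0 + ennreal 6 * (ennreal c * ennreal E0))"
      unfolding m2k using c m2 by (intro add_mono mult_left_mono mult_mono) auto
    also have "\<dots> = ennreal (c + 12 * h * (E0 * E0 + 6 * (c * E0)))"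
      using c E0 h by (simp add: ennreal_mult[symmetric] ennreal_plus[symmetric] del: ennreal_plus ennreal_numeral)
    also have "\<dots> \<le> ennreal ((c + E0) * (1 + 72 * h * E0) - E0)"
    proof (rule ennreal_leI)
      have "0 \<le> h * (E0 * E0)" using h E0 by simp
      then show "c + 12 * h * (E0 * E0 + 6 * (c * E0)) \<le> (c + E0) * (1 + 72 * h * E0) - E0"
        by (simp add: algebra_simps)
    qed
    also have "(c + E0) * (1 + 72 * h * E0) - E0 = (M + E0) * (1 + 72 * h * E0) ^ Suc k - E0"
      by (simp add: c_def)
    finally have 1: "sixth_moment (F (Suc k)) \<le> ennreal ((M + E0) * (1 + 72 * h * E0) ^ Suc k - E0)" .
    have "(c + E0) * 1 \<le> (c + E0) * (1 + 72 * h * E0)" using c E0 h by (intro mult_left_mono) auto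
    then have "0 \<le> (M + E0) * (1 + 72 * h * E0) ^ Suc k - E0" using c by (simp add: c_def mult_ac)
    with 1 show ?case by blast
  qed
  moreover have "(M + E0) * (1 + 72 * h * E0) ^ k - E0 \<le> (M + E0) * exp (72 * E0 * (h * real k))"
  proof -
    have "(1 + 72 * h * E0) ^ k \<le> exp (72 * h * E0) ^ k"
      using h E0 exp_ge_add_one_self by (intro power_mono) auto
    also have "\<dots> = exp (72 * E0 * (h * real k))" by (simp add: exp_of_nat_mult[symmetric] mult_ac)
    finally have "(M + E0) * (1 + 72 * h * E0) ^ k \<le> (M + E0) * exp (72 * E0 * (h * real k))"
      using M E0 by (intro mult_left_mono) auto
    then show ?thesis using E0 by simp
  qed
  ultimately show "sixth_moment ((collision_step \<gamma> h ^^ k) F0) \<le> ennreal ((M + E0) * exp (72 * E0 * (h * real k)))"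
    unfolding F_def[symmetric] by (meson ennreal_leI order_trans)
  show "(collision_step \<gamma> h ^^ k) F0 \<in> prob_measures" "moment 2 ((collision_step \<gamma> h ^^ k) F0) = moment 2 F0"
    using prob m2k unfolding F_def by auto
qed

section \<open>Comparison of moments and tails\<close>

lemma moment_le_sixth_moment:
  assumes F: "F \<in> prob_measures" and \<gamma>: "0 < \<gamma>" "\<gamma> \<le> 1"
  shows "moment (2 + \<gamma>) F \<le> 1 + sixth_moment F"
proof -
  interpret F: prob_space F using prob_measuresD[OF F] by simp
  note prob_measuresD(2)[OF F, measurable_cong]
  have "norm v powr (2 + \<gamma>) \<le> 1 + norm v ^ 6" for v :: "real^3"
  proof (cases "norm v \<le> 1")
    case True
    then have "norm v powr (2 + \<gamma>) \<le> 1" using \<gamma> by (intro powr_le1) auto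
    then show ?thesis by (simp add: add_increasing2)
  next
    case False
    then have "norm v powr (2 + \<gamma>) \<le> norm v powr 6" using \<gamma> by (intro powr_mono) auto
    then show ?thesis using False by (simp add: powr_numeral)
  qed
  then have "moment (2 + \<gamma>) F \<le> (\<integral>\<^sup>+v. ennreal (1 + norm v ^ 6) \<partial>F)"
    unfolding moment_def by (intro nn_integral_mono ennreal_leI)
  also have "\<dots> = 1 + sixth_moment F"
    unfolding sixth_moment_def by (simp add: nn_integral_add F.emeasure_space_1)
  finally show ?thesis .
qed

lemma moment_le_high_moment_tail:
  assumes F: "F \<in> prob_measures" and \<gamma>: "0 < \<gamma>" "\<gamma> \<le> 1" and R: "1 \<le> R"
  shows "moment (2 + \<gamma>) F \<le> ennreal (R ^ 3) + high_moment_tail \<gamma> R F" "high_moment_tail \<gamma> R F \<le> moment (2 + \<gamma>) F"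
proof -
  interpret F: prob_space F using prob_measuresD[OF F] by simp
  note prob_measuresD(2)[OF F, measurable_cong]
  have pt: "norm v powr (2 + \<gamma>) \<le> R ^ 3 + norm v powr (2 + \<gamma>) * indicator {v. R \<le> (norm v)\<^sup>2} v" for v :: "real^3"
  proof (cases "R \<le> (norm v)\<^sup>2")
    case False
    have "norm v \<le> R"
    proof (rule ccontr)
      assume "\<not> norm v \<le> R"
      then have "R * 1 \<le> norm v * norm v" using R by (intro mult_mono) auto
      with False show False by (simp add: power2_eq_square)
    qed
    then have "norm v powr (2 + \<gamma>) \<le> R powr (2 + \<gamma>)" using \<gamma> by (intro powr_mono2) auto
    also have "\<dots> \<le> R powr 3" using R \<gamma> by (intro powr_mono) auto
    also have "\<dots> = R ^ 3" using R by (simp add: powr_numeral)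
    finally show ?thesis using False by simp
  qed (use R in auto)
  then have "moment (2 + \<gamma>) F \<le> (\<integral>\<^sup>+v. ennreal (R ^ 3 + norm v powr (2 + \<gamma>) * indicator {v. R \<le> (norm v)\<^sup>2} v) \<partial>F)"
    unfolding moment_def by (intro nn_integral_mono ennreal_leI)
  also have "\<dots> = (\<integral>\<^sup>+v. ennreal (R ^ 3) + ennreal (norm v powr (2 + \<gamma>) * indicator {v. R \<le> (norm v)\<^sup>2} v) \<partial>F)"
    using R by (intro nn_integral_cong ennreal_plus) auto
  also have "\<dots> = ennreal (R ^ 3) + high_moment_tail \<gamma> R F"
    unfolding high_moment_tail_def by (subst nn_integral_add) (auto simp: F.emeasure_space_1)
  finally show "moment (2 + \<gamma>) F \<le> ennreal (R ^ 3) + high_moment_tail \<gamma> R F" .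
  show "high_moment_tail \<gamma> R F \<le> moment (2 + \<gamma>) F"
    unfolding high_moment_tail_def moment_def by (intro nn_integral_mono ennreal_leI) (auto simp: indicator_def)
qed

lemma high_moments_real:
  assumes \<mu>: "\<mu> \<in> prob_measures" and m: "moment (2 + \<gamma>) \<mu> < \<infinity>" and \<gamma>: "0 < \<gamma>" "\<gamma> \<le> 1" and R: "1 \<le> R"
  shows "integrable \<mu> (\<lambda>v. norm v powr (2 + \<gamma>))" "(\<integral>v. norm v powr (2 + \<gamma>) \<partial>\<mu>) = enn2real (moment (2 + \<gamma>) \<mu>)"
    "integrable \<mu> (\<lambda>v. norm v powr (2 + \<gamma>) * indicator {v. R \<le> (norm v)\<^sup>2} v)"
    "(\<integral>v. norm v powr (2 + \<gamma>) * indicator {v. R \<le> (norm v)\<^sup>2} v \<partial>\<mu>) = enn2real (high_moment_tail \<gamma> R \<mu>)"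
    "enn2real (moment (2 + \<gamma>) \<mu>) \<le> R ^ 3 + enn2real (high_moment_tail \<gamma> R \<mu>)"
proof -
  note prob_measuresD(2)[OF \<mu>, measurable_cong]
  note t = moment_le_high_moment_tail[OF \<mu> \<gamma> R]
  have ht: "high_moment_tail \<gamma> R \<mu> < \<infinity>" using t(2) m by (rule le_less_trans)
  show "integrable \<mu> (\<lambda>v. norm v powr (2 + \<gamma>))"
    by (rule integrableI_nonneg) (use m in \<open>auto simp: moment_def\<close>)
  show "(\<integral>v. norm v powr (2 + \<gamma>) \<partial>\<mu>) = enn2real (moment (2 + \<gamma>) \<mu>)"
    unfolding moment_def by (rule integral_eq_nn_integral) auto
  show "integrable \<mu> (\<lambda>v. norm v powr (2 + \<gamma>) * indicator {v. R \<le> (norm v)\<^sup>2} v)"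
  proof (rule integrableI_nonneg)
    show "(\<lambda>v. norm v powr (2 + \<gamma>) * indicator {v. R \<le> (norm v)\<^sup>2} v) \<in> borel_measurable \<mu>" by measurable
  qed (use ht in \<open>auto simp: high_moment_tail_def\<close>)
  show "(\<integral>v. norm v powr (2 + \<gamma>) * indicator {v. R \<le> (norm v)\<^sup>2} v \<partial>\<mu>) = enn2real (high_moment_tail \<gamma> R \<mu>)"
    unfolding high_moment_tail_def
  proof (rule integral_eq_nn_integral)
    show "(\<lambda>v. norm v powr (2 + \<gamma>) * indicator {v. R \<le> (norm v)\<^sup>2} v) \<in> borel_measurable \<mu>" by measurable
  qed auto
  obtain u where u: "high_moment_tail \<gamma> R \<mu> = ennreal u" "0 \<le> u" using ht by (cases "high_moment_tail \<gamma> R \<mu>") auto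
  obtain z where z: "moment (2 + \<gamma>) \<mu> = ennreal z" "0 \<le> z" using m by (cases "moment (2 + \<gamma>) \<mu>") auto
  have "ennreal z \<le> ennreal (R ^ 3 + u)" using t(1) u z R by simp
  moreover have "0 \<le> R ^ 3 + u" using u R by simp
  ultimately have "z \<le> R ^ 3 + u" by (simp only: ennreal_le_iff)
  then show "enn2real (moment (2 + \<gamma>) \<mu>) \<le> R ^ 3 + enn2real (high_moment_tail \<gamma> R \<mu>)" using u z by simp
qed

lemma tail_energy_le: "0 < R \<Longrightarrow> tail_energy R v \<le> (norm v)\<^sup>2"
proof -
  assume R: "0 < R"
  have "((norm v)\<^sup>2)\<^sup>2 \<le> (norm v)\<^sup>2 * (R + (norm v)\<^sup>2)" using R by (simp add: power2_eq_square algebra_simps)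
  moreover have "0 < R + (norm v)\<^sup>2" using R by (simp add: add_pos_nonneg)
  ultimately show ?thesis by (simp add: tail_energy_def pos_divide_le_eq)
qed

text \<open>Dominated convergence with the energy density as majorant. The smallness of the initial
  tail energy is what replaces a higher moment of the datum.\<close>

lemma tail_energy_integral_tendsto_0:
  assumes F: "F \<in> prob_measures" and m2: "moment 2 F < \<infinity>"
  shows "(\<lambda>n. \<integral>\<^sup>+v. ennreal (tail_energy (real (Suc n)) v) \<partial>F) \<longlonglongrightarrow> 0"
proof -
  note prob_measuresD(2)[OF F, measurable_cong]
  have "(\<lambda>n. \<integral>\<^sup>+v. ennreal (tail_energy (real (Suc n)) v) \<partial>F) \<longlonglongrightarrow> (\<integral>\<^sup>+v. 0 \<partial>F)"
  proof (rule nn_integral_dominated_convergence[where w="\<lambda>v. ennreal ((norm v)\<^sup>2)"])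
    show "(\<integral>\<^sup>+v. ennreal ((norm v)\<^sup>2) \<partial>F) < \<infinity>" using m2 by (simp add: moment_2_eq)
    show "AE v in F. (\<lambda>n. ennreal (tail_energy (real (Suc n)) v)) \<longlonglongrightarrow> 0"
    proof (intro AE_I2)
      fix v :: "real^3"
      have "filterlim (\<lambda>n. (norm v)\<^sup>2 + real (Suc n)) at_top sequentially"
        by (rule filterlim_tendsto_add_at_top[OF tendsto_const filterlim_compose[OF filterlim_real_sequentially filterlim_Suc]])
      then have "filterlim (\<lambda>n. real (Suc n) + (norm v)\<^sup>2) at_top sequentially" by (simp only: add.commute)
      then have "(\<lambda>n. ((norm v)\<^sup>2)\<^sup>2 / (real (Suc n) + (norm v)\<^sup>2)) \<longlonglongrightarrow> 0"
        by (intro real_tendsto_divide_at_top[OF tendsto_const])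
      then show "(\<lambda>n. ennreal (tail_energy (real (Suc n)) v)) \<longlonglongrightarrow> 0"
        unfolding tail_energy_def using tendsto_ennrealI[of _ 0] by (simp only: ennreal_0)
    qed
    show "AE v in F. ennreal (tail_energy (real (Suc n)) v) \<le> ennreal ((norm v)\<^sup>2)" for n
      by (intro AE_I2 ennreal_leI tail_energy_le) simp
  qed auto
  then show ?thesis by simp
qed

section \<open>The discrete scheme and its uniform integrability\<close>

lemma collision_step_dissipation_real:
  assumes F: "F \<in> prob_measures" and \<gamma>: "0 < \<gamma>" "\<gamma> \<le> 1" and h: "0 \<le> h"
    and m2: "moment 2 F \<le> ennreal E0" and E0: "0 \<le> E0" and R: "4 * (2 * E0 + 1) \<le> R"
    and m6: "sixth_moment F \<le> ennreal c" "0 \<le> c"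
  shows "enn2real (\<integral>\<^sup>+v. ennreal (tail_energy R v) \<partial>collision_step \<gamma> h F) + h / 50 * enn2real (high_moment_tail \<gamma> R F)
    \<le> enn2real (\<integral>\<^sup>+v. ennreal (tail_energy R v) \<partial>F) + 96 * h / R * E0 * enn2real (moment (2 + \<gamma>) F) + 360 * h\<^sup>2 * (1 + c)"
proof -
  have R1: "1 \<le> R" using R E0 by simp
  have fin: "(\<integral>\<^sup>+v. ennreal (tail_energy R v) \<partial>G) < \<infinity>" if "moment 2 G \<le> ennreal E0" for G
  proof -
    have "(\<integral>\<^sup>+v. ennreal (tail_energy R v) \<partial>G) \<le> moment 2 G"
      unfolding moment_2_eq using R1 by (intro nn_integral_mono ennreal_leI tail_energy_le) auto
    also have "\<dots> \<le> ennreal E0" by (rule that)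
    finally show ?thesis by (metis ennreal_less_top infinity_ennreal_def le_less_trans)
  qed
  have m: "moment (2 + \<gamma>) F < \<infinity>"
  proof -
    have "moment (2 + \<gamma>) F \<le> 1 + ennreal c"
      using moment_le_sixth_moment[OF F \<gamma>] m6(1) by (meson add_left_mono order_trans)
    also have "\<dots> < \<infinity>" by (simp add: ennreal_add_less_top flip: ennreal_1)
    finally show ?thesis .
  qed
  have t: "high_moment_tail \<gamma> R F < \<infinity>" using moment_le_high_moment_tail(2)[OF F \<gamma> R1] m by (rule le_less_trans)
  obtain x where x: "(\<integral>\<^sup>+v. ennreal (tail_energy R v) \<partial>collision_step \<gamma> h F) = ennreal x" "0 \<le> x"
    using fin[of "collision_step \<gamma> h F"] m2 moment_2_collision_step[OF F h]
    by (cases "\<integral>\<^sup>+v. ennreal (tail_energy R v) \<partial>collision_step \<gamma> h F") auto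
  obtain y where y: "(\<integral>\<^sup>+v. ennreal (tail_energy R v) \<partial>F) = ennreal y" "0 \<le> y"
    using fin[of F] m2 by (cases "\<integral>\<^sup>+v. ennreal (tail_energy R v) \<partial>F") auto
  obtain z where z: "moment (2 + \<gamma>) F = ennreal z" "0 \<le> z" using m by (cases "moment (2 + \<gamma>) F") auto
  obtain u where u: "high_moment_tail \<gamma> R F = ennreal u" "0 \<le> u" using t by (cases "high_moment_tail \<gamma> R F") auto
  have "ennreal x + ennreal (h / 50) * ennreal u \<le> ennreal y + ennreal (96 * h / R * E0) * ennreal z + ennreal (36 * h\<^sup>2) * (6 + 10 * sixth_moment F)"
    using tail_energy_collision_step[OF F \<gamma> h m2 E0 R] unfolding x y z u .
  also have "\<dots> \<le> ennreal y + ennreal (96 * h / R * E0) * ennreal z + ennreal (36 * h\<^sup>2) * (ennreal 6 + ennreal 10 * ennreal c)"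
    using m6(1) by (intro add_left_mono mult_left_mono) (auto intro!: mult_left_mono)
  also have "\<dots> = ennreal (y + 96 * h / R * E0 * z + 36 * h\<^sup>2 * (6 + 10 * c))"
    using y z h R1 E0 m6(2) by (simp add: ennreal_mult[symmetric] ennreal_plus[symmetric] del: ennreal_plus ennreal_numeral)
  finally have "ennreal (x + h / 50 * u) \<le> ennreal (y + 96 * h / R * E0 * z + 36 * h\<^sup>2 * (6 + 10 * c))"
    using x u h by (simp add: ennreal_mult[symmetric] ennreal_plus[symmetric] del: ennreal_plus)
  moreover have "0 \<le> y + 96 * h / R * E0 * z + 36 * h\<^sup>2 * (6 + 10 * c)" using y z h R1 E0 m6(2) by auto
  ultimately have "x + h / 50 * u \<le> y + 96 * h / R * E0 * z + 36 * h\<^sup>2 * (6 + 10 * c)" by (simp add: ennreal_le_iff)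
  also have "\<dots> \<le> y + 96 * h / R * E0 * z + 360 * h\<^sup>2 * (1 + c)"
  proof -
    have "36 * h\<^sup>2 * (6 + 10 * c) \<le> 36 * h\<^sup>2 * (10 * (1 + c))" by (intro mult_left_mono) auto
    also have "\<dots> = 360 * h\<^sup>2 * (1 + c)" by simp
    finally show ?thesis by simp
  qed
  finally show ?thesis using x y z u by simp
qed

text \<open>Telescoping sum of the one-step inequality, the final tail energy being dropped as
  nonnegative. The number c bounds every sixth moment up to step N.\<close>

lemma collision_iterates_dissipation:
  assumes F0: "F0 \<in> prob_measures" and \<gamma>: "0 < \<gamma>" "\<gamma> \<le> 1" and h: "0 \<le> h"
    and m2: "moment 2 F0 \<le> ennreal E0" and E0: "0 \<le> E0" and M: "sixth_moment F0 \<le> ennreal M" "0 \<le> M"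
    and R: "4 * (2 * E0 + 1) \<le> R" and m6: "(M + E0) * exp (72 * E0 * (h * real N)) \<le> c"
  defines "F \<equiv> \<lambda>k. (collision_step \<gamma> h ^^ k) F0"
  shows "h / 50 * (\<Sum>k\<le>N. enn2real (high_moment_tail \<gamma> R (F k)))
    \<le> enn2real (\<integral>\<^sup>+v. ennreal (tail_energy R v) \<partial>F0) + 96 * h / R * E0 * (\<Sum>k\<le>N. enn2real (moment (2 + \<gamma>) (F k)))
      + 360 * h\<^sup>2 * (1 + c) * real (Suc N)"
proof -
  note it = collision_iterates(1,2)[OF F0 \<gamma> h m2 E0 M]
  have c0: "0 \<le> c" using M E0 m6 by (meson add_nonneg_nonneg exp_ge_zero mult_nonneg_nonneg order_trans)
  have m6k: "sixth_moment (F k) \<le> ennreal c" if "k \<le> N" for k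
  proof -
    have "(M + E0) * exp (72 * E0 * (h * real k)) \<le> (M + E0) * exp (72 * E0 * (h * real N))"
      using that h E0 M by (intro mult_left_mono) (auto intro!: mult_left_mono)
    then have "ennreal ((M + E0) * exp (72 * E0 * (h * real k))) \<le> ennreal c" using m6 by (intro ennreal_leI) simp
    with collision_iterates(3)[OF F0 \<gamma> h m2 E0 M, of k] show ?thesis unfolding F_def by (rule order_trans)
  qed
  define i where "i k = enn2real (\<integral>\<^sup>+v. ennreal (tail_energy R v) \<partial>F k)" for k
  have step: "i (Suc k) + h / 50 * enn2real (high_moment_tail \<gamma> R (F k)) \<le> i k + 96 * h / R * E0 * enn2real (moment (2 + \<gamma>) (F k)) + 360 * h\<^sup>2 * (1 + c)"
    if "k \<le> N" for k
    using collision_step_dissipation_real[OF it(1) \<gamma> h _ E0 R m6k[OF that, unfolded F_def] c0] m2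
    unfolding i_def F_def by (simp add: it(2))
  have "n \<le> N \<Longrightarrow> i (Suc n) + h / 50 * (\<Sum>k\<le>n. enn2real (high_moment_tail \<gamma> R (F k)))
    \<le> i 0 + 96 * h / R * E0 * (\<Sum>k\<le>n. enn2real (moment (2 + \<gamma>) (F k))) + 360 * h\<^sup>2 * (1 + c) * real (Suc n)" for n
  proof (induction n)
    case 0
    then show ?case using step[of 0] by simp
  next
    case (Suc n)
    have "i (Suc (Suc n)) + h / 50 * (\<Sum>k\<le>Suc n. enn2real (high_moment_tail \<gamma> R (F k)))
      = (i (Suc (Suc n)) + h / 50 * enn2real (high_moment_tail \<gamma> R (F (Suc n)))) + h / 50 * (\<Sum>k\<le>n. enn2real (high_moment_tail \<gamma> R (F k)))"
      by (simp add: algebra_simps)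
    also have "\<dots> \<le> (i (Suc n) + 96 * h / R * E0 * enn2real (moment (2 + \<gamma>) (F (Suc n))) + 360 * h\<^sup>2 * (1 + c)) + h / 50 * (\<Sum>k\<le>n. enn2real (high_moment_tail \<gamma> R (F k)))"
      by (intro add_right_mono step Suc.prems)
    also have "\<dots> \<le> i 0 + 96 * h / R * E0 * (\<Sum>k\<le>n. enn2real (moment (2 + \<gamma>) (F k))) + 360 * h\<^sup>2 * (1 + c) * real (Suc n)
      + 96 * h / R * E0 * enn2real (moment (2 + \<gamma>) (F (Suc n))) + 360 * h\<^sup>2 * (1 + c)"
      using Suc by simp
    also have "\<dots> = i 0 + 96 * h / R * E0 * (\<Sum>k\<le>Suc n. enn2real (moment (2 + \<gamma>) (F k))) + 360 * h\<^sup>2 * (1 + c) * real (Suc (Suc n))"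
      by (simp add: distrib_left)
    finally show ?case .
  qed
  from this[of N] have "i (Suc N) + h / 50 * (\<Sum>k\<le>N. enn2real (high_moment_tail \<gamma> R (F k)))
    \<le> i 0 + 96 * h / R * E0 * (\<Sum>k\<le>N. enn2real (moment (2 + \<gamma>) (F k))) + 360 * h\<^sup>2 * (1 + c) * real (Suc N)" by simp
  moreover have "0 \<le> i (Suc N)" by (simp add: i_def)
  ultimately have "h / 50 * (\<Sum>k\<le>N. enn2real (high_moment_tail \<gamma> R (F k)))
    \<le> i 0 + 96 * h / R * E0 * (\<Sum>k\<le>N. enn2real (moment (2 + \<gamma>) (F k))) + 360 * h\<^sup>2 * (1 + c) * real (Suc N)" by linarith
  moreover have "i 0 = enn2real (\<integral>\<^sup>+v. ennreal (tail_energy R v) \<partial>F0)" by (simp add: i_def F_def)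
  ultimately show ?thesis by simp
qed

text \<open>Fast velocities are sent to 0 instead of being conditioned away: the image measure needs
  no normalisation, and no moment of positive order increases.\<close>

definition truncate :: "nat \<Rightarrow> real^3 \<Rightarrow> real^3" where
  "truncate n v = (if norm v \<le> real n then v else 0)"

lemma truncate_measurable[measurable]: "truncate n \<in> borel_measurable borel"
  unfolding truncate_def[abs_def] by measurable

text \<open>A time step \<open>h n\<close> so small that the sixth moment, which may blow up with the truncation level
  \<open>n\<close>, only enters through a vanishing error.\<close>

definition scheme_step :: "real \<Rightarrow> nat \<Rightarrow> real" where
  "scheme_step E0 n = 1 / (real (Suc n) * (1 + (real n ^ 6 + E0) * exp (72 * E0 * real n)))"

definition scheme :: "real \<Rightarrow> (real^3) measure \<Rightarrow> nat \<Rightarrow> nat \<Rightarrow> (real^3) measure" where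
  "scheme \<gamma> f0 n k = (collision_step \<gamma> (scheme_step (enn2real (moment 2 f0)) n) ^^ k) (distr f0 borel (truncate n))"

lemma scheme_step_bounds:
  assumes "0 \<le> E0"
  shows "0 < scheme_step E0 n" "scheme_step E0 n \<le> 1 / real (Suc n)"
    "scheme_step E0 n * (1 + (real n ^ 6 + E0) * exp (72 * E0 * real n)) = 1 / real (Suc n)"
proof -
  define D where "D = 1 + (real n ^ 6 + E0) * exp (72 * E0 * real n)"
  have D: "1 \<le> D" using assms by (simp add: D_def)
  have s: "scheme_step E0 n = 1 / (real (Suc n) * D)" by (simp add: scheme_step_def D_def)
  show "0 < scheme_step E0 n" unfolding s using D by (intro divide_pos_pos mult_pos_pos) auto
  show "scheme_step E0 n \<le> 1 / real (Suc n)"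
    unfolding s using D by (intro divide_left_mono mult_pos_pos) (auto simp: mult_le_cancel_left1)
  show "scheme_step E0 n * (1 + (real n ^ 6 + E0) * exp (72 * E0 * real n)) = 1 / real (Suc n)"
    unfolding D_def[symmetric] s using D by simp
qed

lemma truncated_moments:
  assumes f0: "f0 \<in> prob_measures"
  shows "distr f0 borel (truncate n) \<in> prob_measures" "moment 2 (distr f0 borel (truncate n)) \<le> moment 2 f0"
    "sixth_moment (distr f0 borel (truncate n)) \<le> ennreal (real n ^ 6)"
    "0 < R \<Longrightarrow> (\<integral>\<^sup>+v. ennreal (tail_energy R v) \<partial>distr f0 borel (truncate n)) \<le> (\<integral>\<^sup>+v. ennreal (tail_energy R v) \<partial>f0)"
proof -
  interpret f0: prob_space f0 using prob_measuresD[OF f0] by simp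
  note prob_measuresD(2)[OF f0, measurable_cong]
  show "distr f0 borel (truncate n) \<in> prob_measures"
    by (rule prob_measures_distr[OF f0.prob_space_axioms]) measurable
  show "moment 2 (distr f0 borel (truncate n)) \<le> moment 2 f0"
    unfolding moment_2_eq by (subst nn_integral_distr) (auto intro!: nn_integral_mono ennreal_leI simp: truncate_def)
  have "sixth_moment (distr f0 borel (truncate n)) = (\<integral>\<^sup>+v. ennreal (norm (truncate n v) ^ 6) \<partial>f0)"
    unfolding sixth_moment_def by (subst nn_integral_distr) auto
  also have "\<dots> \<le> (\<integral>\<^sup>+v. ennreal (real n ^ 6) \<partial>f0)"
    by (intro nn_integral_mono ennreal_leI power_mono) (auto simp: truncate_def)
  also have "\<dots> = ennreal (real n ^ 6)" by (simp add: f0.emeasure_space_1)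
  finally show "sixth_moment (distr f0 borel (truncate n)) \<le> ennreal (real n ^ 6)" .
  show "(\<integral>\<^sup>+v. ennreal (tail_energy R v) \<partial>distr f0 borel (truncate n)) \<le> (\<integral>\<^sup>+v. ennreal (tail_energy R v) \<partial>f0)" if R: "0 < R"
  proof -
    have "(\<integral>\<^sup>+v. ennreal (tail_energy R v) \<partial>distr f0 borel (truncate n)) = (\<integral>\<^sup>+v. ennreal (tail_energy R (truncate n v)) \<partial>f0)"
      by (subst nn_integral_distr) auto
    also have "\<dots> \<le> (\<integral>\<^sup>+v. ennreal (tail_energy R v) \<partial>f0)"
      using R tail_energy_nonneg[of R]
      by (intro nn_integral_mono ennreal_leI) (auto simp: truncate_def tail_energy_def[of R 0])
    finally show ?thesis .
  qed
qed

lemma scheme_basic: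
  assumes f0: "f0 \<in> prob_measures" and m2: "moment 2 f0 < \<infinity>" and \<gamma>: "0 < \<gamma>" "\<gamma> \<le> 1"
  shows "scheme \<gamma> f0 n k \<in> prob_measures" "moment 2 (scheme \<gamma> f0 n k) \<le> moment 2 f0"
    "moment (2 + \<gamma>) (scheme \<gamma> f0 n k) < \<infinity>"
proof -
  define E0 where "E0 = enn2real (moment 2 f0)"
  have E0: "moment 2 f0 = ennreal E0" "0 \<le> E0" using m2 by (auto simp: E0_def)
  note t = truncated_moments[OF f0, where n=n]
  note it = collision_iterates[OF t(1) \<gamma> less_imp_le[OF scheme_step_bounds(1)[OF E0(2), of n]] t(2)[unfolded E0(1)] E0(2) t(3) zero_le_power[OF of_nat_0_le_iff]]
  have eq: "scheme \<gamma> f0 n k = (collision_step \<gamma> (scheme_step E0 n) ^^ k) (distr f0 borel (truncate n))" for k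
    by (simp add: scheme_def E0_def)
  show p: "scheme \<gamma> f0 n k \<in> prob_measures" unfolding eq by (rule it(1))
  show "moment 2 (scheme \<gamma> f0 n k) \<le> moment 2 f0" unfolding eq it(2) by (rule t(2))
  have "moment (2 + \<gamma>) (scheme \<gamma> f0 n k) \<le> 1 + sixth_moment (scheme \<gamma> f0 n k)" by (rule moment_le_sixth_moment[OF p \<gamma>])
  also have "\<dots> \<le> 1 + ennreal ((real n ^ 6 + E0) * exp (72 * E0 * (scheme_step E0 n * real k)))"
    unfolding eq by (intro add_left_mono it(3))
  also have "\<dots> < \<infinity>" by (simp add: ennreal_add_less_top flip: ennreal_1)
  finally show "moment (2 + \<gamma>) (scheme \<gamma> f0 n k) < \<infinity>" .
qed

text \<open>The inequality \<open>main\<close> is used twice. At the fixed level \<open>R0\<close>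
  its gain is absorbed, which bounds the summed full moments by K independently of n; at a large
  level R that bound makes the gain of order 1 / R.\<close>

lemma scheme_uniformly_integrable:
  fixes T \<epsilon> :: real
  assumes f0: "f0 \<in> prob_measures" and m2: "moment 2 f0 < \<infinity>" and \<gamma>: "0 < \<gamma>" "\<gamma> \<le> 1"
    and T: "0 < T" and \<epsilon>: "0 < \<epsilon>"
  defines "h \<equiv> scheme_step (enn2real (moment 2 f0))"
  shows "\<exists>R\<ge>1. \<exists>n0. \<forall>n\<ge>n0. h n * (\<Sum>k\<le>nat \<lfloor>T / h n\<rfloor>. enn2real (high_moment_tail \<gamma> R (scheme \<gamma> f0 n k))) \<le> \<epsilon>"
proof -
  define E0 where "E0 = enn2real (moment 2 f0)"
  have E0: "moment 2 f0 = ennreal E0" "0 \<le> E0" using m2 by (auto simp: E0_def)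
  have h: "h = scheme_step E0" by (simp add: h_def E0_def)
  have h0: "0 < h n" "h n \<le> 1" for n
    using scheme_step_bounds(1,2)[OF E0(2), of n] by (auto simp: h intro: order_trans)
  define N where "N n = nat \<lfloor>T / h n\<rfloor>" for n
  have Nh: "h n * real (N n) \<le> T" "h n * real (Suc (N n)) \<le> T + 1" for n
  proof -
    have "0 \<le> T / h n" using T h0(1)[of n] by simp
    then have "real (N n) \<le> T / h n" unfolding N_def by simp
    then show 1: "h n * real (N n) \<le> T" using h0(1)[of n] by (simp add: pos_le_divide_eq mult.commute)
    then show "h n * real (Suc (N n)) \<le> T + 1" using h0(2)[of n] by (simp add: distrib_left)
  qed
  define S where "S n R = h n * (\<Sum>k\<le>N n. enn2real (high_moment_tail \<gamma> R (scheme \<gamma> f0 n k)))" for n R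
  define Sm where "Sm n = h n * (\<Sum>k\<le>N n. enn2real (moment (2 + \<gamma>) (scheme \<gamma> f0 n k)))" for n
  define i0 where "i0 R = enn2real (\<integral>\<^sup>+v. ennreal (tail_energy R v) \<partial>f0)" for R
  have i0_fin: "(\<integral>\<^sup>+v. ennreal (tail_energy R v) \<partial>f0) \<le> ennreal E0" if "0 < R" for R
    unfolding E0(1)[symmetric] moment_2_eq by (intro nn_integral_mono ennreal_leI tail_energy_le that)
  have i0E: "i0 R \<le> E0" if "0 < R" for R
    unfolding i0_def using i0_fin[OF that] E0(2) by (simp add: enn2real_leI)
  have main: "S n R \<le> 50 * i0 R + 4800 * E0 / R * Sm n + 18000 * (T + 1) / real (Suc n)"
    if n: "T \<le> real n" and R: "4 * (2 * E0 + 1) \<le> R" for n R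
  proof -
    \<comment> \<open>The exponent contains the horizon n, not T, so one choice of time steps serves
      every T, as soon as n \<ge> T.\<close>
    define c where "c = (real n ^ 6 + E0) * exp (72 * E0 * real n)"
    have R0: "0 < R" using R E0(2) by simp
    note t = truncated_moments[OF f0, where n=n]
    have m6: "(real n ^ 6 + E0) * exp (72 * E0 * (h n * real (N n))) \<le> c"
      unfolding c_def using E0(2) Nh(1)[of n] n by (intro mult_left_mono) (auto intro!: mult_left_mono)
    have hc: "h n * (1 + c) = 1 / real (Suc n)"
      unfolding c_def h by (rule scheme_step_bounds(3)[OF E0(2)])
    have i: "enn2real (\<integral>\<^sup>+v. ennreal (tail_energy R v) \<partial>distr f0 borel (truncate n)) \<le> i0 R"
      unfolding i0_def using t(4)[OF R0] i0_fin[OF R0]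
      by (intro enn2real_mono) (auto intro: le_less_trans)
    have "h n / 50 * (\<Sum>k\<le>N n. enn2real (high_moment_tail \<gamma> R (scheme \<gamma> f0 n k)))
      \<le> enn2real (\<integral>\<^sup>+v. ennreal (tail_energy R v) \<partial>distr f0 borel (truncate n))
       + 96 * h n / R * E0 * (\<Sum>k\<le>N n. enn2real (moment (2 + \<gamma>) (scheme \<gamma> f0 n k))) + 360 * (h n)\<^sup>2 * (1 + c) * real (Suc (N n))"
      using collision_iterates_dissipation[OF t(1) \<gamma> less_imp_le[OF h0(1)] t(2)[unfolded E0(1)] E0(2) t(3) zero_le_power[OF of_nat_0_le_iff] R m6]
      unfolding scheme_def h E0_def .
    \<comment> \<open>One factor h n compensates the sixth-moment bound c, the other pays for the
      number of steps.\<close>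
    also have "360 * (h n)\<^sup>2 * (1 + c) * real (Suc (N n)) = 360 * (h n * (1 + c)) * (h n * real (Suc (N n)))"
      by (simp add: power2_eq_square)
    also have "\<dots> \<le> 360 * (1 / real (Suc n)) * (T + 1)"
      unfolding hc by (intro mult_left_mono Nh) auto
    finally have "S n R / 50 \<le> i0 R + 96 / R * E0 * Sm n + 360 * (1 / real (Suc n)) * (T + 1)"
      using i unfolding S_def Sm_def by (simp add: mult_ac)
    then have "50 * (S n R / 50) \<le> 50 * (i0 R + 96 / R * E0 * Sm n + 360 * (1 / real (Suc n)) * (T + 1))" by (intro mult_left_mono) auto
    also have "\<dots> = 50 * i0 R + 4800 * E0 / R * Sm n + 18000 * (T + 1) / real (Suc n)"
      by (simp add: distrib_left add_divide_distrib mult.assoc)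
    finally show ?thesis by simp
  qed
  have Sm_le: "Sm n \<le> (T + 1) * R ^ 3 + S n R" if R: "1 \<le> R" for n R
  proof -
    have "enn2real (moment (2 + \<gamma>) (scheme \<gamma> f0 n k)) \<le> R ^ 3 + enn2real (high_moment_tail \<gamma> R (scheme \<gamma> f0 n k))" for k
      using scheme_basic[OF f0 m2 \<gamma>, of n k] by (intro high_moments_real(5) \<gamma> R)
    then have "(\<Sum>k\<le>N n. enn2real (moment (2 + \<gamma>) (scheme \<gamma> f0 n k))) \<le> (\<Sum>k\<le>N n. R ^ 3 + enn2real (high_moment_tail \<gamma> R (scheme \<gamma> f0 n k)))"
      by (intro sum_mono)
    then have "Sm n \<le> h n * (\<Sum>k\<le>N n. R ^ 3 + enn2real (high_moment_tail \<gamma> R (scheme \<gamma> f0 n k)))"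
      unfolding Sm_def using h0(1)[of n] by (intro mult_left_mono) auto
    also have "\<dots> = h n * real (Suc (N n)) * R ^ 3 + S n R" by (simp add: S_def sum.distrib distrib_left)
    also have "\<dots> \<le> (T + 1) * R ^ 3 + S n R" using Nh(2)[of n] R by (intro add_right_mono mult_right_mono) auto
    finally show ?thesis .
  qed
  \<comment> \<open>Large enough for 4800 E0 / R0 \<le> 1 / 2, with 4800 = 50 * 96, and admissible
    as a level in \<open>main\<close>.\<close>
  define R0 where "R0 = 9600 * (E0 + 1)"
  have R0: "1 \<le> R0" "4 * (2 * E0 + 1) \<le> R0" using E0(2) by (auto simp: R0_def)
  \<comment> \<open>Twice the constants in Sm n \<le> (T + 1) R0^3 + 50 E0 + Sm n / 2 + 18000 (T +
    1), after the half of Sm n is moved to the left.\<close>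
  define K where "K = 100 * E0 + 2 * ((T + 1) * R0 ^ 3) + 36000 * (T + 1)"
  have K0: "0 \<le> K" using E0(2) T R0 by (auto simp: K_def)
  have SmK: "Sm n \<le> K" if n: "T \<le> real n" for n
  proof -
    have Sm0: "0 \<le> Sm n" unfolding Sm_def using h0(1)[of n] by (intro mult_nonneg_nonneg sum_nonneg) auto
    have a: "4800 * E0 / R0 * Sm n \<le> 1 / 2 * Sm n"
      using E0(2) Sm0 by (intro mult_right_mono) (auto simp: R0_def field_simps)
    have b: "18000 * (T + 1) / real (Suc n) \<le> 18000 * (T + 1) / 1" using T by (intro divide_left_mono) auto
    have "S n R0 \<le> 50 * E0 + 1 / 2 * Sm n + 18000 * (T + 1)"
      using main[OF n R0(2)] i0E[of R0] R0 a b by linarith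
    with Sm_le[OF R0(1), of n] show ?thesis unfolding K_def by linarith
  qed
  have l1: "(\<lambda>m. 50 * i0 (real (Suc m))) \<longlonglongrightarrow> 50 * 0"
  proof (intro tendsto_mult tendsto_const)
    have "(\<lambda>m. \<integral>\<^sup>+v. ennreal (tail_energy (real (Suc m)) v) \<partial>f0) \<longlonglongrightarrow> ennreal 0"
      unfolding ennreal_0 by (rule tail_energy_integral_tendsto_0[OF f0 m2])
    then have "(\<lambda>m. enn2real (\<integral>\<^sup>+v. ennreal (tail_energy (real (Suc m)) v) \<partial>f0)) \<longlonglongrightarrow> 0"
      by (rule tendsto_enn2real) simp
    then show "(\<lambda>m. i0 (real (Suc m))) \<longlonglongrightarrow> 0" by (simp add: i0_def)
  qed
  have l2: "(\<lambda>m. 4800 * E0 * K * inverse (real (Suc m))) \<longlonglongrightarrow> 4800 * E0 * K * 0"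
    by (intro tendsto_mult tendsto_const LIMSEQ_inverse_real_of_nat)
  have l3: "(\<lambda>m. 18000 * (T + 1) * inverse (real (Suc m))) \<longlonglongrightarrow> 18000 * (T + 1) * 0"
    by (intro tendsto_mult tendsto_const LIMSEQ_inverse_real_of_nat)
  have large: "\<forall>\<^sub>F m in sequentially. C \<le> real m" for C
    using filterlim_real_sequentially unfolding filterlim_at_top by blast
  have "\<forall>\<^sub>F m in sequentially. 50 * i0 (real (Suc m)) < \<epsilon> / 3"
    by (rule order_tendstoD(2)[OF l1]) (use \<epsilon> in simp)
  moreover have "\<forall>\<^sub>F m in sequentially. 4800 * E0 * K * inverse (real (Suc m)) < \<epsilon> / 3"
    by (rule order_tendstoD(2)[OF l2]) (use \<epsilon> in simp)
  ultimately have "\<forall>\<^sub>F m in sequentially. 50 * i0 (real (Suc m)) < \<epsilon> / 3 \<and> 4800 * E0 * K * inverse (real (Suc m)) < \<epsilon> / 3 \<and> R0 \<le> real m"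
    using large[of R0] by eventually_elim blast
  then obtain m where m: "50 * i0 (real (Suc m)) < \<epsilon> / 3" "4800 * E0 * K * inverse (real (Suc m)) < \<epsilon> / 3" "R0 \<le> real m"
    using eventually_happens'[OF sequentially_bot] by blast
  have "\<forall>\<^sub>F n in sequentially. 18000 * (T + 1) * inverse (real (Suc n)) < \<epsilon> / 3"
    by (rule order_tendstoD(2)[OF l3]) (use \<epsilon> in simp)
  then have "\<forall>\<^sub>F n in sequentially. 18000 * (T + 1) * inverse (real (Suc n)) < \<epsilon> / 3 \<and> T \<le> real n"
    using large[of T] by eventually_elim blast
  then obtain n0 where n0: "\<And>n. n \<ge> n0 \<Longrightarrow> 18000 * (T + 1) * inverse (real (Suc n)) < \<epsilon> / 3 \<and> T \<le> real n"
    unfolding eventually_sequentially by blast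
  define R where "R = real (Suc m)"
  have R: "1 \<le> R" "4 * (2 * E0 + 1) \<le> R" using m(3) R0 by (auto simp: R_def)
  have "S n R \<le> \<epsilon>" if n: "n \<ge> n0" for n
  proof -
    have "4800 * E0 / R * Sm n \<le> 4800 * E0 / R * K" using SmK n0[OF n] E0(2) R by (intro mult_left_mono) auto
    also have "\<dots> = 4800 * E0 * K * inverse (real (Suc m))" by (simp add: R_def divide_inverse mult_ac)
    finally have "4800 * E0 / R * Sm n < \<epsilon> / 3" using m(2) by linarith
    moreover have "18000 * (T + 1) / real (Suc n) < \<epsilon> / 3"
      unfolding divide_inverse[of _ "real (Suc n)"] using n0[OF n] by blast
    moreover have "S n R \<le> 50 * i0 R + 4800 * E0 / R * Sm n + 18000 * (T + 1) / real (Suc n)"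
      using n0[OF n] by (intro main R) blast
    ultimately show ?thesis using m(1) unfolding R_def by linarith
  qed
  then show ?thesis using R(1) unfolding S_def N_def by blast
qed

section \<open>Compactness\<close>

text \<open>Growth as a sum of one-particle terms is what \<open>discrete_L_bound\<close> provides;
  on the product of a probability measure with itself each summand integrates to the same value,
  hence the factor 2.\<close>

lemma double_integral_bound:
  fixes G :: "real^3 \<Rightarrow> real^3 \<Rightarrow> real"
  assumes \<mu>: "\<mu> \<in> prob_measures" and a: "integrable \<mu> a" "\<And>v. 0 \<le> a v"
    and G: "(\<lambda>(v, w). G v w) \<in> borel_measurable (borel \<Otimes>\<^sub>M borel)" and le: "\<And>v w. \<bar>G v w\<bar> \<le> a v + a w"
  shows "integrable (\<mu> \<Otimes>\<^sub>M \<mu>) (\<lambda>(v, w). G v w)" "\<bar>\<integral>v. (\<integral>w. G v w \<partial>\<mu>) \<partial>\<mu>\<bar> \<le> 2 * (\<integral>v. a v \<partial>\<mu>)"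
proof -
  interpret m: prob_space \<mu> using prob_measuresD[OF \<mu>] by simp
  interpret P: pair_prob_space \<mu> \<mu> ..
  note prob_measuresD(2)[OF \<mu>, measurable_cong] G[measurable] borel_measurable_integrable[OF a(1), measurable]
  have nn: "(\<integral>\<^sup>+x. ennreal (norm (case x of (v, w) \<Rightarrow> G v w)) \<partial>(\<mu> \<Otimes>\<^sub>M \<mu>)) \<le> ennreal (2 * (\<integral>v. a v \<partial>\<mu>))"
  proof -
    have "(\<integral>\<^sup>+x. ennreal (norm (case x of (v, w) \<Rightarrow> G v w)) \<partial>(\<mu> \<Otimes>\<^sub>M \<mu>)) = (\<integral>\<^sup>+v. \<integral>\<^sup>+w. ennreal \<bar>G v w\<bar> \<partial>\<mu> \<partial>\<mu>)"
      by (subst m.nn_integral_fst[symmetric]) auto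
    also have "\<dots> \<le> (\<integral>\<^sup>+v. \<integral>\<^sup>+w. ennreal (a v) + ennreal (a w) \<partial>\<mu> \<partial>\<mu>)"
      using le a(2) by (intro nn_integral_mono) (simp add: ennreal_plus[symmetric] ennreal_leI del: ennreal_plus)
    also have "\<dots> = (\<integral>\<^sup>+v. ennreal (a v) \<partial>\<mu>) + (\<integral>\<^sup>+v. ennreal (a v) \<partial>\<mu>)"
      by (simp add: nn_integral_add m.emeasure_space_1)
    also have "\<dots> = ennreal (2 * (\<integral>v. a v \<partial>\<mu>))"
    proof -
      have e: "(\<integral>\<^sup>+v. ennreal (a v) \<partial>\<mu>) = ennreal (\<integral>v. a v \<partial>\<mu>)"
        by (rule nn_integral_eq_integral[OF a(1)]) (simp add: a(2))
      have p: "0 \<le> (\<integral>v. a v \<partial>\<mu>)" using a(2) by (rule Bochner_Integration.integral_nonneg)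
      show ?thesis unfolding e mult_2 ennreal_plus[OF p p] ..
    qed
    finally show ?thesis .
  qed
  show i: "integrable (\<mu> \<Otimes>\<^sub>M \<mu>) (\<lambda>(v, w). G v w)"
    by (rule integrableI_bounded) (use nn in \<open>auto intro: le_less_trans\<close>)
  have "\<bar>\<integral>v. (\<integral>w. G v w \<partial>\<mu>) \<partial>\<mu>\<bar> = norm (\<integral>x. (case x of (v, w) \<Rightarrow> G v w) \<partial>(\<mu> \<Otimes>\<^sub>M \<mu>))"
    using P.integral_fst'[OF i] by simp
  also have "\<dots> \<le> (\<integral>x. norm (case x of (v, w) \<Rightarrow> G v w) \<partial>(\<mu> \<Otimes>\<^sub>M \<mu>))" by (rule integral_norm_bound)
  also have "\<dots> \<le> 2 * (\<integral>v. a v \<partial>\<mu>)"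
  proof -
    have "ennreal (\<integral>x. norm (case x of (v, w) \<Rightarrow> G v w) \<partial>(\<mu> \<Otimes>\<^sub>M \<mu>)) \<le> ennreal (2 * (\<integral>v. a v \<partial>\<mu>))"
      using nn nn_integral_eq_integral[OF integrable_norm[OF i]] by simp
    moreover have "0 \<le> 2 * (\<integral>v. a v \<partial>\<mu>)" using a(2) by simp
    ultimately show ?thesis by (simp only: ennreal_le_iff)
  qed
  finally show "\<bar>\<integral>v. (\<integral>w. G v w \<partial>\<mu>) \<partial>\<mu>\<bar> \<le> 2 * (\<integral>v. a v \<partial>\<mu>)" .
qed

lemma double_integral_diff:
  fixes G H :: "real^3 \<Rightarrow> real^3 \<Rightarrow> real"
  assumes \<mu>: "\<mu> \<in> prob_measures"
    and G: "integrable (\<mu> \<Otimes>\<^sub>M \<mu>) (\<lambda>(v, w). G v w)" and H: "integrable (\<mu> \<Otimes>\<^sub>M \<mu>) (\<lambda>(v, w). H v w)"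
  shows "(\<integral>v. (\<integral>w. G v w \<partial>\<mu>) \<partial>\<mu>) - (\<integral>v. (\<integral>w. H v w \<partial>\<mu>) \<partial>\<mu>) = (\<integral>v. (\<integral>w. G v w - H v w \<partial>\<mu>) \<partial>\<mu>)"
proof -
  interpret m: prob_space \<mu> using prob_measuresD[OF \<mu>] by simp
  interpret P: pair_prob_space \<mu> \<mu> ..
  have "integrable (\<mu> \<Otimes>\<^sub>M \<mu>) (\<lambda>x. (case x of (v, w) \<Rightarrow> G v w) - (case x of (v, w) \<Rightarrow> H v w))"
    using G H by (rule Bochner_Integration.integrable_diff)
  from P.integral_fst'[OF this] P.integral_fst'[OF G] P.integral_fst'[OF H] Bochner_Integration.integral_diff[OF G H]
  show ?thesis by simp
qed

locale landau_scheme =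
  fixes \<gamma> :: real and f0 :: "(real^3) measure"
  assumes \<gamma>: "0 < \<gamma>" "\<gamma> \<le> 1" and f0: "f0 \<in> prob_measures" and f0_2: "moment 2 f0 < \<infinity>"
begin

definition "E0 = enn2real (moment 2 f0)"
definition "h = scheme_step E0"
text \<open>Number of completed steps, so \<open>F n (idx n t)\<close> is the piecewise constant
  interpolation of the scheme. For negative t the index is 0, which later permits a constant
  extension to negative times.\<close>

definition "idx n t = nat \<lfloor>t / h n\<rfloor>"
definition "F n k = scheme \<gamma> f0 n k"
definition "drift n k \<phi> = (\<integral>v. (\<integral>w. discrete_L \<gamma> (h n) \<phi> v w \<partial>F n k) \<partial>F n k)"
definition "tail R n k = enn2real (high_moment_tail \<gamma> R (F n k))"

lemma E0: "moment 2 f0 = ennreal E0" "0 \<le> E0"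
  using f0_2 by (auto simp: E0_def)

lemma h: "0 < h n" "h n \<le> 1 / real (Suc n)" "h n \<le> 1"
  using scheme_step_bounds(1,2)[OF E0(2), of n] by (auto simp: h_def intro: order_trans)

lemma h_tendsto: "h \<longlonglongrightarrow> 0"
  by (rule tendsto_sandwich[OF _ _ tendsto_const LIMSEQ_inverse_real_of_nat])
    (use h in \<open>auto simp: less_imp_le inverse_eq_divide simp del: of_nat_Suc\<close>)

lemma F: "F n k \<in> prob_measures" "moment 2 (F n k) \<le> ennreal E0" "moment (2 + \<gamma>) (F n k) < \<infinity>"
  using scheme_basic[OF f0 f0_2 \<gamma>] by (auto simp: F_def E0(1)[symmetric])

lemma uniformly_integrable:
  assumes "0 < T" "0 < \<epsilon>"
  shows "\<exists>R\<ge>1. \<exists>n0. \<forall>n\<ge>n0. h n * (\<Sum>k\<le>idx n T. tail R n k) \<le> \<epsilon>"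
  using scheme_uniformly_integrable[OF f0 f0_2 \<gamma> assms] unfolding h_def E0_def idx_def tail_def F_def .

lemma tail_nonneg: "0 \<le> tail R n k"
  by (simp add: tail_def)

lemma idx_mono: "s \<le> t \<Longrightarrow> idx n s \<le> idx n t"
  unfolding idx_def using h(1)[of n] by (intro nat_mono floor_mono divide_right_mono) auto

lemma idx_bounds:
  assumes "0 \<le> t" shows "h n * real (idx n t) \<le> t" "t < h n * real (idx n t) + h n"
proof -
  have "0 \<le> t / h n" using assms h(1)[of n] by simp
  then have "real (idx n t) \<le> t / h n" "t / h n < real (idx n t) + 1"
    unfolding idx_def by (auto simp: of_nat_nat)
  then show "h n * real (idx n t) \<le> t" "t < h n * real (idx n t) + h n"
    using h(1)[of n] by (auto simp: field_simps)
qed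

lemma weak_identity:
  assumes \<phi>: "\<phi> \<in> C2b"
  shows "(\<integral>v. \<phi> v \<partial>F n N) - (\<integral>v. \<phi> v \<partial>F n 0) = h n * (\<Sum>k<N. drift n k \<phi>)"
proof (induction N)
  case (Suc N)
  have "F n (Suc N) = collision_step \<gamma> (h n) (F n N)" by (simp add: F_def scheme_def h_def E0_def)
  then have "(\<integral>v. \<phi> v \<partial>F n (Suc N)) - (\<integral>v. \<phi> v \<partial>F n N) = h n * drift n N \<phi>"
    using integral_collision_step[OF F(1) \<phi> h(1)] by (simp add: drift_def)
  with Suc show ?case by (simp add: distrib_left)
qed simp

lemma drift_bound:
  assumes \<phi>: "\<phi> \<in> C2b"
    and C: "0 \<le> C" "\<And>h v w. h > 0 \<Longrightarrow> \<bar>discrete_L \<gamma> h \<phi> v w\<bar> \<le> C * (1 + norm v powr (2 + \<gamma>) + norm w powr (2 + \<gamma>))"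
    and R: "1 \<le> R"
  shows "\<bar>drift n k \<phi>\<bar> \<le> 2 * C * (1 + R ^ 3 + tail R n k)"
proof -
  note m = high_moments_real[OF F(1,3) \<gamma> R, of n k]
  interpret prob_space "F n k" using prob_measuresD[OF F(1)] by simp
  have "\<bar>drift n k \<phi>\<bar> \<le> 2 * (\<integral>v. C * (1 + norm v powr (2 + \<gamma>)) \<partial>F n k)"
    unfolding drift_def
  proof (rule double_integral_bound[OF F(1) _ _ discrete_L_measurable[OF \<phi>]])
    show "integrable (F n k) (\<lambda>v. C * (1 + norm v powr (2 + \<gamma>)))" using m(1) by simp
    show "0 \<le> C * (1 + norm v powr (2 + \<gamma>))" for v :: "real^3" using C(1) by simp
    show "\<bar>discrete_L \<gamma> (h n) \<phi> v w\<bar> \<le> C * (1 + norm v powr (2 + \<gamma>)) + C * (1 + norm w powr (2 + \<gamma>))" for v w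
      using C(2)[OF h(1)[of n], of v w] C(1) by (simp add: algebra_simps)
  qed
  also have "(\<integral>v. C * (1 + norm v powr (2 + \<gamma>)) \<partial>F n k) = C * (1 + enn2real (moment (2 + \<gamma>) (F n k)))"
    using m(1,2) by (simp add: prob_space)
  also have "2 * (C * (1 + enn2real (moment (2 + \<gamma>) (F n k)))) \<le> 2 * (C * (1 + (R ^ 3 + tail R n k)))"
    using m(5) C(1) unfolding tail_def by (intro mult_left_mono add_left_mono) auto
  finally show ?thesis by (simp add: mult.assoc add.assoc)
qed

text \<open>The drift has no uniform bound. Uniform integrability splits it into a bounded part,
  small on short time intervals, and a tail part, small on all of [0, T]. The interpolations jump,
  so this can hold for large n only.\<close>

lemma equicontinuous:
  assumes \<phi>: "\<phi> \<in> C2b" and T: "0 < T" and \<epsilon>: "0 < \<epsilon>"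
  shows "\<exists>\<delta>>0. \<exists>n0. \<forall>n\<ge>n0. \<forall>s t. 0 \<le> s \<longrightarrow> s \<le> t \<longrightarrow> t \<le> T \<longrightarrow> t - s \<le> \<delta> \<longrightarrow>
    \<bar>(\<integral>v. \<phi> v \<partial>F n (idx n t)) - (\<integral>v. \<phi> v \<partial>F n (idx n s))\<bar> \<le> \<epsilon>"
proof -
  obtain C where C: "C \<ge> 0" "\<And>h v w. h > 0 \<Longrightarrow> \<bar>discrete_L \<gamma> h \<phi> v w\<bar> \<le> C * (1 + norm v powr (2 + \<gamma>) + norm w powr (2 + \<gamma>))"
    using discrete_L_bound[OF \<phi> \<gamma>] by blast
  \<comment> \<open>The tail part costs 2 C \<eta> \<le> \<epsilon> / 2 however long the interval
    is. It fixes R, hence B, and then \<delta> is chosen for the bounded part. The summands 1 cover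
    C = 0 and B = 0.\<close>
  define \<eta> where "\<eta> = \<epsilon> / (4 * (C + 1))"
  have \<eta>: "0 < \<eta>" "2 * C * \<eta> \<le> \<epsilon> / 2" using \<epsilon> C(1) by (auto simp: \<eta>_def field_simps)
  obtain R n1 where R: "R \<ge> 1" and n1: "\<And>n. n \<ge> n1 \<Longrightarrow> h n * (\<Sum>k\<le>idx n T. tail R n k) \<le> \<eta>"
    using uniformly_integrable[OF T \<eta>(1)] by blast
  define B where "B = 2 * C * (1 + R ^ 3)"
  have B: "0 \<le> B" using C(1) R by (simp add: B_def)
  define \<delta> where "\<delta> = \<epsilon> / (4 * (B + 1))"
  have \<delta>: "0 < \<delta>" "B * (2 * \<delta>) \<le> \<epsilon> / 2" using \<epsilon> B by (auto simp: \<delta>_def field_simps)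
  obtain n2 where n2: "\<And>n. n \<ge> n2 \<Longrightarrow> h n < \<delta>"
    using order_tendstoD(2)[OF h_tendsto \<delta>(1)] by (auto simp: eventually_sequentially)
  have "\<bar>(\<integral>v. \<phi> v \<partial>F n (idx n t)) - (\<integral>v. \<phi> v \<partial>F n (idx n s))\<bar> \<le> \<epsilon>"
    if n: "n \<ge> max n1 n2" and st: "0 \<le> s" "s \<le> t" "t \<le> T" "t - s \<le> \<delta>" for n s t
  proof -
    have le: "idx n s \<le> idx n t" "idx n t \<le> idx n T" using st by (auto intro: idx_mono)
    have "(\<Sum>k<idx n t. drift n k \<phi>) - (\<Sum>k<idx n s. drift n k \<phi>) = (\<Sum>k\<in>{idx n s..<idx n t}. drift n k \<phi>)"
      using sum_diff[of "{..<idx n t}" "{..<idx n s}" "\<lambda>k. drift n k \<phi>"] le(1)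
      by (simp add: lessThan_minus_lessThan)
    moreover have "(\<integral>v. \<phi> v \<partial>F n (idx n t)) - (\<integral>v. \<phi> v \<partial>F n (idx n s))
      = h n * ((\<Sum>k<idx n t. drift n k \<phi>) - (\<Sum>k<idx n s. drift n k \<phi>))"
      using weak_identity[OF \<phi>, of n "idx n t"] weak_identity[OF \<phi>, of n "idx n s"] by (simp add: right_diff_distrib)
    ultimately have "\<bar>(\<integral>v. \<phi> v \<partial>F n (idx n t)) - (\<integral>v. \<phi> v \<partial>F n (idx n s))\<bar> = h n * \<bar>\<Sum>k\<in>{idx n s..<idx n t}. drift n k \<phi>\<bar>"
      using h(1)[of n] by (simp add: abs_mult)
    also have "\<dots> \<le> h n * (\<Sum>k\<in>{idx n s..<idx n t}. B + 2 * C * tail R n k)"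
      using h(1)[of n] drift_bound[OF \<phi> C R]
      by (intro mult_left_mono order_trans[OF sum_abs] sum_mono) (auto simp: B_def distrib_left)
    also have "\<dots> = B * (h n * real (idx n t - idx n s)) + 2 * C * (h n * (\<Sum>k\<in>{idx n s..<idx n t}. tail R n k))"
      by (simp add: sum.distrib sum_distrib_left[symmetric] distrib_left mult_ac)
    also have "\<dots> \<le> B * (2 * \<delta>) + 2 * C * \<eta>"
    proof (intro add_mono mult_left_mono B)
      \<comment> \<open>The steps between s and t cover at most t - s plus one step, and h n <
        \<delta>.\<close>
      have "h n * real (idx n t - idx n s) = h n * real (idx n t) - h n * real (idx n s)"
        using le(1) by (simp add: of_nat_diff right_diff_distrib)
      then show "h n * real (idx n t - idx n s) \<le> 2 * \<delta>"
        using idx_bounds(1)[of t n] idx_bounds(2)[of s n] st n2[of n] n by simp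
      have "(\<Sum>k\<in>{idx n s..<idx n t}. tail R n k) \<le> (\<Sum>k\<le>idx n T. tail R n k)"
        using le by (intro sum_mono2) (auto simp: tail_nonneg)
      then have "h n * (\<Sum>k\<in>{idx n s..<idx n t}. tail R n k) \<le> h n * (\<Sum>k\<le>idx n T. tail R n k)"
        using h(1)[of n] by (intro mult_left_mono) auto
      also have "\<dots> \<le> \<eta>" using n by (intro n1) auto
      finally show "h n * (\<Sum>k\<in>{idx n s..<idx n t}. tail R n k) \<le> \<eta>" .
    qed (use C in auto)
    also have "\<dots> \<le> \<epsilon>" using \<delta>(2) \<eta>(2) by simp
    finally show ?thesis .
  qed
  then show ?thesis
    by (intro exI[of _ \<delta>] conjI \<delta>(1) exI[of _ "max n1 n2"] allI impI)
qed

lemma weakly_converges_ex_subseq: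
  assumes "strict_mono (s :: nat \<Rightarrow> nat)"
  shows "\<exists>r. strict_mono r \<and> (\<exists>\<nu>\<in>prob_measures. weakly_converges (\<lambda>n. F (s (r n)) (idx (s (r n)) t)) \<nu>)"
proof -
  have "\<And>n. F (s n) (idx (s n) t) \<in> prob_measures" "\<And>n. moment 2 (F (s n) (idx (s n) t)) \<le> ennreal E0" "ennreal E0 < \<infinity>"
    using F by auto
  then obtain r X Y and \<Omega> :: "real measure" where *: "strict_mono r" "prob_space \<Omega>"
    "\<And>n. X n \<in> \<Omega> \<rightarrow>\<^sub>M borel" "Y \<in> \<Omega> \<rightarrow>\<^sub>M borel" "\<And>n. distr \<Omega> borel (X n) = F (s (r n)) (idx (s (r n)) t)"
    "AE \<omega> in \<Omega>. (\<lambda>n. X n \<omega>) \<longlonglongrightarrow> Y \<omega>"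
    by (rule prokhorov_skorokhod) (rule that)
  have "weakly_converges (\<lambda>n. F (s (r n)) (idx (s (r n)) t)) (distr \<Omega> borel Y)"
    unfolding weakly_converges_def *(5)[symmetric]
    by (intro allI impI AE_tendsto_integral_distr[OF *(2,3,4,6)])
  then show ?thesis using *(1) prob_measures_distr[OF *(2,4)] by blast
qed

text \<open>A diagonal sequence converges at all nonnegative rational times; equicontinuity
  transfers the Cauchy property to every t \<ge> 0, for test functions in
  \<open>tanh_polynomials\<close>, and that class suffices.\<close>

lemma limit_exists:
  "\<exists>r f. strict_mono (r :: nat \<Rightarrow> nat) \<and> (\<forall>t\<ge>0. f t \<in> prob_measures \<and> weakly_converges (\<lambda>n. F (r n) (idx (r n) t)) (f t))"
proof -
  \<comment> \<open>The absolute value makes the enumeration one of nonnegative rationals.\<close>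
  define q where "q m = \<bar>real_of_rat (from_nat m)\<bar>" for m :: nat
  define P where "P m s \<longleftrightarrow> (\<exists>\<nu>\<in>prob_measures. weakly_converges (\<lambda>n. F (s n) (idx (s n) (q m))) \<nu>)" for m and s :: "nat \<Rightarrow> nat"
  interpret subseqs P
  proof
    fix m :: nat and s :: "nat \<Rightarrow> nat" assume "strict_mono s"
    from weakly_converges_ex_subseq[OF this, of "q m"]
    show "\<exists>r'. strict_mono r' \<and> P m (s \<circ> r')" unfolding P_def o_def .
  qed
  define r where "r = diagseq"
  have r: "strict_mono r" unfolding r_def by (rule subseq_diagseq)
  have Pr: "P m (diagseq \<circ> ((+) (Suc m)))" for m
  proof (rule diagseq_holds)
    fix r s :: "nat \<Rightarrow> nat" and m assume r: "strict_mono r" and "P m s"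
    then obtain \<nu> where "\<nu> \<in> prob_measures" "weakly_converges (\<lambda>n. F (s n) (idx (s n) (q m))) \<nu>" by (auto simp: P_def)
    with weakly_converges_subseq[OF this(2) r] show "P m (s \<circ> r)" by (auto simp: P_def)
  qed
  have conv_q: "convergent (\<lambda>n. \<integral>v. p v \<partial>F (r n) (idx (r n) (q m)))" if p: "p \<in> tanh_polynomials" for p m
  proof -
    obtain \<nu> where "weakly_converges (\<lambda>n. F (r (Suc m + n)) (idx (r (Suc m + n)) (q m))) \<nu>"
      using Pr[of m] by (auto simp: P_def r_def)
    from weakly_convergesD[OF this tanh_polynomials_continuous[OF p] tanh_polynomials_bounded[OF p]]
    have "(\<lambda>n. \<integral>v. p v \<partial>F (r (n + Suc m)) (idx (r (n + Suc m)) (q m))) \<longlonglongrightarrow> (\<integral>v. p v \<partial>\<nu>)" by (simp add: add.commute)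
    then have "(\<lambda>n. \<integral>v. p v \<partial>F (r n) (idx (r n) (q m))) \<longlonglongrightarrow> (\<integral>v. p v \<partial>\<nu>)"
      by (rule LIMSEQ_offset)
    then show ?thesis by (rule convergentI)
  qed
  have Cau: "Cauchy (\<lambda>n. \<integral>v. p v \<partial>F (r n) (idx (r n) t))" if p: "p \<in> tanh_polynomials" and t: "0 \<le> t" for p t
  proof (rule metric_CauchyI)
    fix e :: real assume e: "0 < e"
    have pC: "p \<in> C2b" using p tanh_polynomials_subset_C2b by blast
    have T: "0 < t + 1" "0 < e / 4" using t e by auto
    from equicontinuous[OF pC T] obtain \<delta> n0 where \<delta>: "\<delta> > 0"
      and "\<forall>n\<ge>n0. \<forall>s t'. 0 \<le> s \<longrightarrow> s \<le> t' \<longrightarrow> t' \<le> t + 1 \<longrightarrow> t' - s \<le> \<delta> \<longrightarrow>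
        \<bar>(\<integral>v. p v \<partial>F n (idx n t')) - (\<integral>v. p v \<partial>F n (idx n s))\<bar> \<le> e / 4"
      by blast
    note n0 = this(2)[rule_format]
    \<comment> \<open>A rational just above t stays nonnegative even for t = 0 and below the horizon
      t + 1.\<close>
    have "t < t + min \<delta> 1" using \<delta> by simp
    then obtain x where x: "t < real_of_rat x" "real_of_rat x < t + min \<delta> 1" using of_rat_dense by blast
    define m where "m = to_nat x"
    have qm: "q m = real_of_rat x" unfolding q_def m_def from_nat_to_nat using x(1) t by (intro abs_of_nonneg) linarith
    obtain N where N: "\<And>i j. i \<ge> N \<Longrightarrow> j \<ge> N \<Longrightarrow> dist (\<integral>v. p v \<partial>F (r i) (idx (r i) (q m))) (\<integral>v. p v \<partial>F (r j) (idx (r j) (q m))) < e / 4"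
      using metric_CauchyD[OF convergent_Cauchy[OF conv_q[OF p, of m]], of "e / 4"] e by auto
    have close: "\<bar>(\<integral>v. p v \<partial>F (r i) (idx (r i) (q m))) - (\<integral>v. p v \<partial>F (r i) (idx (r i) t))\<bar> \<le> e / 4" if "i \<ge> n0" for i
      using x t that seq_suble[OF r, of i] unfolding qm by (intro n0) auto
    show "\<exists>M. \<forall>i\<ge>M. \<forall>j\<ge>M. dist (\<integral>v. p v \<partial>F (r i) (idx (r i) t)) (\<integral>v. p v \<partial>F (r j) (idx (r j) t)) < e"
    proof (intro exI[of _ "max N n0"] allI impI)
      fix i j assume ij: "max N n0 \<le> i" "max N n0 \<le> j"
      show "dist (\<integral>v. p v \<partial>F (r i) (idx (r i) t)) (\<integral>v. p v \<partial>F (r j) (idx (r j) t)) < e"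
        using N[of i j] close[of i] close[of j] ij e unfolding dist_real_def max.bounded_iff by linarith
    qed
  qed
  have "\<forall>t. \<exists>\<nu>. 0 \<le> t \<longrightarrow> \<nu> \<in> prob_measures \<and> weakly_converges (\<lambda>n. F (r n) (idx (r n) t)) \<nu>"
    using Cauchy_imp_weakly_converges[OF F(1) F(2) E0(2) Cau] by blast
  from choice[OF this] show ?thesis using r by blast
qed

text \<open>At time 0 the scheme is the truncated datum, and at each point truncation is eventually
  the identity.\<close>

lemma initial_limit:
  assumes r: "strict_mono (r :: nat \<Rightarrow> nat)" and w: "weakly_converges (\<lambda>n. F (r n) (idx (r n) 0)) \<nu>" and \<nu>: "\<nu> \<in> prob_measures"
  shows "\<nu> = f0"
proof (rule prob_measures_eqI[OF \<nu> f0])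
  fix g :: "real^3 \<Rightarrow> real" assume g: "continuous_on UNIV g" "bounded (range g)"
  interpret prob_space f0 using prob_measuresD[OF f0] by simp
  note prob_measuresD(2)[OF f0, measurable_cong]
  have "F n (idx n 0) = distr f0 borel (truncate n)" for n by (simp add: F_def scheme_def idx_def)
  then have "(\<lambda>n. \<integral>v. g v \<partial>distr f0 borel (truncate (r n))) \<longlonglongrightarrow> (\<integral>v. g v \<partial>\<nu>)"
    using weakly_convergesD[OF w g] by simp
  moreover have "(\<lambda>n. \<integral>v. g v \<partial>distr f0 borel (truncate (r n))) \<longlonglongrightarrow> (\<integral>v. g v \<partial>distr f0 borel (\<lambda>v. v))"
  proof (rule AE_tendsto_integral_distr[OF prob_space_axioms _ _ _ g])
    show "AE v in f0. (\<lambda>n. truncate (r n) v) \<longlonglongrightarrow> v"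
    proof (intro AE_I2 tendsto_eventually)
      fix v :: "real^3"
      obtain N :: nat where "norm v \<le> real N" using real_arch_simple by blast
      moreover have "real N \<le> real (r n)" if "N \<le> n" for n
        using le_trans[OF that seq_suble[OF r, of n]] by simp
      ultimately have "norm v \<le> real (r n)" if "N \<le> n" for n using that order_trans by blast
      then show "\<forall>\<^sub>F n in sequentially. truncate (r n) v = v"
        unfolding eventually_sequentially truncate_def by (intro exI[of _ N]) auto
    qed
  qed measurable
  moreover have "distr f0 borel (\<lambda>v. v) = f0" using prob_measuresD(2)[OF f0] by (simp add: distr_id2)
  ultimately show "(\<integral>v. g v \<partial>\<nu>) = (\<integral>v. g v \<partial>f0)" using LIMSEQ_unique by simp
qed

end

section \<open>Passage to the limit\<close>

text \<open>Sums over time steps become integrals of step functions on half-open intervals, so that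
  Fatou's lemma and dominated convergence apply in time.\<close>

lemma step_function_integral:
  fixes a :: "nat \<Rightarrow> real"
  assumes \<eta>: "0 < \<eta>"
  shows "has_bochner_integral lborel (\<lambda>s. indicator {0..<real N * \<eta>} s * a (nat \<lfloor>s / \<eta>\<rfloor>)) (\<eta> * (\<Sum>k<N. a k))"
proof (induction N)
  case 0
  show ?case by (simp add: has_bochner_integral_zero)
next
  case (Suc N)
  have "has_bochner_integral lborel (\<lambda>s. indicator {real N * \<eta>..<real (Suc N) * \<eta>} s * a N) (\<eta> * a N)"
    using has_bochner_integral_mult_left[OF has_bochner_integral_real_indicator[of "{real N * \<eta>..<real (Suc N) * \<eta>}" lborel], of "a N"] \<eta>
    by (simp add: algebra_simps)
  from has_bochner_integral_add[OF Suc this]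
  have "has_bochner_integral lborel (\<lambda>s. indicator {0..<real N * \<eta>} s * a (nat \<lfloor>s / \<eta>\<rfloor>) + indicator {real N * \<eta>..<real (Suc N) * \<eta>} s * a N)
    (\<eta> * (\<Sum>k<Suc N. a k))" by (simp add: distrib_left)
  moreover have "indicator {0..<real (Suc N) * \<eta>} s * a (nat \<lfloor>s / \<eta>\<rfloor>)
    = indicator {0..<real N * \<eta>} s * a (nat \<lfloor>s / \<eta>\<rfloor>) + indicator {real N * \<eta>..<real (Suc N) * \<eta>} s * a N" for s
  proof (cases "real N * \<eta> \<le> s \<and> s < real (Suc N) * \<eta>")
    case True
    then have "real N \<le> s / \<eta>" "s / \<eta> < real N + 1" using \<eta> by (auto simp: field_simps)
    then have "\<lfloor>s / \<eta>\<rfloor> = int N" by (simp add: floor_eq_iff)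
    moreover have "0 \<le> s" using True \<eta> by (meson mult_nonneg_nonneg of_nat_0_le_iff less_imp_le order_trans)
    ultimately show ?thesis using True by simp
  next
    case False
    have "real N * \<eta> \<le> real (Suc N) * \<eta>" using \<eta> by (intro mult_right_mono) auto
    then show ?thesis using False by (auto simp: indicator_def)
  qed
  ultimately show ?case by simp
qed

text \<open>Here the integrand depends on x as well as the measure. Moving \<open>L x\<close> to the
  fibre over x by the map sending y to the pair (x, y) gives a kernel on the product space and a
  fixed integrand.\<close>

lemma integral_kernel_measurable:
  fixes K :: "'a \<Rightarrow> 'b \<Rightarrow> real"
  assumes K[measurable]: "(\<lambda>(x, y). K x y) \<in> borel_measurable (M \<Otimes>\<^sub>M N)" and L[measurable]: "L \<in> M \<rightarrow>\<^sub>M subprob_algebra N"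
  shows "(\<lambda>x. \<integral>y. K x y \<partial>L x) \<in> borel_measurable M"
proof -
  note integral_measurable_subprob_algebra[measurable] measurable_distr2[measurable]
  have "(\<lambda>x. \<integral>z. (case z of (x, y) \<Rightarrow> K x y) \<partial>distr (L x) (M \<Otimes>\<^sub>M N) (\<lambda>y. (x, y))) \<in> borel_measurable M"
    by measurable
  then show ?thesis
    by (rule measurable_cong[THEN iffD1, rotated]) (simp add: integral_distr)
qed

lemma double_integral_kernel_measurable:
  fixes K :: "real^3 \<Rightarrow> real^3 \<Rightarrow> real"
  assumes K[measurable]: "(\<lambda>(v, w). K v w) \<in> borel_measurable (borel \<Otimes>\<^sub>M borel)" and L[measurable]: "L \<in> M \<rightarrow>\<^sub>M subprob_algebra borel"
  shows "(\<lambda>s. \<integral>v. (\<integral>w. K v w \<partial>L s) \<partial>L s) \<in> borel_measurable M"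
proof (rule integral_kernel_measurable[OF _ L])
  have "(\<lambda>p. \<integral>w. K (snd p) w \<partial>L (fst p)) \<in> borel_measurable (M \<Otimes>\<^sub>M borel)"
    by (rule integral_kernel_measurable[where N=borel]) measurable
  then show "(\<lambda>(s, v). \<integral>w. K v w \<partial>L s) \<in> borel_measurable (M \<Otimes>\<^sub>M borel)" by (simp add: case_prod_unfold)
qed

text \<open>For R > 0 it is 1 while |v|^2 + |w|^2 \<le> 2 R and 0 from 4 R on. The threshold is 2 R
  so that, once the cut-off acts, one of the velocities satisfies |u|^2 \<ge> R and the error is
  seen by \<open>high_moment_tail\<close> at level R.\<close>

definition cutoff :: "real \<Rightarrow> real^3 \<Rightarrow> real^3 \<Rightarrow> real" where
  "cutoff R v w = max 0 (min 1 (2 - ((norm v)\<^sup>2 + (norm w)\<^sup>2) / (2 * R)))"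

lemma cutoff_bounds: "0 \<le> cutoff R v w" "cutoff R v w \<le> 1"
  by (auto simp: cutoff_def)

lemma cutoff_measurable[measurable]: "(\<lambda>(v, w). cutoff R v w) \<in> borel_measurable (borel \<Otimes>\<^sub>M borel)"
  unfolding cutoff_def by measurable

lemma cutoff_error:
  assumes \<gamma>: "0 < \<gamma>" "\<gamma> \<le> 1" and R: "1 \<le> R" and C: "0 \<le> C"
    and G: "\<bar>G\<bar> \<le> C * (1 + norm v powr (2 + \<gamma>) + norm w powr (2 + \<gamma>))"
  shows "\<bar>G * cutoff R v w\<bar> \<le> C * (1 + 2 * (4 * R) ^ 3)"
    and "\<bar>G - G * cutoff R v w\<bar> \<le> 3 * C * (norm v powr (2 + \<gamma>) * indicator {v. R \<le> (norm v)\<^sup>2} v)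
      + 3 * C * (norm w powr (2 + \<gamma>) * indicator {v. R \<le> (norm v)\<^sup>2} w)"
proof -
  show "\<bar>G * cutoff R v w\<bar> \<le> C * (1 + 2 * (4 * R) ^ 3)"
  proof (cases "cutoff R v w = 0")
    case True
    then show ?thesis using C R by simp
  next
    case False
    then have "((norm v)\<^sup>2 + (norm w)\<^sup>2) / (2 * R) < 2" by (auto simp: cutoff_def)
    then have lt: "(norm v)\<^sup>2 + (norm w)\<^sup>2 < 4 * R" using R by (simp add: field_simps)
    have p: "norm u powr (2 + \<gamma>) \<le> (4 * R) ^ 3" if "(norm u)\<^sup>2 < 4 * R" for u :: "real^3"
    proof -
      have "norm u \<le> 4 * R"
      proof (rule ccontr)
        assume "\<not> norm u \<le> 4 * R"
        then have "(4 * R) * 1 \<le> norm u * norm u" using R by (intro mult_mono) auto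
        with that show False by (simp add: power2_eq_square)
      qed
      then have "norm u powr (2 + \<gamma>) \<le> (4 * R) powr (2 + \<gamma>)" using \<gamma> by (intro powr_mono2) auto
      also have "\<dots> \<le> (4 * R) powr 3" using R \<gamma> by (intro powr_mono) auto
      also have "\<dots> = (4 * R) ^ 3" using R by (simp add: powr_numeral)
      finally show ?thesis .
    qed
    have "\<bar>G * cutoff R v w\<bar> \<le> \<bar>G\<bar> * 1" unfolding abs_mult using cutoff_bounds[of R v w] by (intro mult_left_mono) auto
    also have "\<dots> \<le> C * (1 + norm v powr (2 + \<gamma>) + norm w powr (2 + \<gamma>))" using G by simp
    also have "\<dots> \<le> C * (1 + (4 * R) ^ 3 + (4 * R) ^ 3)"
      using lt C by (intro mult_left_mono add_mono p order.refl) (auto intro: le_less_trans[rotated])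
    also have "\<dots> = C * (1 + 2 * (4 * R) ^ 3)" by simp
    finally show ?thesis .
  qed
  define T where "T u = norm u powr (2 + \<gamma>) * indicator {v. R \<le> (norm v)\<^sup>2} u" for u :: "real^3"
  have T0: "0 \<le> T u" for u by (simp add: T_def)
  have "\<bar>G - G * cutoff R v w\<bar> \<le> 3 * C * T v + 3 * C * T w"
  proof (cases "(norm v)\<^sup>2 + (norm w)\<^sup>2 \<le> 2 * R")
    case True
    then have "((norm v)\<^sup>2 + (norm w)\<^sup>2) / (2 * R) \<le> 1" using R by simp
    then have "cutoff R v w = 1" by (simp add: cutoff_def)
    then show ?thesis using C T0 by simp
  next
    case False
    \<comment> \<open>The faster velocity a has |a|^2 \<ge> R \<ge> 1, so its power dominates each
      of the three summands; this is the 3 in the statement.\<close>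
    have big: "1 + norm a powr (2 + \<gamma>) + norm b powr (2 + \<gamma>) \<le> 3 * T a" if "norm b \<le> norm a" "2 * R < (norm a)\<^sup>2 + (norm b)\<^sup>2" for a b :: "real^3"
    proof -
      have "(norm b)\<^sup>2 \<le> (norm a)\<^sup>2" using that(1) by (intro power_mono) auto
      then have Ra: "R \<le> (norm a)\<^sup>2" using that(2) by linarith
      then have "1\<^sup>2 \<le> (norm a)\<^sup>2" using R by simp
      then have a1: "1 \<le> norm a" by (rule power2_le_imp_le) simp
      have "1 \<le> norm a powr (2 + \<gamma>)" using a1 \<gamma> by (intro ge_one_powr_ge_zero) auto
      moreover have "norm b powr (2 + \<gamma>) \<le> norm a powr (2 + \<gamma>)" using that(1) \<gamma> by (intro powr_mono2) auto
      moreover have "T a = norm a powr (2 + \<gamma>)" using Ra by (simp add: T_def)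
      ultimately show ?thesis by linarith
    qed
    have s: "1 + norm v powr (2 + \<gamma>) + norm w powr (2 + \<gamma>) \<le> 3 * T v + 3 * T w"
    proof (cases "norm w \<le> norm v")
      case True
      from big[OF this] False T0[of w] show ?thesis by simp
    next
      case F: False
      then have "norm v \<le> norm w" by simp
      from big[OF this] False T0[of v] show ?thesis by simp
    qed
    have "\<bar>G - G * cutoff R v w\<bar> = \<bar>G\<bar> * (1 - cutoff R v w)"
    proof -
      have "G - G * cutoff R v w = G * (1 - cutoff R v w)" by (simp add: right_diff_distrib)
      then show ?thesis using cutoff_bounds[of R v w] by (simp add: abs_mult)
    qed
    also have "\<dots> \<le> \<bar>G\<bar> * 1" using cutoff_bounds[of R v w] by (intro mult_left_mono) auto
    also have "\<dots> \<le> C * (1 + norm v powr (2 + \<gamma>) + norm w powr (2 + \<gamma>))" using G by simp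
    also have "\<dots> \<le> C * (3 * T v + 3 * T w)" using s C by (intro mult_left_mono) auto
    finally show ?thesis by (simp add: algebra_simps)
  qed
  then show "\<bar>G - G * cutoff R v w\<bar> \<le> 3 * C * (norm v powr (2 + \<gamma>) * indicator {v. R \<le> (norm v)\<^sup>2} v)
      + 3 * C * (norm w powr (2 + \<gamma>) * indicator {v. R \<le> (norm v)\<^sup>2} w)" by (simp add: T_def)
qed

text \<open>Stated for every kernel of growth 2 + \<gamma>, so that it serves the discrete operators
  uniformly in h as well as the limit operator. The cost is linear in the tail, which makes it
  summable over time steps.\<close>

lemma double_integral_cutoff_error:
  assumes \<mu>: "\<mu> \<in> prob_measures" and m: "moment (2 + \<gamma>) \<mu> < \<infinity>"
    and \<gamma>: "0 < \<gamma>" "\<gamma> \<le> 1" and R: "1 \<le> R" and C: "0 \<le> C"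
    and G: "\<And>v w. \<bar>G v w\<bar> \<le> C * (1 + norm v powr (2 + \<gamma>) + norm w powr (2 + \<gamma>))"
    and Gm: "(\<lambda>(v, w). G v w) \<in> borel_measurable (borel \<Otimes>\<^sub>M borel)"
  shows "\<bar>(\<integral>v. (\<integral>w. G v w \<partial>\<mu>) \<partial>\<mu>) - (\<integral>v. (\<integral>w. G v w * cutoff R v w \<partial>\<mu>) \<partial>\<mu>)\<bar> \<le> 6 * C * enn2real (high_moment_tail \<gamma> R \<mu>)"
    and "\<bar>\<integral>v. (\<integral>w. G v w \<partial>\<mu>) \<partial>\<mu>\<bar> \<le> 2 * C * (1 + enn2real (moment (2 + \<gamma>) \<mu>))"
proof -
  interpret prob_space \<mu> using prob_measuresD[OF \<mu>] by simp
  note Gm[measurable]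
  note hm = high_moments_real[OF \<mu> m \<gamma> R]
  have i0: "integrable \<mu> (\<lambda>v. C * (1 + norm v powr (2 + \<gamma>)))" using hm(1) by simp
  have n0: "0 \<le> C * (1 + norm v powr (2 + \<gamma>))" for v :: "real^3" using C by simp
  have g0: "\<bar>G v w\<bar> \<le> C * (1 + norm v powr (2 + \<gamma>)) + C * (1 + norm w powr (2 + \<gamma>))" for v w
    using G[of v w] C by (simp add: algebra_simps)
  have g1: "\<bar>G v w * cutoff R v w\<bar> \<le> C * (1 + norm v powr (2 + \<gamma>)) + C * (1 + norm w powr (2 + \<gamma>))" for v w
  proof -
    have "\<bar>G v w * cutoff R v w\<bar> \<le> \<bar>G v w\<bar> * 1" unfolding abs_mult using cutoff_bounds[of R v w] by (intro mult_left_mono) auto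
    with g0[of v w] show ?thesis by simp
  qed
  have cm: "(\<lambda>(v, w). G v w * cutoff R v w) \<in> borel_measurable (borel \<Otimes>\<^sub>M borel)" by measurable
  note b0 = double_integral_bound[OF \<mu> i0 n0 Gm g0] and b1 = double_integral_bound[OF \<mu> i0 n0 cm g1]
  show "\<bar>\<integral>v. (\<integral>w. G v w \<partial>\<mu>) \<partial>\<mu>\<bar> \<le> 2 * C * (1 + enn2real (moment (2 + \<gamma>) \<mu>))"
    using b0(2) hm(1,2) by (simp add: prob_space mult.assoc)
  have i2: "integrable \<mu> (\<lambda>v. 3 * C * (norm v powr (2 + \<gamma>) * indicator {v. R \<le> (norm v)\<^sup>2} v))" using hm(3) by simp
  have "\<bar>\<integral>v. (\<integral>w. G v w - G v w * cutoff R v w \<partial>\<mu>) \<partial>\<mu>\<bar> \<le> 2 * (\<integral>v. 3 * C * (norm v powr (2 + \<gamma>) * indicator {v. R \<le> (norm v)\<^sup>2} v) \<partial>\<mu>)"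
    by (rule double_integral_bound(2)[OF \<mu> i2 _ _ cutoff_error(2)[OF \<gamma> R C G]]) (use C in auto)
  also have "\<dots> = 6 * C * enn2real (high_moment_tail \<gamma> R \<mu>)" using hm(4) by simp
  finally show "\<bar>(\<integral>v. (\<integral>w. G v w \<partial>\<mu>) \<partial>\<mu>) - (\<integral>v. (\<integral>w. G v w * cutoff R v w \<partial>\<mu>) \<partial>\<mu>)\<bar> \<le> 6 * C * enn2real (high_moment_tail \<gamma> R \<mu>)"
    unfolding double_integral_diff[OF \<mu> b0(1) b1(1)] .
qed

lemma high_moment_tail_antimono: "R \<le> S \<Longrightarrow> high_moment_tail \<gamma> S \<mu> \<le> high_moment_tail \<gamma> R \<mu>"
  unfolding high_moment_tail_def by (intro nn_integral_mono ennreal_leI) (auto simp: indicator_def)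

text \<open>Convergence is assumed at every real time, so that measurability in time can be stated
  on the whole line.\<close>

locale landau_limit = landau_scheme +
  fixes r :: "nat \<Rightarrow> nat" and f :: "real \<Rightarrow> (real^3) measure"
  assumes r: "strict_mono r" and f: "\<And>t. f t \<in> prob_measures"
    and conv: "\<And>t. weakly_converges (\<lambda>n. F (r n) (idx (r n) t)) (f t)"
begin

lemma idx_measurable[measurable]: "idx n \<in> borel \<rightarrow>\<^sub>M count_space UNIV"
  unfolding idx_def[abs_def] by measurable

lemma step_function_measurable: "(\<lambda>t. a (idx n t)) \<in> borel_measurable borel" for a :: "nat \<Rightarrow> 'c::topological_space"
  by (rule measurable_compose[OF idx_measurable]) simp

text \<open>For bounded continuous integrands the integral against \<open>f t\<close> is a limit of
  step functions of t, hence measurable; the cut-offs by \<open>infdist\<close> pass to closed sets,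
  and these generate the Borel sets.\<close>

lemma kernel[measurable]: "f \<in> borel \<rightarrow>\<^sub>M subprob_algebra borel"
proof (rule measurable_subprob_algebra_generated[where \<Omega>=UNIV and G="Collect closed"])
  show "sets borel = sigma_sets UNIV (Collect closed)" by (simp add: borel_eq_closed)
  show "Int_stable (Collect closed)" by (auto simp: Int_stable_def)
  show "subprob_space (f t)" "sets (f t) = sets borel" for t
    by (rule prob_space_imp_subprob_space[OF prob_measuresD(1)[OF f]], rule prob_measuresD(2)[OF f])
  have "(\<lambda>t. emeasure (f t) A) \<in> borel_measurable borel" if A: "closed A" for A
  proof (cases "A = {}")
    case False
    have m: "(\<lambda>t. \<integral>v. max 0 (1 - real k * infdist v A) \<partial>f t) \<in> borel_measurable borel" for k
    proof (rule borel_measurable_LIMSEQ_real)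
      show "(\<lambda>n. \<integral>v. max 0 (1 - real k * infdist v A) \<partial>F (r n) (idx (r n) t)) \<longlonglongrightarrow> (\<integral>v. max 0 (1 - real k * infdist v A) \<partial>f t)" for t
        by (rule weakly_convergesD[OF conv _ infdist_cutoff_bounded]) (intro continuous_intros)
    qed (rule step_function_measurable)
    have "(\<lambda>t. measure (f t) A) \<in> borel_measurable borel"
      by (rule borel_measurable_LIMSEQ_real[OF _ m])
        (rule integral_infdist_tendsto_measure_closed[OF A False prob_measuresD(1,2)[OF f]])
    then show ?thesis
      using finite_measure.emeasure_eq_measure[OF prob_measuresD(4)[OF f]] by simp
  qed simp
  then show "\<And>A. A \<in> Collect closed \<Longrightarrow> (\<lambda>t. emeasure (f t) A) \<in> borel_measurable borel"
    "(\<lambda>t. emeasure (f t) UNIV) \<in> borel_measurable borel" by auto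
qed auto

lemma high_moments_measurable[measurable]:
  "(\<lambda>t. moment q (f t)) \<in> borel_measurable borel" "(\<lambda>t. high_moment_tail \<gamma> R (f t)) \<in> borel_measurable borel"
proof -
  show "(\<lambda>t. moment q (f t)) \<in> borel_measurable borel" unfolding moment_def
    by (rule measurable_compose[OF kernel nn_integral_measurable_subprob_algebra]) measurable
  have "(\<lambda>v::real^3. ennreal (norm v powr (2 + \<gamma>) * indicator {v. R \<le> (norm v)\<^sup>2} v)) \<in> borel_measurable borel" by measurable
  from measurable_compose[OF kernel nn_integral_measurable_subprob_algebra[OF this]]
  show "(\<lambda>t. high_moment_tail \<gamma> R (f t)) \<in> borel_measurable borel" unfolding high_moment_tail_def .
qed

lemma moment_2_limit: "moment 2 (f t) \<le> moment 2 f0"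
proof -
  have "moment 2 (f t) \<le> liminf (\<lambda>n. moment 2 (F (r n) (idx (r n) t)))"
    unfolding moment_2_eq by (rule weakly_converges_nn_integral_le[OF conv F(1) f]) (auto intro!: continuous_intros)
  also have "\<dots> \<le> liminf (\<lambda>n. moment 2 f0)"
    using F(2) E0 by (intro Liminf_mono) auto
  finally show ?thesis by (simp add: Liminf_const)
qed

text \<open>Fatou's lemma is used twice, for weak convergence at a fixed time and for the integral
  over time. Scheme and limit are treated in one statement because
  \<open>limit_weak_identity\<close> needs the same level R for both.\<close>

lemma uniformly_integrable_limit:
  assumes T: "0 < T" and \<epsilon>: "0 < \<epsilon>"
  shows "\<exists>R\<ge>1. (\<exists>n0. \<forall>n\<ge>n0. h n * (\<Sum>k\<le>idx n T. tail R n k) \<le> \<epsilon>) \<and>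
    (\<integral>\<^sup>+t. indicator {0..T} t * high_moment_tail \<gamma> R (f t) \<partial>lborel) \<le> ennreal \<epsilon>"
proof -
  obtain R n0 where R: "R \<ge> 1" and n0: "\<And>n. n \<ge> n0 \<Longrightarrow> h n * (\<Sum>k\<le>idx n T. tail R n k) \<le> \<epsilon>"
    using uniformly_integrable[OF T \<epsilon>] by blast
  \<comment> \<open>The tail density jumps at level R; g is continuous and lies between the tail
    densities at levels R + 1 and R, which costs one unit of level.\<close>
  define g :: "real^3 \<Rightarrow> real" where "g v = norm v powr (2 + \<gamma>) * min 1 (max 0 ((norm v)\<^sup>2 - R))" for v
  have gc: "continuous_on UNIV g" unfolding g_def using \<gamma>
    by (intro continuous_intros continuous_on_powr') auto
  have g0: "0 \<le> g v" for v by (simp add: g_def)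
  have [measurable]: "g \<in> borel_measurable borel" by (rule borel_measurable_continuous_onI[OF gc])
  have tail_fin: "high_moment_tail \<gamma> R (F n k) = ennreal (tail R n k)" for n k
  proof -
    have "high_moment_tail \<gamma> R (F n k) < \<infinity>"
      using moment_le_high_moment_tail(2)[OF F(1) \<gamma> R] F(3) by (rule le_less_trans)
    then show ?thesis by (simp add: tail_def)
  qed
  have "(\<integral>\<^sup>+t. indicator {0..T} t * high_moment_tail \<gamma> (R + 1) (f t) \<partial>lborel)
    \<le> (\<integral>\<^sup>+t. liminf (\<lambda>n. indicator {0..T} t * (\<integral>\<^sup>+v. ennreal (g v) \<partial>F (r n) (idx (r n) t))) \<partial>lborel)"
  proof (intro nn_integral_mono)
    fix t
    have "high_moment_tail \<gamma> (R + 1) (f t) \<le> (\<integral>\<^sup>+v. ennreal (g v) \<partial>f t)"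
      unfolding high_moment_tail_def by (intro nn_integral_mono ennreal_leI) (auto simp: g_def indicator_def)
    also have "\<dots> \<le> liminf (\<lambda>n. \<integral>\<^sup>+v. ennreal (g v) \<partial>F (r n) (idx (r n) t))"
      by (rule weakly_converges_nn_integral_le[OF conv F(1) f gc g0])
    finally show "indicator {0..T} t * high_moment_tail \<gamma> (R + 1) (f t)
      \<le> liminf (\<lambda>n. indicator {0..T} t * (\<integral>\<^sup>+v. ennreal (g v) \<partial>F (r n) (idx (r n) t)))"
      by (cases "t \<in> {0..T}") auto
  qed
  also have "\<dots> \<le> liminf (\<lambda>n. \<integral>\<^sup>+t. indicator {0..T} t * (\<integral>\<^sup>+v. ennreal (g v) \<partial>F (r n) (idx (r n) t)) \<partial>lborel)"
  proof (rule nn_integral_liminf)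
    fix n
    have "(\<lambda>t. \<integral>\<^sup>+v. ennreal (g v) \<partial>F (r n) (idx (r n) t)) \<in> borel_measurable borel"
      by (rule step_function_measurable)
    then show "(\<lambda>t. indicator {0..T} t * (\<integral>\<^sup>+v. ennreal (g v) \<partial>F (r n) (idx (r n) t))) \<in> borel_measurable lborel" by measurable
  qed
  also have "\<dots> \<le> liminf (\<lambda>n. ennreal \<epsilon>)"
  proof (rule Liminf_mono)
    have "(\<integral>\<^sup>+t. indicator {0..T} t * (\<integral>\<^sup>+v. ennreal (g v) \<partial>F n (idx n t)) \<partial>lborel) \<le> ennreal \<epsilon>" if n: "n \<ge> n0" for n
    proof -
      \<comment> \<open>One more than the completed steps, so that the step intervals cover [0, T]
        including the unfinished last step.\<close>
      define N where "N = Suc (idx n T)"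
      have TN: "T < real N * h n" using idx_bounds(2)[of T n] T by (simp add: N_def distrib_left distrib_right mult.commute)
      have pt: "indicator {0..T} t * (\<integral>\<^sup>+v. ennreal (g v) \<partial>F n (idx n t)) \<le> ennreal (indicator {0..<real N * h n} t * tail R n (idx n t))" for t
      proof (cases "t \<in> {0..T}")
        case True
        have "(\<integral>\<^sup>+v. ennreal (g v) \<partial>F n (idx n t)) \<le> high_moment_tail \<gamma> R (F n (idx n t))"
          unfolding high_moment_tail_def
          by (intro nn_integral_mono ennreal_leI) (auto simp: g_def indicator_def mult_left_le)
        with True TN show ?thesis by (simp add: tail_fin)
      qed simp
      note hb = step_function_integral[OF h(1)[of n], of N "tail R n", folded idx_def]
      have "(\<integral>\<^sup>+t. indicator {0..T} t * (\<integral>\<^sup>+v. ennreal (g v) \<partial>F n (idx n t)) \<partial>lborel)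
        \<le> (\<integral>\<^sup>+t. ennreal (indicator {0..<real N * h n} t * tail R n (idx n t)) \<partial>lborel)"
        by (intro nn_integral_mono pt)
      also have "\<dots> = ennreal (h n * (\<Sum>k<N. tail R n k))"
      proof -
        have "integrable lborel (\<lambda>t. indicator {0..<real N * h n} t * tail R n (idx n t))"
          "(\<integral>t. indicator {0..<real N * h n} t * tail R n (idx n t) \<partial>lborel) = h n * (\<Sum>k<N. tail R n k)"
          using hb by (simp_all only: has_bochner_integral_iff)
        then show ?thesis using nn_integral_eq_integral[of lborel "\<lambda>t. indicator {0..<real N * h n} t * tail R n (idx n t)"]
          by (simp only: tail_nonneg mult_nonneg_nonneg indicator_pos_le AE_I2)
      qed
      also have "\<dots> \<le> ennreal \<epsilon>" using n0[OF n] by (intro ennreal_leI) (simp add: N_def lessThan_Suc_atMost)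
      finally show ?thesis .
    qed
    then show "\<forall>\<^sub>F n in sequentially. (\<integral>\<^sup>+t. indicator {0..T} t * (\<integral>\<^sup>+v. ennreal (g v) \<partial>F (r n) (idx (r n) t)) \<partial>lborel) \<le> ennreal \<epsilon>"
      unfolding eventually_sequentially using le_trans[OF _ seq_suble[OF r]] by blast
  qed
  also have "\<dots> = ennreal \<epsilon>" by (simp add: Liminf_const)
  finally have 1: "(\<integral>\<^sup>+t. indicator {0..T} t * high_moment_tail \<gamma> (R + 1) (f t) \<partial>lborel) \<le> ennreal \<epsilon>" .
  have "h n * (\<Sum>k\<le>idx n T. tail (R + 1) n k) \<le> \<epsilon>" if "n \<ge> n0" for n
  proof -
    have "tail (R + 1) n k \<le> tail R n k" for k
      unfolding tail_def using high_moment_tail_antimono[of R "R + 1" \<gamma> "F n k"] tail_fin[of n k]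
      by (intro enn2real_mono) auto
    then have "h n * (\<Sum>k\<le>idx n T. tail (R + 1) n k) \<le> h n * (\<Sum>k\<le>idx n T. tail R n k)"
      using h(1)[of n] by (intro mult_left_mono sum_mono) auto
    with n0[OF that] show ?thesis by linarith
  qed
  with 1 R show ?thesis by (intro exI[of _ "R + 1"]) auto
qed

lemma moment_integral_finite:
  assumes T: "0 < T"
  shows "(\<integral>\<^sup>+t. indicator {0..T} t * moment (2 + \<gamma>) (f t) \<partial>lborel) < \<infinity>"
proof -
  obtain R where R: "R \<ge> 1" "(\<integral>\<^sup>+t. indicator {0..T} t * high_moment_tail \<gamma> R (f t) \<partial>lborel) \<le> ennreal 1"
    using uniformly_integrable_limit[OF T zero_less_one] by blast
  have "(\<integral>\<^sup>+t. indicator {0..T} t * moment (2 + \<gamma>) (f t) \<partial>lborel)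
    \<le> (\<integral>\<^sup>+t. ennreal (R ^ 3) * indicator {0..T} t + indicator {0..T} t * high_moment_tail \<gamma> R (f t) \<partial>lborel)"
    using moment_le_high_moment_tail(1)[OF f \<gamma> R(1)] by (intro nn_integral_mono) (auto simp: indicator_def)
  also have "\<dots> = ennreal (R ^ 3) * ennreal T + (\<integral>\<^sup>+t. indicator {0..T} t * high_moment_tail \<gamma> R (f t) \<partial>lborel)"
    using T by (subst nn_integral_add) (auto simp: nn_integral_cmult_indicator)
  also have "\<dots> \<le> ennreal (R ^ 3) * ennreal T + ennreal 1" using R(2) by (rule add_left_mono)
  also have "\<dots> < \<infinity>" by (simp add: ennreal_mult_less_top)
  finally show ?thesis .
qed

lemma cutoff_tendsto:
  assumes "x \<longlonglongrightarrow> v" "y \<longlonglongrightarrow> w" "0 < R"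
  shows "(\<lambda>n. cutoff R (x n) (y n)) \<longlonglongrightarrow> cutoff R v w"
  unfolding cutoff_def using assms by (intro tendsto_intros) auto

text \<open>With the cut-off the kernels are bounded uniformly in n:
  \<open>weakly_converges_double_integral\<close> applies at each time, and dominated convergence
  applies to the step functions in time.\<close>

lemma cutoff_drift_converges:
  assumes \<phi>: "\<phi> \<in> C2b" and t: "0 \<le> t" and R: "1 \<le> R"
    and C: "0 \<le> C" "\<And>h v w. h > 0 \<Longrightarrow> \<bar>discrete_L \<gamma> h \<phi> v w\<bar> \<le> C * (1 + norm v powr (2 + \<gamma>) + norm w powr (2 + \<gamma>))"
  defines "d \<equiv> \<lambda>n k. \<integral>v. (\<integral>w. discrete_L \<gamma> (h n) \<phi> v w * cutoff R v w \<partial>F n k) \<partial>F n k"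
    and "A \<equiv> \<lambda>s. \<integral>v. (\<integral>w. landau_L \<gamma> \<phi> v w * cutoff R v w \<partial>f s) \<partial>f s"
  shows "(\<lambda>n. h (r n) * (\<Sum>k<idx (r n) t. d (r n) k)) \<longlonglongrightarrow> (\<integral>s. indicator {0..t} s * A s \<partial>lborel)"
    and "integrable lborel (\<lambda>s. indicator {0..t} s * A s)"
proof -
  define B where "B = C * (1 + 2 * (4 * R) ^ 3)"
  have B: "0 \<le> B" using C R by (simp add: B_def)
  have gb: "\<bar>discrete_L \<gamma> (h n) \<phi> v w * cutoff R v w\<bar> \<le> B" for n v w
    unfolding B_def by (rule cutoff_error(1)[OF \<gamma> R C(1) C(2)[OF h(1)]])
  have lb: "\<bar>landau_L \<gamma> \<phi> v w * cutoff R v w\<bar> \<le> B" for v w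
    unfolding B_def by (rule cutoff_error(1)[OF \<gamma> R C(1) landau_L_bound[OF \<phi> \<gamma>(1) C(2)]])
  note discrete_L_measurable[OF \<phi>, measurable] landau_L_measurable[OF \<phi> \<gamma>(1), measurable]
  have lim: "(\<lambda>n. d (r n) (idx (r n) s)) \<longlonglongrightarrow> A s" for s
    unfolding d_def A_def
  proof (rule weakly_converges_double_integral[OF conv F(1) f F(2) _ _ _ gb])
    show "ennreal E0 < \<infinity>" by simp
    fix u :: "nat \<Rightarrow> nat" and x y :: "nat \<Rightarrow> real^3" and v w :: "real^3"
    assume u: "strict_mono u" and xy: "x \<longlonglongrightarrow> v" "y \<longlonglongrightarrow> w"
    have "(\<lambda>n. h (r (u n))) \<longlonglongrightarrow> 0"
      using LIMSEQ_subseq_LIMSEQ[OF h_tendsto strict_mono_o[OF r u]] by (simp add: o_def)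
    then have "(\<lambda>n. discrete_L \<gamma> (h (r (u n))) \<phi> (x n) (y n)) \<longlonglongrightarrow> landau_L \<gamma> \<phi> v w"
      by (rule discrete_L_tendsto[OF \<phi> \<gamma>(1) h(1) _ xy])
    then show "(\<lambda>n. discrete_L \<gamma> (h (r (u n))) \<phi> (x n) (y n) * cutoff R (x n) (y n)) \<longlonglongrightarrow> landau_L \<gamma> \<phi> v w * cutoff R v w"
      using R by (intro tendsto_mult cutoff_tendsto xy) auto
  qed measurable
  have dB: "\<bar>d n k\<bar> \<le> B" for n k
  proof -
    interpret prob_space "F n k" using prob_measuresD[OF F(1)] by simp
    have "\<bar>d n k\<bar> \<le> 2 * (\<integral>v. B / 2 \<partial>F n k)"
      unfolding d_def by (rule double_integral_bound(2)[OF F(1)]) (use gb B in auto)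
    then show ?thesis by (simp add: prob_space)
  qed
  have Am: "A \<in> borel_measurable borel"
    unfolding A_def by (rule double_integral_kernel_measurable[OF _ kernel]) measurable
  have AB: "\<bar>A s\<bar> \<le> B" for s
    by (rule LIMSEQ_le_const2[OF tendsto_rabs[OF lim]]) (use dB in auto)
  have sm: "(\<lambda>s. indicator {0..<real (idx n t) * h n} s * d n (idx n s)) \<in> borel_measurable lborel" for n
  proof -
    have "(\<lambda>s. d n (idx n s)) \<in> borel_measurable borel" by (rule step_function_measurable)
    then show ?thesis by measurable
  qed
  have Nt: "real (idx n t) * h n \<le> t" for n using idx_bounds(1)[OF t, of n] by (simp add: mult.commute)
  have hb: "has_bochner_integral lborel (\<lambda>s. indicator {0..<real (idx n t) * h n} s * d n (idx n s)) (h n * (\<Sum>k<idx n t. d n k))" for n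
    using step_function_integral[OF h(1)[of n], of "idx n t" "d n"] unfolding idx_def .
  have "(\<lambda>n. \<integral>s. indicator {0..<real (idx (r n) t) * h (r n)} s * d (r n) (idx (r n) s) \<partial>lborel) \<longlonglongrightarrow> (\<integral>s. indicator {0..t} s * A s \<partial>lborel)"
  proof (rule integral_dominated_convergence[where w="\<lambda>s. indicator {0..t} s * B"])
    show "(\<lambda>s. indicator {0..t} s * A s) \<in> borel_measurable lborel" using Am by measurable
    show "(\<lambda>s. indicator {0..<real (idx (r n) t) * h (r n)} s * d (r n) (idx (r n) s)) \<in> borel_measurable lborel" for n by (rule sm)
    show "integrable lborel (\<lambda>s. indicator {0..t} s * B)"
      using t by (intro integrable_mult_left integrable_real_indicator) auto
    show "AE s in lborel. norm (indicator {0..<real (idx (r n) t) * h (r n)} s * d (r n) (idx (r n) s)) \<le> indicator {0..t} s * B" for n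
      using dB B Nt[of "r n"] by (intro AE_I2) (auto simp: indicator_def abs_mult)
    show "AE s in lborel. (\<lambda>n. indicator {0..<real (idx (r n) t) * h (r n)} s * d (r n) (idx (r n) s)) \<longlonglongrightarrow> indicator {0..t} s * A s"
      \<comment> \<open>At s = t the half-open indicators are all 0 while the limit indicator is 1;
        this single time is discarded.\<close>
      using AE_lborel_singleton[of t]
    proof eventually_elim
      case (elim s)
      have "(\<lambda>n. indicator {0..<real (idx (r n) t) * h (r n)} s :: real) \<longlonglongrightarrow> indicator {0..t} s"
      proof (cases "0 \<le> s \<and> s < t")
        case True
        then have "\<forall>\<^sub>F n in sequentially. h n < t - s" using order_tendstoD(2)[OF h_tendsto, of "t - s"] by simp
        then have "\<forall>\<^sub>F n in sequentially. h (r n) < t - s"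
          unfolding eventually_sequentially using le_trans[OF _ seq_suble[OF r]] by blast
        then have "\<forall>\<^sub>F n in sequentially. indicator {0..<real (idx (r n) t) * h (r n)} s = (indicator {0..t} s :: real)"
        proof eventually_elim
          case (elim n)
          then have "s < real (idx (r n) t) * h (r n)" using idx_bounds(2)[OF t, of "r n"] by (simp add: mult.commute)
          then show ?case using True by simp
        qed
        then show ?thesis by (rule tendsto_eventually)
      next
        case False
        have "indicator {0..<real (idx (r n) t) * h (r n)} s = (0 :: real)" for n
          using False Nt[of "r n"] elim by auto
        moreover have "indicator {0..t} s = (0 :: real)" using False elim by auto
        ultimately show ?thesis by simp
      qed
      then show ?case by (intro tendsto_mult lim)
    qed
  qed
  then show "(\<lambda>n. h (r n) * (\<Sum>k<idx (r n) t. d (r n) k)) \<longlonglongrightarrow> (\<integral>s. indicator {0..t} s * A s \<partial>lborel)"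
    using has_bochner_integral_integral_eq[OF hb] by simp
  show "integrable lborel (\<lambda>s. indicator {0..t} s * A s)"
  proof (rule Bochner_Integration.integrable_bound)
    show "integrable lborel (\<lambda>s. indicator {0..t} s * B)"
      using t by (intro integrable_mult_left integrable_real_indicator) auto
    show "(\<lambda>s. indicator {0..t} s * A s) \<in> borel_measurable lborel" using Am by measurable
    show "AE s in lborel. norm (indicator {0..t} s * A s) \<le> norm (indicator {0..t} s * B)"
      using AB B by (intro AE_I2) (auto simp: indicator_def)
  qed
qed

lemma action_measurable:
  assumes \<phi>: "\<phi> \<in> C2b"
  shows "(\<lambda>s. landau_action \<gamma> \<phi> (f s)) \<in> borel_measurable borel"
  unfolding landau_action_def
  by (rule double_integral_kernel_measurable[OF landau_L_measurable[OF \<phi> \<gamma>(1)] kernel])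

lemma action_integrable:
  assumes \<phi>: "\<phi> \<in> C2b" and t: "0 < t"
  shows "integrable lborel (\<lambda>s. indicator {0..t} s * landau_action \<gamma> \<phi> (f s))"
proof (rule integrableI_bounded)
  obtain C where C: "C \<ge> 0" "\<And>h v w. h > 0 \<Longrightarrow> \<bar>discrete_L \<gamma> h \<phi> v w\<bar> \<le> C * (1 + norm v powr (2 + \<gamma>) + norm w powr (2 + \<gamma>))"
    using discrete_L_bound[OF \<phi> \<gamma>] by blast
  show "(\<lambda>s. indicator {0..t} s * landau_action \<gamma> \<phi> (f s)) \<in> borel_measurable lborel"
    using action_measurable[OF \<phi>] by measurable
  \<comment> \<open>The coefficient is 2 C + 1 rather than 2 C so that it stays positive: at times
    of infinite moment the right side is then infinite even if C = 0. The same device appears in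
    \<open>action_cutoff_error\<close>.\<close>
  have "(\<integral>\<^sup>+s. ennreal (norm (indicator {0..t} s * landau_action \<gamma> \<phi> (f s))) \<partial>lborel)
    \<le> (\<integral>\<^sup>+s. ennreal (2 * C + 1) * (indicator {0..t} s + indicator {0..t} s * moment (2 + \<gamma>) (f s)) \<partial>lborel)"
  proof (intro nn_integral_mono)
    fix s
    show "ennreal (norm (indicator {0..t} s * landau_action \<gamma> \<phi> (f s)))
      \<le> ennreal (2 * C + 1) * (indicator {0..t} s + indicator {0..t} s * moment (2 + \<gamma>) (f s))"
    proof (cases "s \<in> {0..t} \<and> moment (2 + \<gamma>) (f s) < \<infinity>")
      case False
      then show ?thesis using C by (auto simp: indicator_def ennreal_mult_top top_unique less_top[symmetric] ennreal_top_mult)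
    next
      case True
      then obtain z where z: "moment (2 + \<gamma>) (f s) = ennreal z" "0 \<le> z" by (cases "moment (2 + \<gamma>) (f s)") auto
      have "\<bar>landau_action \<gamma> \<phi> (f s)\<bar> \<le> 2 * C * (1 + z)"
        using double_integral_cutoff_error(2)[OF f _ \<gamma> order.refl C(1) landau_L_bound[OF \<phi> \<gamma>(1) C(2)] landau_L_measurable[OF \<phi> \<gamma>(1)], of s] True z
        by (simp add: landau_action_def)
      also have "\<dots> \<le> (2 * C + 1) * (1 + z)" using z by (intro mult_right_mono) auto
      finally have "ennreal \<bar>landau_action \<gamma> \<phi> (f s)\<bar> \<le> ennreal ((2 * C + 1) * (1 + z))" by (rule ennreal_leI)
      also have "\<dots> = ennreal (2 * C + 1) * (1 + ennreal z)" using C z by (simp add: ennreal_mult)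
      finally show ?thesis using True z by simp
    qed
  qed
  also have "\<dots> = ennreal (2 * C + 1) * (ennreal t + (\<integral>\<^sup>+s. indicator {0..t} s * moment (2 + \<gamma>) (f s) \<partial>lborel))"
    using t by (simp add: nn_integral_cmult nn_integral_add)
  also have "\<dots> < \<infinity>"
    using moment_integral_finite[OF t] by (simp add: ennreal_mult_less_top)
  finally show "(\<integral>\<^sup>+s. ennreal (norm (indicator {0..t} s * landau_action \<gamma> \<phi> (f s))) \<partial>lborel) < \<infinity>" .
qed

lemma action_cutoff_error:
  assumes \<phi>: "\<phi> \<in> C2b" and t: "0 < t" and R: "1 \<le> R" and C: "0 \<le> C"
    "\<And>h v w. h > 0 \<Longrightarrow> \<bar>discrete_L \<gamma> h \<phi> v w\<bar> \<le> C * (1 + norm v powr (2 + \<gamma>) + norm w powr (2 + \<gamma>))"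
    and tail: "(\<integral>\<^sup>+s. indicator {0..t} s * high_moment_tail \<gamma> R (f s) \<partial>lborel) \<le> ennreal \<epsilon>" and \<epsilon>: "0 < \<epsilon>"
  defines "A \<equiv> \<lambda>s. \<integral>v. (\<integral>w. landau_L \<gamma> \<phi> v w * cutoff R v w \<partial>f s) \<partial>f s"
  shows "\<bar>(\<integral>s. indicator {0..t} s * landau_action \<gamma> \<phi> (f s) \<partial>lborel) - (\<integral>s. indicator {0..t} s * A s \<partial>lborel)\<bar> \<le> (6 * C + 1) * \<epsilon>"
proof -
  have i1: "integrable lborel (\<lambda>s. indicator {0..t} s * landau_action \<gamma> \<phi> (f s))" by (rule action_integrable[OF \<phi> t])
  have i2: "integrable lborel (\<lambda>s. indicator {0..t} s * A s)"
    unfolding A_def by (rule cutoff_drift_converges(2)[OF \<phi> less_imp_le[OF t] R C])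
  define D where "D s = indicator {0..t} s * landau_action \<gamma> \<phi> (f s) - indicator {0..t} s * A s" for s
  have i3: "integrable lborel D" unfolding D_def using i1 i2 by (rule Bochner_Integration.integrable_diff)
  have pt: "ennreal (norm (D s)) \<le> ennreal (6 * C + 1) * (indicator {0..t} s * high_moment_tail \<gamma> R (f s))" for s
  proof (cases "s \<in> {0..t} \<and> high_moment_tail \<gamma> R (f s) < \<infinity>")
    case False
    then show ?thesis using C by (auto simp: D_def indicator_def less_top[symmetric] ennreal_mult_top ennreal_top_mult)
  next
    case True
    then obtain z where z: "high_moment_tail \<gamma> R (f s) = ennreal z" "0 \<le> z" by (cases "high_moment_tail \<gamma> R (f s)") auto
    have "moment (2 + \<gamma>) (f s) < \<infinity>"
      using moment_le_high_moment_tail(1)[OF f \<gamma> R, of s] z by (auto intro: le_less_trans)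
    from double_integral_cutoff_error(1)[OF f this \<gamma> R C(1) landau_L_bound[OF \<phi> \<gamma>(1) C(2)] landau_L_measurable[OF \<phi> \<gamma>(1)]]
    have "norm (D s) \<le> 6 * C * z" using True z by (simp add: D_def A_def landau_action_def)
    also have "\<dots> \<le> (6 * C + 1) * z" using z by (intro mult_right_mono) auto
    finally have "ennreal (norm (D s)) \<le> ennreal ((6 * C + 1) * z)" by (rule ennreal_leI)
    then show ?thesis using True z C by (simp add: ennreal_mult)
  qed
  have "ennreal (norm (\<integral>s. D s \<partial>lborel)) \<le> (\<integral>\<^sup>+s. ennreal (norm (D s)) \<partial>lborel)"
    by (rule integral_norm_bound_ennreal[OF i3])
  also have "\<dots> \<le> (\<integral>\<^sup>+s. ennreal (6 * C + 1) * (indicator {0..t} s * high_moment_tail \<gamma> R (f s)) \<partial>lborel)"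
    by (intro nn_integral_mono pt)
  also have "\<dots> = ennreal (6 * C + 1) * (\<integral>\<^sup>+s. indicator {0..t} s * high_moment_tail \<gamma> R (f s) \<partial>lborel)"
    by (rule nn_integral_cmult) measurable
  also have "\<dots> \<le> ennreal (6 * C + 1) * ennreal \<epsilon>" by (intro mult_left_mono tail) auto
  also have "\<dots> = ennreal ((6 * C + 1) * \<epsilon>)" using C \<epsilon> by (simp add: ennreal_mult)
  finally have "norm (\<integral>s. D s \<partial>lborel) \<le> (6 * C + 1) * \<epsilon>"
    using C(1) \<epsilon> by (subst (asm) ennreal_le_iff) auto
  moreover have "(\<integral>s. D s \<partial>lborel) = (\<integral>s. indicator {0..t} s * landau_action \<gamma> \<phi> (f s) \<partial>lborel) - (\<integral>s. indicator {0..t} s * A s \<partial>lborel)"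
    unfolding D_def by (rule Bochner_Integration.integral_diff[OF i1 i2])
  ultimately show ?thesis by simp
qed

text \<open>Scheme and limit are compared through the cut-off kernel: the drift of the scheme
  changes by at most 6 C \<epsilon>, the cut-off drifts converge, and the action of the limit
  changes by at most (6 C + 1) \<epsilon>.\<close>

lemma limit_weak_identity:
  assumes \<phi>: "\<phi> \<in> C2b" and t: "0 < t"
  shows "(\<integral>v. \<phi> v \<partial>f t) - (\<integral>v. \<phi> v \<partial>f 0) = (\<integral>s. indicator {0..t} s * landau_action \<gamma> \<phi> (f s) \<partial>lborel)"
proof -
  obtain C where C: "C \<ge> 0" "\<And>h v w. h > 0 \<Longrightarrow> \<bar>discrete_L \<gamma> h \<phi> v w\<bar> \<le> C * (1 + norm v powr (2 + \<gamma>) + norm w powr (2 + \<gamma>))"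
    using discrete_L_bound[OF \<phi> \<gamma>] by blast
  have \<phi>b: "continuous_on UNIV \<phi>" "bounded (range \<phi>)"
    using C2b_continuous[OF \<phi>] \<phi> by (simp_all add: C2b_def)
  define X where "X = (\<integral>v. \<phi> v \<partial>f t) - (\<integral>v. \<phi> v \<partial>f 0)"
  define Y where "Y = (\<integral>s. indicator {0..t} s * landau_action \<gamma> \<phi> (f s) \<partial>lborel)"
  have "\<bar>X - Y\<bar> \<le> (12 * C + 1) * \<epsilon>" if \<epsilon>: "0 < \<epsilon>" for \<epsilon>
  proof -
    obtain R n0 where R: "R \<ge> 1" and n0: "\<And>n. n \<ge> n0 \<Longrightarrow> h n * (\<Sum>k\<le>idx n t. tail R n k) \<le> \<epsilon>"
      and tl: "(\<integral>\<^sup>+s. indicator {0..t} s * high_moment_tail \<gamma> R (f s) \<partial>lborel) \<le> ennreal \<epsilon>"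
      using uniformly_integrable_limit[OF t \<epsilon>] by blast
    define d where "d n k = (\<integral>v. (\<integral>w. discrete_L \<gamma> (h n) \<phi> v w * cutoff R v w \<partial>F n k) \<partial>F n k)" for n k
    define Z where "Z = (\<integral>s. indicator {0..t} s * (\<integral>v. (\<integral>w. landau_L \<gamma> \<phi> v w * cutoff R v w \<partial>f s) \<partial>f s) \<partial>lborel)"
    have YZ: "\<bar>Y - Z\<bar> \<le> (6 * C + 1) * \<epsilon>" unfolding Y_def Z_def by (rule action_cutoff_error[OF \<phi> t R C tl \<epsilon>])
    have lz: "(\<lambda>n. h (r n) * (\<Sum>k<idx (r n) t. d (r n) k)) \<longlonglongrightarrow> Z"
      unfolding Z_def d_def by (rule cutoff_drift_converges(1)[OF \<phi> less_imp_le[OF t] R C])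
    have "(\<lambda>n. (\<integral>v. \<phi> v \<partial>F (r n) (idx (r n) t)) - (\<integral>v. \<phi> v \<partial>F (r n) (idx (r n) 0))) \<longlonglongrightarrow> X"
      unfolding X_def by (intro tendsto_diff weakly_convergesD[OF conv \<phi>b])
    moreover have "idx n 0 = 0" for n by (simp add: idx_def)
    ultimately have lx: "(\<lambda>n. h (r n) * (\<Sum>k<idx (r n) t. drift (r n) k \<phi>)) \<longlonglongrightarrow> X"
      by (simp add: weak_identity[OF \<phi>])
    have close: "\<bar>h n * (\<Sum>k<idx n t. drift n k \<phi>) - h n * (\<Sum>k<idx n t. d n k)\<bar> \<le> 6 * C * \<epsilon>" if n: "n \<ge> n0" for n
    proof -
      have "\<bar>(\<Sum>k<idx n t. drift n k \<phi>) - (\<Sum>k<idx n t. d n k)\<bar> \<le> (\<Sum>k<idx n t. 6 * C * tail R n k)"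
        unfolding sum_subtractf[symmetric] drift_def d_def tail_def
        by (intro order_trans[OF sum_abs] sum_mono double_integral_cutoff_error(1)[OF F(1,3) \<gamma> R C(1) C(2)[OF h(1)] discrete_L_measurable[OF \<phi>]])
      also have "\<dots> \<le> (\<Sum>k\<le>idx n t. 6 * C * tail R n k)"
        using C tail_nonneg by (intro sum_mono2) auto
      also have "\<dots> = 6 * C * (\<Sum>k\<le>idx n t. tail R n k)" by (simp add: sum_distrib_left)
      finally have "h n * \<bar>(\<Sum>k<idx n t. drift n k \<phi>) - (\<Sum>k<idx n t. d n k)\<bar> \<le> h n * (6 * C * (\<Sum>k\<le>idx n t. tail R n k))"
        using h(1)[of n] by (intro mult_left_mono) auto
      also have "\<dots> = 6 * C * (h n * (\<Sum>k\<le>idx n t. tail R n k))" by simp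
      also have "\<dots> \<le> 6 * C * \<epsilon>" using C n0[OF n] by (intro mult_left_mono) auto
      finally show ?thesis using h(1)[of n] by (simp add: abs_mult right_diff_distrib[symmetric])
    qed
    have "\<bar>X - Z\<bar> \<le> 6 * C * \<epsilon>"
    proof (rule LIMSEQ_le_const2[OF tendsto_rabs[OF tendsto_diff[OF lx lz]]], intro exI[of _ n0] allI impI)
      fix n assume "n0 \<le> n"
      then show "\<bar>h (r n) * (\<Sum>k<idx (r n) t. drift (r n) k \<phi>) - h (r n) * (\<Sum>k<idx (r n) t. d (r n) k)\<bar> \<le> 6 * C * \<epsilon>"
        by (intro close le_trans[OF _ seq_suble[OF r]])
    qed
    moreover have "(12 * C + 1) * \<epsilon> = 6 * C * \<epsilon> + (6 * C + 1) * \<epsilon>" by (simp add: algebra_simps)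
    ultimately show ?thesis using YZ by linarith
  qed
  note small = this
  have "X = Y"
  proof (rule ccontr)
    assume "X \<noteq> Y"
    then have p: "0 < \<bar>X - Y\<bar>" by simp
    have "\<bar>X - Y\<bar> \<le> (12 * C + 1) * (\<bar>X - Y\<bar> / (2 * (12 * C + 1)))"
      using p C(1) by (intro small) (auto intro!: divide_pos_pos)
    also have "\<dots> = \<bar>X - Y\<bar> / 2" using C(1) by (simp add: field_simps)
    finally have "\<bar>X - Y\<bar> \<le> \<bar>X - Y\<bar> / 2" .
    moreover have "\<not> a \<le> a / 2" if "0 < a" for a :: real using that by simp
    ultimately show False using p by blast
  qed
  then show ?thesis by (simp add: X_def Y_def)
qed

end

theorem theorem3:
  fixes \<gamma> :: real and f0 :: "(real^3) measure"
  assumes "\<gamma> \<in> {0<..1}" and "f0 \<in> prob_measures_moment 2"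
  shows "\<exists>f. landau_weak_solution \<gamma> f \<and> f 0 = f0"
proof -
  interpret landau_scheme \<gamma> f0
    using assms by unfold_locales (auto simp: prob_measures_moment_def)
  obtain r :: "nat \<Rightarrow> nat" and g where r: "strict_mono r" and g: "\<forall>t\<ge>0. g t \<in> prob_measures \<and> weakly_converges (\<lambda>n. F (r n) (idx (r n) t)) (g t)"
    using limit_exists by blast
  \<comment> \<open>Constant extension to negative times, matching \<open>idx\<close>, which is 0
    there.\<close>
  define f where "f t = g (max 0 t)" for t :: real
  have idx: "idx n (max 0 t) = idx n t" for n t
    using h(1)[of n] divide_nonpos_pos[of t "h n"] by (cases "0 \<le> t") (auto simp: idx_def max_def)
  interpret landau_limit \<gamma> f0 r f
  proof
    fix t :: real
    have "0 \<le> max 0 t" by simp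
    then show "f t \<in> prob_measures" "weakly_converges (\<lambda>n. F (r n) (idx (r n) t)) (f t)"
      using g[rule_format, of "max 0 t"] unfolding f_def idx by auto
  qed (rule r)
  have f_0: "f 0 = f0" by (rule initial_limit[OF r conv f])
  have "landau_weak_solution \<gamma> f"
    unfolding landau_weak_solution_def
  proof (intro conjI allI impI ballI)
    show "f t \<in> prob_measures" for t by (rule f)
    show "(\<lambda>t. moment (2 + \<gamma>) (f t)) \<in> borel_measurable (restrict_space borel {0..})"
      by (intro measurable_restrict_space1 high_moments_measurable)
    show "moment 2 (f t) \<le> moment 2 (f 0)" for t unfolding f_0 by (rule moment_2_limit)
    fix T :: real assume T: "0 < T"
    have "(SUP t\<in>{0..T}. moment 2 (f t)) \<le> moment 2 f0" by (intro SUP_least moment_2_limit)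
    then have "(SUP t\<in>{0..T}. moment 2 (f t)) < \<infinity>" using f0_2 by (rule le_less_trans)
    then show "(SUP t\<in>{0..T}. moment 2 (f t)) + (\<integral>\<^sup>+t\<in>{0..T}. moment (2 + \<gamma>) (f t) \<partial>lborel) < \<infinity>"
      using moment_integral_finite[OF T] by (simp add: mult.commute)
  next
    fix \<phi> :: "real^3 \<Rightarrow> real" and t :: real assume \<phi>: "\<phi> \<in> C2b" and t: "0 \<le> t"
    \<comment> \<open>\<open>action_integrable\<close> asks for a positive endpoint; the longer
      interval also covers t = 0.\<close>
    have "set_integrable lborel {0..t + 1} (\<lambda>s. landau_action \<gamma> \<phi> (f s))"
      using action_integrable[OF \<phi>, of "t + 1"] t by (simp add: set_integrable_def)
    then show "set_integrable lborel {0..t} (\<lambda>s. landau_action \<gamma> \<phi> (f s))"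
      by (rule set_integrable_subset) auto
    show "(\<integral>v. \<phi> v \<partial>f t) = (\<integral>v. \<phi> v \<partial>f 0) + (LINT s:{0..t}|lborel. landau_action \<gamma> \<phi> (f s))"
    proof (cases "t = 0")
      case True
      have "(LINT s:{0..0}|lborel. landau_action \<gamma> \<phi> (f s)) = 0"
        unfolding set_lebesgue_integral_def using AE_lborel_singleton[of 0]
        by (intro integral_eq_zero_AE) (auto elim!: eventually_mono)
      with True show ?thesis by simp
    next
      case False
      then show ?thesis
        using limit_weak_identity[OF \<phi>, of t] t by (simp add: set_lebesgue_integral_def)
    qed
  qed
  with f_0 show ?thesis by blast
qed

end
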